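(* Let $\{u^\nu\}_\nu, \{f^\nu\}_\nu\subset C^\infty (\mathbb{T}^2)$ be vector fields related by the stationary Navier--Stokes equations $$\operatorname{div} (u^\nu \otimes u^\nu) +\nabla p^\nu=\nu \Delta u^\nu + f^\nu,\qquad \operatorname{div} u^\nu=0 \qquad \text{on } \mathbb{T}^2$$ (for some pressure $p^\nu$). Assume that, as $\nu\to 0$, $u^\nu\rightharpoonup u$ and $f^\nu\rightharpoonup f$ in $L^2(\mathbb{T}^2)$, and that $|u^\nu-u|^2\overset{*}{\rightharpoonup} \Lambda$, $|f^\nu-f|^2\overset{*}{\rightharpoonup} F$ and $\nu |\nabla u^\nu|^2\overset{*}{\rightharpoonup} D$ in $\mathcal M(\mathbb{T}^2)$. Then $D\ll \Lambda$ and $$F=0 \qquad \Longrightarrow \qquad D=0.$$ In addition, assume that $|\omega^\nu|\overset{*}{\rightharpoonup} \Omega$ in $\mathcal M(\mathbb{T}^2)$, where $\omega^\nu=\operatorname{curl}u^\nu$, and denote by $\mathscr L$ and $\mathscr O$ the sets of atoms of $\Lambda$ and $\Omega$ respectively. Then $D=D\llcorner \left( \mathscr L \cap \mathscr O\right)$.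
   Context: $\mathbb{T}^2$ is the two-dimensional flat torus; $\operatorname{curl}v=\partial_1v_2-\partial_2v_1$. $\mathcal M(\mathbb{T}^2)$ is the space of finite Borel measures on $\mathbb{T}^2$. $\mu\ll\lambda$ means that $\mu(A)=0$ for every measurable $A$ with $\lambda(A)=0$; $\mu\llcorner A(B)=\mu(A\cap B)$; an atom of $\mu$ is a point $x$ with $\mu(\{x\})>0$. Families are indexed by viscosities $\nu$ in a fixed set of positive numbers accumulating at $0$ (for instance a sequence), and limits $\nu\to 0$ are along this set. *)

theory Defs
  imports "HOL-Analysis.Analysis"
begin

text \<open>
  The flat torus is the quotient of \<^typ>\<open>real^2\<close> by the lattice of integer vectors. Functions with
  pointwise regularity (smooth or continuous) are represented by their periodic lifts to
  \<^typ>\<open>real^2\<close>. Borel measures, and functions defined almost everywhere, live on the half-open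
  fundamental cell: the projection maps it bijectively onto the torus, with Borel sets
  corresponding to Borel sets, so it carries exactly the Borel measures of the torus.
\<close>

definition periodic :: "(real^2 \<Rightarrow> 'a) \<Rightarrow> bool" where
  "periodic g \<longleftrightarrow> (\<forall>x i. g (x + axis i 1) = g x)"

definition torus :: "(real^2) measure" where
  "torus = restrict_space lborel {x. \<forall>i. 0 \<le> x $ i \<and> x $ i < 1}"


subsection \<open>Differential operators\<close>

definition partial :: "2 \<Rightarrow> (real^2 \<Rightarrow> 'a::real_normed_vector) \<Rightarrow> real^2 \<Rightarrow> 'a" where
  "partial i g x = vector_derivative (\<lambda>t. g (x + t *\<^sub>R axis i 1)) (at 0)"

primrec Ck :: "nat \<Rightarrow> (real^2 \<Rightarrow> 'a::real_normed_vector) \<Rightarrow> bool" where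
  "Ck 0 g \<longleftrightarrow> continuous_on UNIV g"
| "Ck (Suc k) g \<longleftrightarrow> (\<forall>x. g differentiable (at x)) \<and> (\<forall>i. Ck k (partial i g))"

definition smooth_torus :: "(real^2 \<Rightarrow> 'a::real_normed_vector) \<Rightarrow> bool" where
  "smooth_torus g \<longleftrightarrow> periodic g \<and> (\<forall>k. Ck k g)"

definition grad :: "(real^2 \<Rightarrow> real) \<Rightarrow> real^2 \<Rightarrow> real^2" where
  "grad p x = (\<chi> i. partial i p x)"

definition divergence :: "(real^2 \<Rightarrow> real^2) \<Rightarrow> real^2 \<Rightarrow> real" where
  "divergence v x = (\<Sum>i\<in>UNIV. partial i (\<lambda>y. v y $ i) x)"

definition curl :: "(real^2 \<Rightarrow> real^2) \<Rightarrow> real^2 \<Rightarrow> real" where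
  "curl v x = partial 1 (\<lambda>y. v y $ 2) x - partial 2 (\<lambda>y. v y $ 1) x"

definition laplacian :: "(real^2 \<Rightarrow> real^2) \<Rightarrow> real^2 \<Rightarrow> real^2" where
  "laplacian v x = (\<Sum>i\<in>UNIV. partial i (partial i v) x)"

definition outer :: "real^2 \<Rightarrow> real^2 \<Rightarrow> real^2^2" where
  "outer a b = (\<chi> i j. a $ i * b $ j)"

text \<open>Row-wise divergence of a matrix field.\<close>

definition mat_divergence :: "(real^2 \<Rightarrow> real^2^2) \<Rightarrow> real^2 \<Rightarrow> real^2" where
  "mat_divergence A x = (\<chi> i. \<Sum>j\<in>UNIV. partial j (\<lambda>y. A y $ i $ j) x)"

text \<open>The squared Euclidean (Frobenius) norm of the Jacobian matrix.\<close>

definition grad_norm_sq :: "(real^2 \<Rightarrow> real^2) \<Rightarrow> real^2 \<Rightarrow> real" where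
  "grad_norm_sq v x = (\<Sum>i\<in>UNIV. \<Sum>j\<in>UNIV. (partial j (\<lambda>y. v y $ i) x)\<^sup>2)"

definition stationary_NS :: "real \<Rightarrow> (real^2 \<Rightarrow> real^2) \<Rightarrow> (real^2 \<Rightarrow> real) \<Rightarrow> (real^2 \<Rightarrow> real^2) \<Rightarrow> bool" where
  "stationary_NS \<nu> v p g \<longleftrightarrow>
     (\<forall>x. mat_divergence (\<lambda>y. outer (v y) (v y)) x + grad p x = \<nu> *\<^sub>R laplacian v x + g x) \<and>
     (\<forall>x. divergence v x = 0)"


subsection \<open>Weak convergence\<close>

definition L2_torus :: "(real^2 \<Rightarrow> 'a::euclidean_space) \<Rightarrow> bool" where
  "L2_torus g \<longleftrightarrow> g \<in> borel_measurable torus \<and> integrable torus (\<lambda>x. (norm (g x))\<^sup>2)"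

definition weak_L2 ::
  "('i \<Rightarrow> real^2 \<Rightarrow> 'a::euclidean_space) \<Rightarrow> (real^2 \<Rightarrow> 'a) \<Rightarrow> 'i filter \<Rightarrow> bool" where
  "weak_L2 v w \<F> \<longleftrightarrow> L2_torus w \<and>
     (\<forall>\<phi>. L2_torus \<phi> \<longrightarrow>
        ((\<lambda>\<nu>. \<integral>x. v \<nu> x \<bullet> \<phi> x \<partial>torus) \<longlongrightarrow> (\<integral>x. w x \<bullet> \<phi> x \<partial>torus)) \<F>)"

definition finite_borel_torus :: "(real^2) measure \<Rightarrow> bool" where
  "finite_borel_torus \<mu> \<longleftrightarrow> finite_measure \<mu> \<and> sets \<mu> = sets torus"

text \<open>
  Weak-* convergence in the space of finite Borel measures, dual to the continuous functions.
  The members of the family are integrable functions \<open>h \<nu>\<close>, identified with the measures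
  having density \<open>h \<nu>\<close> with respect to Lebesgue measure on the torus.
\<close>

definition weak_star :: "('i \<Rightarrow> real^2 \<Rightarrow> real) \<Rightarrow> (real^2) measure \<Rightarrow> 'i filter \<Rightarrow> bool" where
  "weak_star h \<mu> \<F> \<longleftrightarrow> finite_borel_torus \<mu> \<and>
     (\<forall>\<phi>::real^2 \<Rightarrow> real. periodic \<phi> \<and> continuous_on UNIV \<phi> \<longrightarrow>
        ((\<lambda>\<nu>. \<integral>x. \<phi> x * h \<nu> x \<partial>torus) \<longlongrightarrow> (\<integral>x. \<phi> x \<partial>\<mu>)) \<F>)"


subsection \<open>Atoms and restriction\<close>

definition atoms :: "'a measure \<Rightarrow> 'a set" where
  "atoms \<mu> = {x \<in> space \<mu>. emeasure \<mu> {x} > 0}"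

text \<open>Unlike \<^const>\<open>restrict_space\<close>, this keeps the underlying space.\<close>

definition measure_restr :: "'a measure \<Rightarrow> 'a set \<Rightarrow> 'a measure" where
  "measure_restr \<mu> A = measure_of (space \<mu>) (sets \<mu>) (\<lambda>B. emeasure \<mu> (A \<inter> B))"

end

theory Submission
  imports Defs
begin

text \<open>
  Put \<open>H = \<nu> \<Delta>u\<close>. In two dimensions the inertial and pressure terms are \<open>L\<^sup>2\<close>-orthogonal to \<open>\<Delta>u\<close>, so
  \<open>\<integral>\<bar>H\<bar>\<^sup>2 = - \<integral>f \<bullet> H\<close>: \<open>H\<close> is bounded in \<open>L\<^sup>2\<close>, tends weakly to zero, and tends strongly to zero
  when \<open>f\<close> converges strongly. Up to vanishing terms \<open>\<integral>\<phi> \<nu>\<bar>\<nabla>u\<bar>\<^sup>2\<close> equals both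
  \<open>- \<integral>\<phi> (u - u\<^sub>0) \<bullet> H\<close> and \<open>\<nu> \<integral>\<phi> \<omega>\<^sup>2\<close>. The first expression gives \<open>D(\<phi>)\<^sup>2 \<le> C sup \<phi> \<Lambda>(\<phi>)\<close>, hence
  \<open>D \<ll> \<Lambda>\<close>. In the second, Nash's inequality applied to \<open>\<phi> \<omega>\<close>, with \<open>\<nu> \<bar>\<nabla>\<omega>\<bar> = \<bar>H\<bar>\<close> bounded in \<open>L\<^sup>2\<close>, gives
  \<open>\<Sum> D(E\<^sub>i) \<le> C sqrt (\<Sum> \<Omega>(E\<^sub>i)\<^sup>2)\<close> for disjoint sets \<open>E\<^sub>i\<close>; cutting the complement of the atoms of \<open>\<Omega>\<close> into
  pieces of small \<open>\<Omega>\<close>-measure shows that \<open>D\<close> does not charge it.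
\<close>

section \<open>Fields of class \<open>C\<^sup>1\<close>\<close>

text \<open>The difficulty is that \<open>u - u0\<close> and \<open>H\<close> both converge only
  weakly to zero, so their product need not vanish in the limit; what survives is exactly
  \<open>D\<close>, up to sign. Two obstacles shape the estimates. The weak decay of
  \<open>H\<close> comes from one integration by parts against a differentiable field, whereas
  \<open>u0\<close> and \<open>f0\<close> are merely square integrable. They are therefore
  approximated in the L2 norm by C1 fields, whose existence is drawn from the weakly convergent
  smooth families themselves. Secondly, the vorticity estimate must not deteriorate with the number
  of pieces. Cutoffs \<open>phi_i \<ge> 0\<close> whose sum is at most 3 have squares summing to at
  most 9, so the bound on \<open>H\<close> is paid once for all pieces together. The derivatives of
  the cutoffs enter only next to a positive power of the viscosity, which tends to zero while the
  cutoffs are still fixed; the cutoffs are sharpened to indicators afterwards.\<close>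

definition C1per :: "(real^2 \<Rightarrow> real) \<Rightarrow> bool" where
  "C1per g \<longleftrightarrow> periodic g \<and> continuous_on UNIV g \<and>
     (\<forall>i x. ((\<lambda>t. g (x + t *\<^sub>R axis i 1)) has_real_derivative partial i g x) (at 0)) \<and>
     (\<forall>i. continuous_on UNIV (partial i g))"

lemma partial_eqI:
  fixes g :: "real^2 \<Rightarrow> real"
  assumes "((\<lambda>t. g (x + t *\<^sub>R axis i 1)) has_real_derivative d) (at 0)"
  shows "partial i g x = d"
  using assms unfolding partial_def has_real_derivative_iff_has_vector_derivative
  by (rule vector_derivative_at)

text \<open>\<open>partial\<close> is a total function, so existence of the derivative must be
  supplied along with its value. Derivatives along coordinate lines suffice for integration by
  parts, and they reduce sums and products to calculus in one variable.\<close>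

lemma C1perI:
  fixes g :: "real^2 \<Rightarrow> real"
  assumes "periodic g" "continuous_on UNIV g"
    and d: "\<And>i x. ((\<lambda>t. g (x + t *\<^sub>R axis i 1)) has_real_derivative g' i x) (at 0)"
    and c: "\<And>i. continuous_on UNIV (g' i)"
  shows "C1per g" "partial i g = g' i"
proof -
  have *: "partial i g = g' i" for i
    using partial_eqI[OF d] by auto
  show "C1per g" unfolding C1per_def * using assms by auto
  show "partial i g = g' i" by (rule *)
qed

lemma C1perD:
  assumes "C1per g"
  shows "periodic g" "continuous_on UNIV g" "continuous_on UNIV (partial i g)"
    "((\<lambda>t. g (x + t *\<^sub>R axis i 1)) has_real_derivative partial i g x) (at 0)"
  using assms unfolding C1per_def by auto

lemma periodic_shift: "periodic g \<Longrightarrow> g (x + axis i 1) = g x"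
  by (auto simp: periodic_def)

lemma periodic_partial: "periodic g \<Longrightarrow> periodic (partial i g)"
  unfolding periodic_def partial_def
proof (intro allI)
  fix x and k :: 2
  assume *: "\<forall>x i. g (x + axis i 1) = g x"
  have "g (x + axis k 1 + t *\<^sub>R axis i 1) = g (x + t *\<^sub>R axis i 1)" for t
    using *[rule_format, of "x + t *\<^sub>R axis i 1" k] by (simp add: ac_simps)
  then show "vector_derivative (\<lambda>t. g (x + axis k 1 + t *\<^sub>R axis i 1)) (at 0)
      = vector_derivative (\<lambda>t. g (x + t *\<^sub>R axis i 1)) (at 0)" by simp
qed

lemma C1per_const: "C1per (\<lambda>x. c)" "partial i (\<lambda>x. c::real) = (\<lambda>x. 0)"
proof -
  have d: "\<And>i x. ((\<lambda>t. (\<lambda>x. c) (x + t *\<^sub>R axis i 1)) has_real_derivative (\<lambda>i x. 0) i x) (at 0)" by auto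
  show "C1per (\<lambda>x. c)" "partial i (\<lambda>x. c::real) = (\<lambda>x. 0)"
    using C1perI[of "\<lambda>x. c", OF _ _ d] by (auto simp: periodic_def)
qed

lemma
  assumes f: "C1per f" and g: "C1per g"
  shows C1per_add: "C1per (\<lambda>x. f x + g x)"
    and partial_add: "partial i (\<lambda>x. f x + g x) = (\<lambda>x. partial i f x + partial i g x)"
proof -
  have d: "\<And>i x. ((\<lambda>t. (\<lambda>x. f x + g x) (x + t *\<^sub>R axis i 1)) has_real_derivative
     (\<lambda>i x. partial i f x + partial i g x) i x) (at 0)"
    by (auto intro!: derivative_eq_intros C1perD[OF f] C1perD[OF g])
  show "C1per (\<lambda>x. f x + g x)" "partial i (\<lambda>x. f x + g x) = (\<lambda>x. partial i f x + partial i g x)"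
    by (intro C1perI[OF _ _ d] continuous_intros C1perD[OF f] C1perD[OF g];
        use C1perD(1)[OF f] C1perD(1)[OF g] in \<open>simp add: periodic_def\<close>)+
qed

lemma
  assumes f: "C1per f" and g: "C1per g"
  shows C1per_mult: "C1per (\<lambda>x. f x * g x)"
    and partial_mult: "partial i (\<lambda>x. f x * g x) = (\<lambda>x. f x * partial i g x + partial i f x * g x)"
proof -
  have d: "\<And>i x. ((\<lambda>t. (\<lambda>x. f x * g x) (x + t *\<^sub>R axis i 1)) has_real_derivative
     (\<lambda>i x. f x * partial i g x + partial i f x * g x) i x) (at 0)"
    by (auto intro!: derivative_eq_intros C1perD[OF f] C1perD[OF g])
  show "C1per (\<lambda>x. f x * g x)" 
      "partial i (\<lambda>x. f x * g x) = (\<lambda>x. f x * partial i g x + partial i f x * g x)"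
    by (intro C1perI[OF _ _ d] continuous_intros C1perD[OF f] C1perD[OF g];
        use C1perD(1)[OF f] C1perD(1)[OF g] in \<open>simp add: periodic_def\<close>)+
qed

lemma
  assumes f: "C1per f"
  shows C1per_cmult: "C1per (\<lambda>x. c * f x)"
    and partial_cmult: "partial i (\<lambda>x. c * f x) = (\<lambda>x. c * partial i f x)"
  using C1per_mult[OF C1per_const(1) f] partial_mult[OF C1per_const(1) f]
  by (auto simp: C1per_const(2))

lemma
  assumes f: "C1per f" and g: "C1per g"
  shows C1per_diff: "C1per (\<lambda>x. f x - g x)"
    and partial_diff: "partial i (\<lambda>x. f x - g x) = (\<lambda>x. partial i f x - partial i g x)"
  using C1per_add[OF f C1per_cmult[OF g, of "-1"]] partial_add[OF f C1per_cmult[OF g, of "-1"]]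
  unfolding partial_cmult[OF g] by auto

lemma C1per_line:
  assumes "C1per g"
  shows "((\<lambda>s. g (x + s *\<^sub>R axis i 1)) has_real_derivative partial i g (x + t *\<^sub>R axis i 1)) (at t)"
proof -
  have "((\<lambda>s. g ((x + t *\<^sub>R axis i 1) + s *\<^sub>R axis i 1)) has_real_derivative
      partial i g (x + t *\<^sub>R axis i 1)) (at 0)"
    by (rule C1perD[OF assms])
  then have "((\<lambda>s. g (x + (s + t) *\<^sub>R axis i 1)) has_real_derivative
      partial i g (x + t *\<^sub>R axis i 1)) (at 0)"
    by (simp add: scaleR_add_left add.commute add.left_commute)
  then show ?thesis
    using DERIV_shift[of "\<lambda>s. g (x + s *\<^sub>R axis i 1)" _ 0 t] by simp
qed

text \<open>The difference quotient over a small square is a value of either mixed derivative.\<close>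

lemma partial_commute:
  assumes g: "C1per g" and g1: "\<And>i. C1per (partial i g)"
  shows "partial i (partial j g) x = partial j (partial i g) x"
proof -
  have key: "\<exists>s t. 0 < s \<and> s < h \<and> 0 < t \<and> t < h \<and>
      g (x + h *\<^sub>R axis i 1 + h *\<^sub>R axis j 1) - g (x + h *\<^sub>R axis i 1)
        - g (x + h *\<^sub>R axis j 1) + g x = h * h * partial j (partial i g) (x + s *\<^sub>R axis i 1 + t *\<^sub>R axis j 1)"
    if h: "0 < h" for h and i j :: 2
  proof -
    let ?F = "\<lambda>s. g ((x + h *\<^sub>R axis j 1) + s *\<^sub>R axis i 1) - g (x + s *\<^sub>R axis i 1)"
    have D: "(?F has_real_derivative (partial i g ((x + h *\<^sub>R axis j 1) + s *\<^sub>R axis i 1)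
         - partial i g (x + s *\<^sub>R axis i 1))) (at s)" for s
      by (intro derivative_intros C1per_line[OF g])
    obtain s where s: "0 < s" "s < h" "?F h - ?F 0 = (h - 0) * (partial i g ((x + h *\<^sub>R axis j 1) + s *\<^sub>R axis i 1)
         - partial i g (x + s *\<^sub>R axis i 1))"
      using MVT2[of 0 h ?F, OF h D] by blast
    let ?G = "\<lambda>t. partial i g ((x + s *\<^sub>R axis i 1) + t *\<^sub>R axis j 1)"
    have D2: "(?G has_real_derivative partial j (partial i g) ((x + s *\<^sub>R axis i 1) + t *\<^sub>R axis j 1)) (at t)" for t
      by (intro C1per_line g1)
    obtain t where t: "0 < t" "t < h" "?G h - ?G 0 = (h - 0) * partial j (partial i g) ((x + s *\<^sub>R axis i 1) + t *\<^sub>R axis j 1)"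
      using MVT2[of 0 h ?G, OF h D2] by blast
    show ?thesis
      using s t by (intro exI[of _ s] exI[of _ t]) (simp add: algebra_simps)
  qed
  define e where "e n = inverse (real (Suc n))" for n
  have e: "0 < e n" for n by (simp add: e_def)
  have e0: "e \<longlonglongrightarrow> 0" unfolding e_def by (rule LIMSEQ_inverse_real_of_nat)
  have lim: "(\<lambda>n. partial j (partial i g) (x + s n *\<^sub>R axis i 1 + t n *\<^sub>R axis j 1)) \<longlonglongrightarrow> partial j (partial i g) x"
    if "\<And>n. 0 < s n \<and> s n < e n \<and> 0 < t n \<and> t n < e n" for s t and i j :: 2
  proof -
    have s: "s \<longlonglongrightarrow> 0"
      by (rule tendsto_sandwich[OF _ _ tendsto_const e0])
         (use that less_imp_le in \<open>auto intro!: always_eventually\<close>)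
    have t: "t \<longlonglongrightarrow> 0"
      by (rule tendsto_sandwich[OF _ _ tendsto_const e0])
         (use that less_imp_le in \<open>auto intro!: always_eventually\<close>)
    have "(\<lambda>n. x + s n *\<^sub>R axis i 1 + t n *\<^sub>R axis j 1) \<longlonglongrightarrow> x + 0 *\<^sub>R axis i 1 + 0 *\<^sub>R axis j 1"
      by (intro tendsto_intros s t)
    moreover have "isCont (partial j (partial i g)) x"
      using C1perD(3)[OF g1] by (auto simp: continuous_on_eq_continuous_at)
    ultimately show ?thesis
      using isCont_tendsto_compose by fastforce
  qed
  obtain s t where st: "\<And>n. 0 < s n \<and> s n < e n \<and> 0 < t n \<and> t n < e n \<and>
      g (x + e n *\<^sub>R axis i 1 + e n *\<^sub>R axis j 1) - g (x + e n *\<^sub>R axis i 1)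
        - g (x + e n *\<^sub>R axis j 1) + g x = e n * e n * partial j (partial i g) (x + s n *\<^sub>R axis i 1 + t n *\<^sub>R axis j 1)"
    using key[OF e, where i=i and j=j] by metis
  obtain s' t' where st': "\<And>n. 0 < s' n \<and> s' n < e n \<and> 0 < t' n \<and> t' n < e n \<and>
      g (x + e n *\<^sub>R axis j 1 + e n *\<^sub>R axis i 1) - g (x + e n *\<^sub>R axis j 1)
        - g (x + e n *\<^sub>R axis i 1) + g x = e n * e n * partial i (partial j g) (x + s' n *\<^sub>R axis j 1 + t' n *\<^sub>R axis i 1)"
    using key[OF e, where i=j and j=i] by metis
  \<comment> \<open>The second difference of \<open>g\<close> is symmetric in the two directions, so
    both mean value points compute the same number.\<close>
  have eq0: "e n * e n * partial j (partial i g) (x + s n *\<^sub>R axis i 1 + t n *\<^sub>R axis j 1)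
     = e n * e n * partial i (partial j g) (x + s' n *\<^sub>R axis j 1 + t' n *\<^sub>R axis i 1)" for n
    using st[of n] st'[of n] by (smt (verit) add.assoc add.commute)
  have eq: "partial j (partial i g) (x + s n *\<^sub>R axis i 1 + t n *\<^sub>R axis j 1)
     = partial i (partial j g) (x + s' n *\<^sub>R axis j 1 + t' n *\<^sub>R axis i 1)" for n
    using eq0[of n] e[of n] by simp
  have "(\<lambda>n. partial j (partial i g) (x + s n *\<^sub>R axis i 1 + t n *\<^sub>R axis j 1)) \<longlonglongrightarrow> partial j (partial i g) x"
    by (rule lim) (use st in blast)
  moreover have "(\<lambda>n. partial j (partial i g) (x + s n *\<^sub>R axis i 1 + t n *\<^sub>R axis j 1)) \<longlonglongrightarrow> partial i (partial j g) x"
    unfolding eq by (rule lim) (use st' in blast)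
  ultimately show ?thesis by (rule LIMSEQ_unique[symmetric])
qed

section \<open>Smooth fields and their components\<close>

lemma has_vector_derivative_partial:
  fixes g :: "real^2 \<Rightarrow> 'a::real_normed_vector"
  assumes "g differentiable (at x)"
  shows "((\<lambda>t. g (x + t *\<^sub>R axis i 1)) has_vector_derivative partial i g x) (at 0)"
proof -
  have "(\<lambda>t. x + t *\<^sub>R axis i (1::real)) differentiable (at 0)"
    by (intro derivative_intros)
  then have "(g \<circ> (\<lambda>t. x + t *\<^sub>R axis i 1)) differentiable (at 0)"
    by (rule differentiable_chain_at) (use assms in simp)
  then show ?thesis
    unfolding partial_def by (simp add: vector_derivative_works o_def)
qed

lemma smooth_C1per:
  assumes "smooth_torus g"
  shows "C1per g"
proof -
  have "Ck 1 g" using assms by (auto simp: smooth_torus_def)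
  then have "\<forall>x. g differentiable (at x)" "continuous_on UNIV (partial i g)" for i by auto
  moreover have "continuous_on UNIV g" using assms Ck.simps(1) by (metis smooth_torus_def)
  ultimately show ?thesis using assms unfolding C1per_def smooth_torus_def
    by (auto simp: has_real_derivative_iff_has_vector_derivative intro: has_vector_derivative_partial)
qed

lemma smooth_partial: 
  fixes g :: "real^2 \<Rightarrow> 'a::real_normed_vector"
  shows "smooth_torus g \<Longrightarrow> smooth_torus (partial i g)"
  unfolding smooth_torus_def using periodic_partial by (metis Ck.simps(2))

text \<open>Coordinate projections are bounded linear and commute with derivatives. This reconciles
  \<open>laplacian\<close>, which differentiates the whole vector field, with
  \<open>divergence\<close> and \<open>curl\<close>, which differentiate components.\<close>

lemma partial_component:
  fixes v :: "real^2 \<Rightarrow> real^'n"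
  assumes "v differentiable (at x)"
  shows "partial i (\<lambda>y. v y $ k) x = partial i v x $ k"
  using has_vector_derivative_partial[OF assms, of i] unfolding partial_def[of _ "\<lambda>y. v y $ k"]
  by (intro vector_derivative_at bounded_linear.has_vector_derivative[OF bounded_linear_vec_nth])

lemma Ck_component:
  fixes v :: "real^2 \<Rightarrow> real^'n"
  shows "Ck k v \<Longrightarrow> Ck k (\<lambda>y. v y $ l)"
proof (induction k arbitrary: v)
  case 0
  then show ?case by (auto intro!: continuous_intros)
next
  case (Suc k)
  then have d: "v differentiable (at x)" for x by auto
  have "(\<lambda>y. v y $ l) differentiable (at x)" for x
    using bounded_linear_imp_differentiable[OF bounded_linear_vec_nth] differentiable_compose[OF _ d]
    by fastforce
  moreover have "partial i (\<lambda>y. v y $ l) = (\<lambda>y. partial i v y $ l)" for i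
    using partial_component[OF d] by auto
  ultimately show ?case using Suc by simp
qed

lemma smooth_component:
  fixes v :: "real^2 \<Rightarrow> real^'n"
  shows "smooth_torus v \<Longrightarrow> smooth_torus (\<lambda>y. v y $ l)"
  using Ck_component[of _ v l] unfolding smooth_torus_def periodic_def by auto

lemma smooth_partial_component:
  fixes v :: "real^2 \<Rightarrow> real^'n"
  assumes "smooth_torus v"
  shows "(\<lambda>y. partial i v y $ k) = partial i (\<lambda>y. v y $ k)"
proof -
  have "Ck 1 v" using assms by (auto simp: smooth_torus_def)
  then show ?thesis using partial_component[of v] by auto
qed

text \<open>Serves the curl, a difference of partial derivatives that is itself differentiated twice
  later on.\<close>

lemma Ck_diff:
  fixes f g :: "real^2 \<Rightarrow> real"
  shows "Ck k f \<Longrightarrow> Ck k g \<Longrightarrow> Ck k (\<lambda>x. f x - g x)"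
proof (induction k arbitrary: f g)
  case 0
  then show ?case by (auto intro!: continuous_intros)
next
  case (Suc k)
  have "partial i (\<lambda>x. f x - g x) = (\<lambda>x. partial i f x - partial i g x)" for i
  proof
    fix x
    show "partial i (\<lambda>x. f x - g x) x = partial i f x - partial i g x"
      unfolding partial_def[of _ "\<lambda>x. f x - g x"] using Suc.prems
      by (intro vector_derivative_at has_vector_derivative_diff has_vector_derivative_partial) auto
  qed
  then show ?case using Suc by (auto intro!: derivative_intros)
qed

lemma smooth_diff:
  fixes f g :: "real^2 \<Rightarrow> real"
  shows "smooth_torus f \<Longrightarrow> smooth_torus g \<Longrightarrow> smooth_torus (\<lambda>x. f x - g x)"
  using Ck_diff unfolding smooth_torus_def periodic_def by auto

lemma smooth_partial_commute:
  fixes g :: "real^2 \<Rightarrow> real"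
  assumes "smooth_torus g"
  shows "partial i (partial j g) x = partial j (partial i g) x"
  by (intro partial_commute smooth_C1per smooth_partial assms)

section \<open>Integration over the cell\<close>

definition vec2 :: "real \<Rightarrow> real \<Rightarrow> real^2" where
  "vec2 a b = (\<chi> i. if i = 1 then a else b)"

definition cell :: "(real^2) set" where
  "cell = {x. \<forall>i. 0 \<le> x $ i \<and> x $ i < 1}"

lemma vec2_nth [simp]: "vec2 a b $ 1 = a" "vec2 a b $ 2 = b"
  by (auto simp: vec2_def)

lemma vec2_in_cell: "vec2 a b \<in> cell \<longleftrightarrow> a \<in> {0..<1} \<and> b \<in> {0..<1}"
  by (auto simp: cell_def forall_2)

lemma vec2_axis: "vec2 a b = vec2 0 b + a *\<^sub>R axis 1 1" "vec2 a b = vec2 a 0 + b *\<^sub>R axis 2 1"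
  by (auto simp: vec_eq_iff forall_2 axis_def)

lemma continuous_vec2 [continuous_intros]:
  "continuous_on A f \<Longrightarrow> continuous_on A g \<Longrightarrow> continuous_on A (\<lambda>x. vec2 (f x) (g x))"
  unfolding vec2_def by (intro continuous_intros, rename_tac i, case_tac "i = 1") auto

lemma vec2_measurable [measurable]: "(\<lambda>z. vec2 (fst z) (snd z)) \<in> borel_measurable borel"
  by (intro borel_measurable_continuous_onI continuous_intros)

lemma vec2_measurable' [measurable]: "(\<lambda>z. vec2 (fst z) (snd z)) \<in> lborel \<Otimes>\<^sub>M lborel \<rightarrow>\<^sub>M borel"
  using vec2_measurable by (simp add: lborel_prod)

lemma torus_cell: "torus = restrict_space lborel cell"
  by (simp add: torus_def cell_def)

lemma cell_sets [measurable]: "cell \<in> sets borel"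
proof -
  have "cell = {x. 0 \<le> x $ 1} \<inter> {x. x $ 1 < 1} \<inter> {x. 0 \<le> x $ 2} \<inter> {x. x $ 2 < 1}"
    by (auto simp: cell_def forall_2)
  also have "\<dots> \<in> sets borel"
    by (intro sets.Int borel_closed borel_open closed_Collect_le open_Collect_less continuous_intros)
  finally show ?thesis .
qed

lemma space_torus [simp]: "space torus = cell"
  by (simp add: torus_cell space_restrict_space)

lemma sets_torus: "sets torus = sets (restrict_space borel cell)"
  unfolding torus_cell by (intro sets_restrict_space_cong) simp

lemma prod_Basis_vec2:
  fixes f :: "real^2 \<Rightarrow> real"
  shows "(\<Prod>b\<in>Basis. f b) = f (axis 1 1) * f (axis 2 1)"
proof -
  have "(Basis :: (real^2) set) = {axis 1 1, axis 2 1}"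
    by (auto simp: Basis_vec_def UNIV_2)
  moreover have "axis 1 1 \<noteq> (axis 2 1 :: real^2)" by (simp add: axis_eq_axis)
  ultimately show ?thesis by (metis (no_types, lifting) empty_iff finite.intros insert_iff mult.right_neutral prod.empty prod.insert)
qed

text \<open>Lebesgue measure is determined by the volumes of boxes, and the preimage of a box is a
  rectangle. This opens the way to Fubini in either order.\<close>

lemma lborel_vec2: "lborel = distr (lborel \<Otimes>\<^sub>M lborel) borel (\<lambda>z. vec2 (fst z) (snd z))"
proof (rule lborel_eqI)
  fix l u :: "real^2" assume le: "\<And>b. b \<in> Basis \<Longrightarrow> l \<bullet> b \<le> u \<bullet> b"
  have "axis i 1 \<in> (Basis :: (real^2) set)" for i by (auto simp: Basis_vec_def)
  then have l: "l $ i \<le> u $ i" for i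
    using le[of "axis i 1"] by (simp add: inner_axis)
  have "(\<lambda>z. vec2 (fst z) (snd z)) -` box l u \<inter> space (lborel \<Otimes>\<^sub>M lborel)
     = box (l $ 1) (u $ 1) \<times> box (l $ 2) (u $ 2)"
    by (auto simp: mem_box_cart forall_2 space_pair_measure box_real)
  then show "emeasure (distr (lborel \<Otimes>\<^sub>M lborel) borel (\<lambda>z. vec2 (fst z) (snd z))) (box l u) = (\<Prod>b\<in>Basis. (u - l) \<bullet> b)"
    using l by (simp add: emeasure_distr prod_Basis_vec2 inner_axis lborel.emeasure_pair_measure_Times box_real
        ennreal_mult)
qed simp

lemma integral_torus_lborel:
  fixes f :: "real^2 \<Rightarrow> real"
  assumes "f \<in> borel_measurable borel"
  shows "(\<integral>x. f x \<partial>torus) = (\<integral>z. indicator cell (vec2 (fst z) (snd z)) * f (vec2 (fst z) (snd z)) \<partial>(lborel \<Otimes>\<^sub>M lborel))"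
proof -
  have "(\<integral>x. f x \<partial>torus) = (\<integral>x. indicator cell x *\<^sub>R f x \<partial>lborel)"
    unfolding torus_cell by (subst integral_restrict_space) auto
  also have "\<dots> = (\<integral>x. indicator cell x *\<^sub>R f x \<partial>(distr (lborel \<Otimes>\<^sub>M lborel) borel (\<lambda>z. vec2 (fst z) (snd z))))"
    by (simp flip: lborel_vec2)
  also have "\<dots> = (\<integral>z. indicator cell (vec2 (fst z) (snd z)) *\<^sub>R f (vec2 (fst z) (snd z)) \<partial>(lborel \<Otimes>\<^sub>M lborel))"
    by (intro integral_distr) (use assms in measurable)
  finally show ?thesis by simp
qed

lemma finite_measure_torus: "finite_measure torus"
proof
  have "cell \<subseteq> cbox (vec2 0 0) (vec2 1 1)"
    by (auto simp: mem_box_cart forall_2 cell_def)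
  then have "emeasure lborel cell \<le> emeasure lborel (cbox (vec2 0 0) (vec2 1 1))"
    by (intro emeasure_mono) auto
  also have "\<dots> < \<infinity>" by (intro emeasure_bounded_finite) simp
  finally show "emeasure torus (space torus) \<noteq> \<infinity>"
    unfolding space_torus unfolding torus_cell by (simp add: emeasure_restrict_space)
qed

interpretation torus: finite_measure torus by (rule finite_measure_torus)

lemma continuous_measurable_torus [intro]:
  fixes g :: "real^2 \<Rightarrow> 'a::topological_space"
  assumes "continuous_on UNIV g"
  shows "g \<in> borel_measurable torus"
  unfolding torus_cell using borel_measurable_continuous_onI[OF assms]
  by (intro measurable_restrict_space1) simp

lemma bounded_on_cell:
  fixes g :: "real^2 \<Rightarrow> 'a::real_normed_vector"
  assumes "continuous_on UNIV g"
  obtains B where "0 < B" "\<And>x. x \<in> cell \<Longrightarrow> norm (g x) \<le> B"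
proof -
  have "compact (g ` cbox (vec2 0 0) (vec2 1 1))"
    by (intro compact_continuous_image continuous_on_subset[OF assms]) auto
  then obtain B where "0 < B" "\<And>y. y \<in> g ` cbox (vec2 0 0) (vec2 1 1) \<Longrightarrow> norm y \<le> B"
    using compact_imp_bounded bounded_pos by metis
  moreover have "cell \<subseteq> cbox (vec2 0 0) (vec2 1 1)"
    by (auto simp: mem_box_cart forall_2 cell_def)
  ultimately show ?thesis using that by blast
qed

lemma continuous_integrable_torus [intro]:
  fixes g :: "real^2 \<Rightarrow> 'a::{banach,second_countable_topology}"
  assumes "continuous_on UNIV g"
  shows "integrable torus g"
proof -
  obtain B where B: "\<And>x. x \<in> cell \<Longrightarrow> norm (g x) \<le> B" using bounded_on_cell[OF assms] by metis
  show ?thesis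
    by (rule torus.integrable_const_bound[of _ B]) (use B assms in auto)
qed

text \<open>The half-open interval of the cell and the closed interval of the fundamental theorem of
  calculus differ by one null point.\<close>

lemma integral_cell_Icc:
  fixes h :: "real \<Rightarrow> real"
  shows "(\<integral>t. indicator {0..<1} t * h t \<partial>lborel) = (LINT t:{0..1}|lborel. h t)"
  unfolding set_lebesgue_integral_def
  by (rule integral_discrete_difference[of "{1}"]) (auto simp: indicator_def)

text \<open>Both orders are needed because a derivative must be integrated first along its own
  direction. Integrability of the inner integrals is recorded for the product estimate of
  \<open>Gagliardo\<close>.\<close>

lemma
  fixes f :: "real^2 \<Rightarrow> real"
  assumes f: "continuous_on UNIV f"
  shows integral_torus_iterated1:
      "(\<integral>x. f x \<partial>torus) = (LINT a:{0..1}|lborel. LINT b:{0..1}|lborel. f (vec2 a b))"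
    and integral_torus_iterated2:
      "(\<integral>x. f x \<partial>torus) = (LINT b:{0..1}|lborel. LINT a:{0..1}|lborel. f (vec2 a b))"
    and integrable_inner1: "set_integrable lborel {0..1} (\<lambda>a. LINT b:{0..1}|lborel. f (vec2 a b))"
    and integrable_inner2: "set_integrable lborel {0..1} (\<lambda>b. LINT a:{0..1}|lborel. f (vec2 a b))"
proof -
  let ?h = "\<lambda>z. indicator cell (vec2 (fst z) (snd z)) * f (vec2 (fst z) (snd z))"
  have [measurable]: "f \<in> borel_measurable borel" using f by (rule borel_measurable_continuous_onI)
  have "integrable torus f" using f by auto
  then have "integrable lborel (\<lambda>x. indicator cell x *\<^sub>R f x)"
    unfolding torus_cell by (simp add: integrable_restrict_space)
  then have "integrable (distr (lborel \<Otimes>\<^sub>M lborel) borel (\<lambda>z. vec2 (fst z) (snd z))) (\<lambda>x. indicator cell x *\<^sub>R f x)"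
    by (simp flip: lborel_vec2)
  then have int: "integrable (lborel \<Otimes>\<^sub>M lborel) ?h"
    by (subst (asm) integrable_distr_eq) auto
  have h: "?h (a, b) = indicator {0..<1} a * (indicator {0..<1} b * f (vec2 a b))" for a b
    by (auto simp: indicator_def vec2_in_cell)
  have "(\<integral>x. f x \<partial>torus) = (\<integral>z. ?h z \<partial>(lborel \<Otimes>\<^sub>M lborel))"
    by (rule integral_torus_lborel) simp
  also have "\<dots> = (\<integral>a. \<integral>b. ?h (a, b) \<partial>lborel \<partial>lborel)"
    by (rule lborel_pair.integral_fst'[OF int, symmetric])
  also have "\<dots> = (LINT a:{0..1}|lborel. LINT b:{0..1}|lborel. f (vec2 a b))"
    unfolding h by (simp add: integral_cell_Icc)
  finally show "(\<integral>x. f x \<partial>torus) = (LINT a:{0..1}|lborel. LINT b:{0..1}|lborel. f (vec2 a b))" .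
  have h': "?h (a, b) = indicator {0..<1} b * (indicator {0..<1} a * f (vec2 a b))" for a b
    by (auto simp: indicator_def vec2_in_cell)
  have "(\<integral>x. f x \<partial>torus) = (\<integral>z. ?h z \<partial>(lborel \<Otimes>\<^sub>M lborel))"
    by (rule integral_torus_lborel) simp
  also have "\<dots> = (\<integral>b. \<integral>a. ?h (a, b) \<partial>lborel \<partial>lborel)"
    using lborel_pair.integral_snd[of "\<lambda>a b. ?h (a, b)"] int by (simp add: case_prod_unfold)
  also have "\<dots> = (LINT b:{0..1}|lborel. LINT a:{0..1}|lborel. f (vec2 a b))"
    unfolding h' by (simp add: integral_cell_Icc)
  finally show "(\<integral>x. f x \<partial>torus) = (LINT b:{0..1}|lborel. LINT a:{0..1}|lborel. f (vec2 a b))" .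
  have Icc: "set_integrable lborel {0..1} k" if "integrable lborel (\<lambda>t. indicator {0..<1} t * k t)"
    for k :: "real \<Rightarrow> real"
    unfolding set_integrable_def
    by (rule integrable_discrete_difference[THEN iffD1, OF _ _ _ _ that, of "{1}"]) (auto simp: indicator_def)
  show "set_integrable lborel {0..1} (\<lambda>a. LINT b:{0..1}|lborel. f (vec2 a b))"
    using lborel_pair.integrable_fst'[OF int] unfolding h by (intro Icc) (simp add: integral_cell_Icc)
  have "integrable lborel (\<lambda>b. \<integral>a. ?h (a, b) \<partial>lborel)"
    using lborel_pair.integrable_snd[of "\<lambda>a b. ?h (a, b)"] int by (simp add: case_prod_unfold)
  then show "set_integrable lborel {0..1} (\<lambda>b. LINT a:{0..1}|lborel. f (vec2 a b))"
    unfolding h' by (intro Icc) (simp add: integral_cell_Icc)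
qed

lemma FTC_line:
  assumes g: "C1per g" and "a \<le> b"
  shows "(LINT t:{a..b}|lborel. partial i g (x + t *\<^sub>R axis i 1))
     = g (x + b *\<^sub>R axis i 1) - g (x + a *\<^sub>R axis i 1)"
proof -
  have "isCont (\<lambda>t. partial i g (x + t *\<^sub>R axis i 1)) t" for t
  proof -
    have "continuous_on UNIV (\<lambda>t. partial i g (x + t *\<^sub>R axis i 1))"
      by (intro continuous_on_compose2[OF C1perD(3)[OF g, of i]] continuous_intros) auto
    then show ?thesis by (simp add: continuous_on_eq_continuous_at)
  qed
  then show ?thesis
    using integral_FTC_Icc_real[OF assms(2) C1per_line[OF g]]
    by (simp add: set_lebesgue_integral_def mult.commute)
qed

text \<open>Along direction \<open>i\<close> the derivative integrates to the increment of
  \<open>g\<close> over one period. Every later integration by parts is this fact applied to a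
  product.\<close>

lemma integral_partial_zero:
  assumes g: "C1per g"
  shows "(\<integral>x. partial i g x \<partial>torus) = 0"
proof -
  have per: "g (x + 1 *\<^sub>R axis i 1) - g (x + 0 *\<^sub>R axis i 1) = 0" for x
    using periodic_shift[OF C1perD(1)[OF g]] by simp
  have c: "continuous_on UNIV (partial i g)" by (rule C1perD[OF g])
  have "i = 1 \<or> i = 2" by (rule exhaust_2)
  then show ?thesis
  proof
    assume i: "i = 1"
    have "(LINT a:{0..1}|lborel. partial i g (vec2 a b)) = 0" for b
      using FTC_line[OF g, of 0 1 i "vec2 0 b"] per[of "vec2 0 b"] i by (simp add: vec2_axis(1)[of _ b, symmetric])
    then show ?thesis unfolding integral_torus_iterated2[OF c] by simp
  next
    assume i: "i = 2"
    have "(LINT b:{0..1}|lborel. partial i g (vec2 a b)) = 0" for a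
      using FTC_line[OF g, of 0 1 i "vec2 a 0"] per[of "vec2 a 0"] i by (simp add: vec2_axis(2)[of a, symmetric])
    then show ?thesis unfolding integral_torus_iterated1[OF c] by simp
  qed
qed

section \<open>Nash's inequality\<close>

text \<open>The quadratic polynomial \<open>t^2 A + 2 t B + C\<close> is nonnegative for all real
  \<open>t\<close>; evaluate it at its vertex. If \<open>A = 0\<close> there is no vertex, and a
  nonzero slope would make it negative somewhere.\<close>

lemma Cauchy_Schwarz_integral:
  fixes f g :: "'a \<Rightarrow> real"
  assumes "integrable M (\<lambda>x. (f x)\<^sup>2)" "integrable M (\<lambda>x. (g x)\<^sup>2)" "integrable M (\<lambda>x. f x * g x)"
  shows "(\<integral>x. f x * g x \<partial>M)\<^sup>2 \<le> (\<integral>x. (f x)\<^sup>2 \<partial>M) * (\<integral>x. (g x)\<^sup>2 \<partial>M)"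
proof -
  define A B C where "A = (\<integral>x. (f x)\<^sup>2 \<partial>M)" and "B = (\<integral>x. f x * g x \<partial>M)" and "C = (\<integral>x. (g x)\<^sup>2 \<partial>M)"
  have q: "0 \<le> t\<^sup>2 * A + 2 * t * B + C" for t
  proof -
    have "0 \<le> (\<integral>x. (t * f x + g x)\<^sup>2 \<partial>M)" by simp
    also have "\<dots> = (\<integral>x. t\<^sup>2 * (f x)\<^sup>2 + 2 * t * (f x * g x) + (g x)\<^sup>2 \<partial>M)"
      by (intro Bochner_Integration.integral_cong) (auto simp: power2_eq_square algebra_simps)
    also have "\<dots> = t\<^sup>2 * A + 2 * t * B + C"
      unfolding A_def B_def C_def using assms by simp
    finally show ?thesis .
  qed
  have A: "0 \<le> A" by (simp add: A_def)
  show ?thesis unfolding A_def[symmetric] B_def[symmetric] C_def[symmetric]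
  proof (cases "A = 0")
    case True
    have "B = 0"
    proof (rule ccontr)
      assume "B \<noteq> 0"
      \<comment> \<open>At this point the affine function \<open>2 t B + C\<close> takes the value
        -1.\<close>
      then show False using q[of "- (C + 1) / (2 * B)"] True by (simp add: field_simps)
    qed
    then show "B\<^sup>2 \<le> A * C" using True by simp
  next
    case False
    then have "A * ((- B / A)\<^sup>2 * A + 2 * (- B / A) * B + C) = A * C - B\<^sup>2"
      by (simp add: field_simps power2_eq_square)
    moreover have "0 \<le> A * ((- B / A)\<^sup>2 * A + 2 * (- B / A) * B + C)"
      by (rule mult_nonneg_nonneg[OF A q])
    ultimately show "B\<^sup>2 \<le> A * C" by simp
  qed
qed

text \<open>The oscillation of \<open>H\<close> is at most the integral of its absolute derivative,
  so \<open>\<bar>H a\<bar>\<close> exceeds no value \<open>\<bar>H s\<bar>\<close> by more than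
  that. Averaging over \<open>s\<close> in an interval of length 1 gives the bound.\<close>

lemma sup_bound_unit_interval:
  fixes H H' :: "real \<Rightarrow> real"
  assumes d: "\<And>t. (H has_real_derivative H' t) (at t)" and c: "continuous_on UNIV H'"
    and a: "a \<in> {0..1}"
  shows "\<bar>H a\<bar> \<le> (LINT s:{0..1}|lborel. \<bar>H s\<bar> + \<bar>H' s\<bar>)"
proof -
  have cH: "continuous_on UNIV H" using d DERIV_isCont by (auto simp: continuous_on_eq_continuous_at)
  have i0: "set_integrable lborel {p..q} (\<lambda>s. \<bar>H s\<bar>)" "set_integrable lborel {p..q} (\<lambda>s. \<bar>H' s\<bar>)" 
      "set_integrable lborel {p..q} H'" for p q
    by (intro borel_integrable_atLeastAtMost' continuous_intros continuous_on_subset[OF c]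
        continuous_on_subset[OF cH]; simp)+
  define J where "J = (LINT s:{0..1}|lborel. \<bar>H' s\<bar>)"
  have diff: "\<bar>H q - H p\<bar> \<le> J" if "0 \<le> p" "p \<le> q" "q \<le> 1" for p q
  proof -
    have "H q - H p = (LINT s:{p..q}|lborel. H' s)"
      using integral_FTC_Icc_real[OF that(2), of H H'] d c
      by (simp add: set_lebesgue_integral_def mult.commute continuous_on_eq_continuous_at)
    also have "\<bar>\<dots>\<bar> \<le> (LINT s:{p..q}|lborel. \<bar>H' s\<bar>)"
      using set_integral_norm_bound[OF i0(3)] by simp
    also have "\<dots> \<le> J" unfolding J_def
      unfolding set_lebesgue_integral_def using i0(2)[of p q] i0(2)[of 0 1] that
      by (intro integral_mono) (auto simp: set_integrable_def indicator_def)
    finally show ?thesis .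
  qed
  have lower: "\<bar>H a\<bar> - J \<le> \<bar>H s\<bar>" if "s \<in> {0..1}" for s
    using diff[of s a] diff[of a s] a that by (cases "s \<le> a") auto
  have "set_integrable lborel {0..1} (\<lambda>s::real. \<bar>H a\<bar> - J)"
    by (intro borel_integrable_atLeastAtMost' continuous_intros)
  from set_integral_mono[OF this i0(1)] lower
  have "(LINT s::real:{0..1}|lborel. \<bar>H a\<bar> - J) \<le> (LINT s:{0..1}|lborel. \<bar>H s\<bar>)"
    by auto
  then have "\<bar>H a\<bar> \<le> (LINT s:{0..1}|lborel. \<bar>H s\<bar>) + J"
    by (simp add: set_integral_const)
  also have "\<dots> = (LINT s:{0..1}|lborel. \<bar>H s\<bar> + \<bar>H' s\<bar>)"
    unfolding J_def by (intro set_integral_add(2)[symmetric] i0)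
  finally show ?thesis .
qed

lemma continuous_on_vec2_comp:
  assumes "continuous_on UNIV g"
  shows "continuous_on A (\<lambda>s. g (vec2 s b))" "continuous_on A (\<lambda>s. g (vec2 b s))"
  by (auto intro!: continuous_on_compose2[OF assms] continuous_intros)

text \<open>Gagliardo's argument: along each coordinate line \<open>h\<close> is bounded by an integral over that line,
  so \<open>h\<^sup>2\<close> is bounded by a product of a function of the first and a function of the second coordinate.\<close>

lemma Gagliardo:
  assumes h: "C1per h"
  shows "(\<integral>x. (h x)\<^sup>2 \<partial>torus) \<le>
    (\<integral>x. \<bar>h x\<bar> + \<bar>partial 1 h x\<bar> \<partial>torus) * (\<integral>x. \<bar>h x\<bar> + \<bar>partial 2 h x\<bar> \<partial>torus)"
proof -
  note [continuous_intros] = C1perD(2,3)[OF h]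
  have c1: "continuous_on UNIV (\<lambda>x. \<bar>h x\<bar> + \<bar>partial 1 h x\<bar>)"
   and c2: "continuous_on UNIV (\<lambda>x. \<bar>h x\<bar> + \<bar>partial 2 h x\<bar>)"
   and c3: "continuous_on UNIV (\<lambda>x. (h x)\<^sup>2)"
    by (intro continuous_intros)+
  define A where "A b = (LINT s:{0..1}|lborel. \<bar>h (vec2 s b)\<bar> + \<bar>partial 1 h (vec2 s b)\<bar>)" for b
  define B where "B a = (LINT s:{0..1}|lborel. \<bar>h (vec2 a s)\<bar> + \<bar>partial 2 h (vec2 a s)\<bar>)" for a
  have A: "\<bar>h (vec2 a b)\<bar> \<le> A b" if "a \<in> {0..1}" for a b
    unfolding A_def using C1per_line[OF h, of "vec2 0 b" 1]
    by (intro sup_bound_unit_interval[OF _ _ that] continuous_on_vec2_comp C1perD[OF h])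
       (simp flip: vec2_axis(1))
  have B: "\<bar>h (vec2 a b)\<bar> \<le> B a" if "b \<in> {0..1}" for a b
    unfolding B_def using C1per_line[OF h, of "vec2 a 0" 2]
    by (intro sup_bound_unit_interval[OF _ _ that] continuous_on_vec2_comp C1perD[OF h])
       (simp flip: vec2_axis(2))
  have iA: "set_integrable lborel {0..1} A" and iB: "set_integrable lborel {0..1} B"
    unfolding A_def B_def using integrable_inner2[OF c1] integrable_inner1[OF c2] by auto
  have "(\<integral>x. (h x)\<^sup>2 \<partial>torus) = (LINT b:{0..1}|lborel. LINT a:{0..1}|lborel. (h (vec2 a b))\<^sup>2)"
    by (rule integral_torus_iterated2[OF c3])
  also have "\<dots> \<le> (LINT b:{0..1}|lborel. A b * (LINT a:{0..1}|lborel. B a))"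
  proof (intro set_integral_mono integrable_inner2[OF c3] set_integrable_mult_left iA impI)
    fix b :: real assume b: "b \<in> {0..1}"
    have "(LINT a:{0..1}|lborel. (h (vec2 a b))\<^sup>2) \<le> (LINT a:{0..1}|lborel. A b * B a)"
    proof (intro set_integral_mono set_integrable_mult_right iB impI
        borel_integrable_atLeastAtMost'[OF continuous_on_vec2_comp(1)[OF c3]])
      fix a :: real assume a: "a \<in> {0..1}"
      have "(h (vec2 a b))\<^sup>2 = \<bar>h (vec2 a b)\<bar> * \<bar>h (vec2 a b)\<bar>" by (simp add: power2_eq_square)
      also have "\<dots> \<le> A b * B a"
        using A[OF a, of b] B[OF b, of a] by (intro mult_mono) auto
      finally show "(h (vec2 a b))\<^sup>2 \<le> A b * B a" .
    qed
    then show "(LINT a:{0..1}|lborel. (h (vec2 a b))\<^sup>2) \<le> A b * (LINT a:{0..1}|lborel. B a)"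
      by simp
  qed
  also have "\<dots> = (LINT b:{0..1}|lborel. A b) * (LINT a:{0..1}|lborel. B a)" by simp
  finally show ?thesis
    unfolding integral_torus_iterated2[OF c1] integral_torus_iterated1[OF c2] A_def B_def .
qed

text \<open>\<open>Gagliardo\<close> applied to the square of \<open>g\<close> controls the fourth
  moment \<open>Q\<close> by the second moment \<open>N\<close> and the gradient. Interpolating
  \<open>N\<close> between the first moment \<open>L\<close> and \<open>Q\<close> then eliminates
  \<open>Q\<close>. The term \<open>2 * N\<close> on the right cannot be dropped on the torus, where
  nonzero constants have zero gradient.\<close>

lemma Nash:
  assumes g: "C1per g"
  shows "(\<integral>x. (g x)\<^sup>2 \<partial>torus)\<^sup>2 \<le> (\<integral>x. \<bar>g x\<bar> \<partial>torus)\<^sup>2 *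
    (2 * (\<integral>x. (g x)\<^sup>2 \<partial>torus) + 4 * ((\<integral>x. (partial 1 g x)\<^sup>2 \<partial>torus) + (\<integral>x. (partial 2 g x)\<^sup>2 \<partial>torus)))"
proof -
  note [continuous_intros] = C1perD(2,3)[OF g]
  define L N A1 A2 X1 X2 T Q where
    "L = (\<integral>x. \<bar>g x\<bar> \<partial>torus)" and "N = (\<integral>x. (g x)\<^sup>2 \<partial>torus)"
    and "A1 = (\<integral>x. (partial 1 g x)\<^sup>2 \<partial>torus)" and "A2 = (\<integral>x. (partial 2 g x)\<^sup>2 \<partial>torus)"
    and "X1 = (\<integral>x. \<bar>g x\<bar> * \<bar>partial 1 g x\<bar> \<partial>torus)" and "X2 = (\<integral>x. \<bar>g x\<bar> * \<bar>partial 2 g x\<bar> \<partial>torus)"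
    and "T = (\<integral>x. \<bar>g x\<bar> * (g x)\<^sup>2 \<partial>torus)" and "Q = (\<integral>x. (g x * g x)\<^sup>2 \<partial>torus)"
  have nn: "0 \<le> N" "0 \<le> L" "0 \<le> A1" "0 \<le> A2" "0 \<le> T" "0 \<le> Q"
    unfolding N_def L_def A1_def A2_def T_def Q_def by (auto intro: integral_nonneg_AE)
  have X1: "X1\<^sup>2 \<le> N * A1"
    using Cauchy_Schwarz_integral[of torus "\<lambda>x. \<bar>g x\<bar>" "\<lambda>x. \<bar>partial 1 g x\<bar>"]
    unfolding X1_def N_def A1_def by (simp add: continuous_integrable_torus continuous_intros)
  have X2: "X2\<^sup>2 \<le> N * A2"
    using Cauchy_Schwarz_integral[of torus "\<lambda>x. \<bar>g x\<bar>" "\<lambda>x. \<bar>partial 2 g x\<bar>"]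
    unfolding X2_def N_def A2_def by (simp add: continuous_integrable_torus continuous_intros)
  \<comment> \<open>Split the square as \<open>\<bar>g\<bar>\<close> to the power 1/2 times
    \<open>\<bar>g\<bar>\<close> to the power 3/2.\<close>
  have N2: "N\<^sup>2 \<le> L * T"
  proof -
    have 1: "sqrt \<bar>t\<bar> * (sqrt \<bar>t\<bar> * \<bar>t\<bar>) = t\<^sup>2" "(sqrt \<bar>t\<bar> * \<bar>t\<bar>)\<^sup>2 = \<bar>t\<bar> * t\<^sup>2" for t :: real
      by (simp_all add: power2_eq_square flip: mult.assoc)
    show ?thesis
      using Cauchy_Schwarz_integral[of torus "\<lambda>x. sqrt \<bar>g x\<bar>" "\<lambda>x. sqrt \<bar>g x\<bar> * \<bar>g x\<bar>"]
      unfolding N_def L_def T_def 1 by (simp add: continuous_integrable_torus continuous_intros)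
  qed
  have T2: "T\<^sup>2 \<le> N * Q"
    using Cauchy_Schwarz_integral[of torus "\<lambda>x. \<bar>g x\<bar>" "\<lambda>x. (g x)\<^sup>2"]
    unfolding T_def N_def Q_def by (simp add: continuous_integrable_torus continuous_intros flip: power2_eq_square)
  have "Q \<le> (\<integral>x. (g x)\<^sup>2 + 2 * (\<bar>g x\<bar> * \<bar>partial 1 g x\<bar>) \<partial>torus) * (\<integral>x. (g x)\<^sup>2 + 2 * (\<bar>g x\<bar> * \<bar>partial 2 g x\<bar>) \<partial>torus)"
    using Gagliardo[OF C1per_mult[OF g g]] unfolding Q_def partial_mult[OF g g]
    by (simp add: abs_mult mult.commute power2_eq_square flip: mult_2)
  also have "\<dots> = (N + 2 * X1) * (N + 2 * X2)"
    unfolding N_def X1_def X2_def by (simp add: continuous_integrable_torus continuous_intros)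
  also have "\<dots> \<le> 2 * N\<^sup>2 + 4 * X1\<^sup>2 + 4 * X2\<^sup>2"
  proof -
    \<comment> \<open>Half of this sum of squares is the difference of the two sides.\<close>
    have "0 \<le> (N - 2 * X1)\<^sup>2 + (N - 2 * X2)\<^sup>2 + (2 * X1 - 2 * X2)\<^sup>2" by simp
    then show ?thesis by (simp add: power2_eq_square algebra_simps)
  qed
  also have "\<dots> \<le> 2 * N\<^sup>2 + 4 * (N * A1) + 4 * (N * A2)"
    using X1 X2 by simp
  finally have Q: "Q \<le> N * (2 * N + 4 * (A1 + A2))"
    by (simp add: power2_eq_square algebra_simps)
  have "N\<^sup>2 \<le> L\<^sup>2 * (2 * N + 4 * (A1 + A2))"
  proof (cases "N = 0")
    case False
    then have N: "0 < N" using nn by simp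
    \<comment> \<open>Squaring \<open>N2\<close> lets \<open>T2\<close> and then the bound on
      \<open>Q\<close> be inserted; both sides then carry a factor \<open>N\<^sup>2\<close>, which
      is cancelled.\<close>
    have "(N\<^sup>2)\<^sup>2 \<le> (L * T)\<^sup>2" using N2 by (intro power_mono) auto
    also have "\<dots> = L\<^sup>2 * T\<^sup>2" by (simp add: power_mult_distrib)
    also have "\<dots> \<le> L\<^sup>2 * (N * Q)" using T2 by (intro mult_left_mono) auto
    also have "\<dots> \<le> L\<^sup>2 * (N * (N * (2 * N + 4 * (A1 + A2))))"
      using Q nn by (intro mult_left_mono) auto
    finally have "N\<^sup>2 * N\<^sup>2 \<le> N\<^sup>2 * (L\<^sup>2 * (2 * N + 4 * (A1 + A2)))"
      by (simp add: power2_eq_square algebra_simps)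
    moreover have "0 < N\<^sup>2" using N by simp
    ultimately show ?thesis by (rule mult_left_le_imp_le)
  qed (use nn in auto)
  then show ?thesis unfolding N_def L_def A1_def A2_def .
qed

section \<open>Identities for solenoidal fields\<close>

lemma integral_div_zero:
  assumes "C1per g" "C1per h"
  shows "(\<integral>x. partial 1 g x + partial 2 h x \<partial>torus) = 0"
  using assms by (simp add: integral_partial_zero C1perD(3) continuous_integrable_torus)

locale solenoidal =
  fixes v :: "real^2 \<Rightarrow> real^2"
  assumes smooth: "smooth_torus v" and div0: "\<And>x. divergence v x = 0"
begin

definition V :: "2 \<Rightarrow> real^2 \<Rightarrow> real" where "V k = (\<lambda>y. v y $ k)"

lemma smooth_V: "smooth_torus (V k)"
  unfolding V_def by (rule smooth_component[OF smooth])

lemma V_C1per: "C1per (V k)" "C1per (partial i (V k))" "C1per (partial j (partial i (V k)))"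
  by (intro smooth_C1per smooth_partial smooth_V)+

lemma curl_eq: "curl v = (\<lambda>x. partial 1 (V 2) x - partial 2 (V 1) x)"
  by (auto simp: curl_def V_def)

lemma smooth_curl: "smooth_torus (curl v)"
  unfolding curl_eq by (intro smooth_diff smooth_partial smooth_V)

lemma curl_C1per: "C1per (curl v)" "C1per (partial i (curl v))"
  by (intro smooth_C1per smooth_partial smooth_curl)+

lemma div_V: "partial 2 (V 2) = (\<lambda>x. - partial 1 (V 1) x)"
proof
  fix x
  show "partial 2 (V 2) x = - partial 1 (V 1) x"
    using div0[of x] by (simp add: divergence_def sum_2 V_def)
qed

lemma partial_curl: "partial i (curl v) x = partial i (partial 1 (V 2)) x - partial i (partial 2 (V 1)) x"
  unfolding curl_eq partial_diff[OF V_C1per(2) V_C1per(2)] ..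

lemma partial_div_V: "partial i (partial 2 (V 2)) x = - partial i (partial 1 (V 1)) x"
  unfolding div_V using partial_cmult[OF V_C1per(2), of i "-1"] by simp

lemma mixed_V: "partial 2 (partial 1 (V k)) x = partial 1 (partial 2 (V k)) x"
  by (rule smooth_partial_commute[OF smooth_V])

lemma grad_norm_sq_eq: "grad_norm_sq v x = (partial 1 (V 1) x)\<^sup>2 + (partial 2 (V 1) x)\<^sup>2
    + (partial 1 (V 2) x)\<^sup>2 + (partial 2 (V 2) x)\<^sup>2"
  by (simp add: grad_norm_sq_def sum_2 V_def)

lemma laplacian_component: "laplacian v x $ k = partial 1 (partial 1 (V k)) x + partial 2 (partial 2 (V k)) x"
proof -
  have "partial i (partial i v) x $ k = partial i (partial i (V k)) x" for i
    using fun_cong[OF smooth_partial_component[OF smooth_partial[OF smooth], of i i k], of x]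
      smooth_partial_component[OF smooth, of i k] unfolding V_def by simp
  then show ?thesis by (simp add: laplacian_def sum_2)
qed

text \<open>The gradient of the vanishing divergence supplies the missing second derivatives. Hence
  a bound on the Laplacian is a bound on the full gradient of the scalar vorticity, the form in
  which Nash's inequality uses it.\<close>

lemma laplacian_curl: "laplacian v x $ 1 = - partial 2 (curl v) x" "laplacian v x $ 2 = partial 1 (curl v) x"
  unfolding laplacian_component partial_curl
  using partial_div_V[of 1 x] partial_div_V[of 2 x] mixed_V[of 1 x] mixed_V[of 2 x] by simp_all

lemma continuous_facts [continuous_intros]:
  "continuous_on UNIV (V k)" "continuous_on UNIV (partial i (V k))"
  "continuous_on UNIV (partial j (partial i (V k)))"
  "continuous_on UNIV (curl v)" "continuous_on UNIV (partial i (curl v))"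
  using V_C1per curl_C1per C1perD by blast+

lemma continuous_v [continuous_intros]: "continuous_on UNIV v"
  using C1perD smooth Ck.simps(1) by (metis smooth_torus_def)

lemma continuous_laplacian [continuous_intros]: "continuous_on UNIV (laplacian v)"
proof -
  have "laplacian v = (\<lambda>x. \<chi> k. partial 1 (partial 1 (V k)) x + partial 2 (partial 2 (V k)) x)"
    by (auto simp: vec_eq_iff laplacian_component)
  then show ?thesis by (simp only:) (intro continuous_intros)
qed

lemma continuous_grad_norm_sq [continuous_intros]: "continuous_on UNIV (grad_norm_sq v)"
  unfolding grad_norm_sq_eq[abs_def] by (intro continuous_intros)

lemma norm_sq_v: "(norm (v x))\<^sup>2 = (V 1 x)\<^sup>2 + (V 2 x)\<^sup>2"
  unfolding power2_norm_eq_inner by (simp add: inner_vec_def sum_2 V_def power2_eq_square)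

lemma norm_sq_laplacian: "(norm (laplacian v x))\<^sup>2 = (partial 1 (curl v) x)\<^sup>2 + (partial 2 (curl v) x)\<^sup>2"
  unfolding power2_norm_eq_inner by (simp add: inner_vec_def sum_2 laplacian_curl power2_eq_square)

text \<open>Integrate the divergence of \<open>\<phi>\<close> times the gradient of half the squared
  length of \<open>v\<close>.\<close>

lemma grad_energy:
  assumes \<phi>: "C1per \<phi>"
  shows "(\<integral>x. \<phi> x * grad_norm_sq v x \<partial>torus) + (\<integral>x. \<phi> x * (v x \<bullet> laplacian v x) \<partial>torus)
    = - (\<integral>x. (\<Sum>j\<in>UNIV. partial j \<phi> x * (V 1 x * partial j (V 1) x + V 2 x * partial j (V 2) x)) \<partial>torus)"
proof -
  note [continuous_intros] = C1perD(2,3)[OF \<phi>]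
  let ?G = "\<lambda>j x. \<phi> x * (V 1 x * partial j (V 1) x + V 2 x * partial j (V 2) x)"
  have G: "C1per (?G j)" for j
    by (intro C1per_mult C1per_add \<phi> V_C1per)
  have dG: "partial j (?G j) x = partial j \<phi> x * (V 1 x * partial j (V 1) x + V 2 x * partial j (V 2) x)
     + \<phi> x * ((partial j (V 1) x)\<^sup>2 + (partial j (V 2) x)\<^sup>2 + V 1 x * partial j (partial j (V 1)) x
         + V 2 x * partial j (partial j (V 2)) x)" for j x
    by (simp add: partial_mult partial_add \<phi> V_C1per C1per_add C1per_mult power2_eq_square algebra_simps)
  have "0 = (\<integral>x. partial 1 (?G 1) x + partial 2 (?G 2) x \<partial>torus)"
    using integral_div_zero[OF G G] by simp
  also have "\<dots> = (\<integral>x. (\<phi> x * grad_norm_sq v x + \<phi> x * (v x \<bullet> laplacian v x))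
      + (\<Sum>j\<in>UNIV. partial j \<phi> x * (V 1 x * partial j (V 1) x + V 2 x * partial j (V 2) x)) \<partial>torus)"
    unfolding dG
    by (intro Bochner_Integration.integral_cong refl)
       (simp add: grad_norm_sq_eq inner_vec_def sum_2 laplacian_component V_def algebra_simps)
  also have "\<dots> = (\<integral>x. \<phi> x * grad_norm_sq v x \<partial>torus) + (\<integral>x. \<phi> x * (v x \<bullet> laplacian v x) \<partial>torus)
    + (\<integral>x. (\<Sum>j\<in>UNIV. partial j \<phi> x * (V 1 x * partial j (V 1) x + V 2 x * partial j (V 2) x)) \<partial>torus)"
    by (subst Bochner_Integration.integral_add Bochner_Integration.integral_add;
        (intro continuous_integrable_torus continuous_intros)?)+ simp
  finally show ?thesis by simp
qed

text \<open>Integrate the divergence of \<open>\<phi>\<close> times the convective derivative of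
  \<open>v\<close> along itself. For a solenoidal field the trace of the squared Jacobian equals
  \<open>grad_norm_sq\<close> minus the squared vorticity.\<close>

lemma grad_curl:
  assumes \<phi>: "C1per \<phi>"
  shows "(\<integral>x. \<phi> x * grad_norm_sq v x \<partial>torus) - (\<integral>x. \<phi> x * (curl v x)\<^sup>2 \<partial>torus)
    = - (\<integral>x. (\<Sum>j\<in>UNIV. partial j \<phi> x * (V 1 x * partial 1 (V j) x + V 2 x * partial 2 (V j) x)) \<partial>torus)"
proof -
  note [continuous_intros] = C1perD(2,3)[OF \<phi>]
  let ?G = "\<lambda>j x. \<phi> x * (V 1 x * partial 1 (V j) x + V 2 x * partial 2 (V j) x)"
  have G: "C1per (?G j)" for j
    by (intro C1per_mult C1per_add \<phi> V_C1per)
  have dG: "partial j (?G j) x = partial j \<phi> x * (V 1 x * partial 1 (V j) x + V 2 x * partial 2 (V j) x)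
     + \<phi> x * (partial j (V 1) x * partial 1 (V j) x + partial j (V 2) x * partial 2 (V j) x
         + V 1 x * partial j (partial 1 (V j)) x + V 2 x * partial j (partial 2 (V j)) x)" for j x
    by (simp add: partial_mult partial_add \<phi> V_C1per C1per_add C1per_mult power2_eq_square algebra_simps)
  have eq: "partial 1 (?G 1) x + partial 2 (?G 2) x = (\<phi> x * grad_norm_sq v x - \<phi> x * (curl v x)\<^sup>2)
      + (\<Sum>j\<in>UNIV. partial j \<phi> x * (V 1 x * partial 1 (V j) x + V 2 x * partial 2 (V j) x))" for x
  proof -
    \<comment> \<open>Facts 1 and 2 cancel the second derivatives, which together form the
      derivative of the divergence along \<open>v\<close>.\<close>
    have 1: "partial 2 (partial 1 (V 2)) x = - partial 1 (partial 1 (V 1)) x"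
      using partial_div_V[of 1 x] mixed_V[of 2 x] by simp
    have 2: "partial 2 (partial 2 (V 2)) x = - partial 1 (partial 2 (V 1)) x"
      using partial_div_V[of 2 x] mixed_V[of 1 x] by simp
    have 3: "partial 2 (V 2) x = - partial 1 (V 1) x" by (simp add: div_V)
    show ?thesis unfolding dG grad_norm_sq_eq curl_eq sum_2 1 2 3
      by (simp add: power2_eq_square algebra_simps)
  qed
  have "0 = (\<integral>x. partial 1 (?G 1) x + partial 2 (?G 2) x \<partial>torus)"
    using integral_div_zero[OF G G] by simp
  also have "\<dots> = (\<integral>x. \<phi> x * grad_norm_sq v x \<partial>torus) - (\<integral>x. \<phi> x * (curl v x)\<^sup>2 \<partial>torus)
    + (\<integral>x. (\<Sum>j\<in>UNIV. partial j \<phi> x * (V 1 x * partial 1 (V j) x + V 2 x * partial 2 (V j) x)) \<partial>torus)"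
    unfolding eq
    by (subst Bochner_Integration.integral_add Bochner_Integration.integral_diff;
        (intro continuous_integrable_torus continuous_intros)?)+ simp
  finally show ?thesis by simp
qed

text \<open>Splitting the viscosity evenly, one half-power goes with the derivative into the
  dissipation and the other stays in front, so the error vanishes. The derivatives are left as
  letters because the energy and the vorticity identity pair them differently with the components of
  \<open>v\<close>.\<close>

lemma commutator_bound:
  fixes \<nu> K :: real
  assumes \<nu>: "0 < \<nu>" and K: "\<And>j. \<bar>c j\<bar> \<le> K"
    and s: "s = V 1 x * p1 + V 2 x * p2" "t = V 1 x * q1 + V 2 x * q2"
    and g: "grad_norm_sq v x = p1\<^sup>2 + p2\<^sup>2 + q1\<^sup>2 + q2\<^sup>2"
  shows "\<nu> * \<bar>(c 1 * s + c 2 * t)\<bar> \<le> K * sqrt \<nu> * ((norm (v x))\<^sup>2 + \<nu> * grad_norm_sq v x)"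
proof -
  have K0: "0 \<le> K" using K[of 1] by linarith
  have am: "\<nu> * \<bar>y * p\<bar> \<le> sqrt \<nu> * ((y\<^sup>2 + \<nu> * p\<^sup>2) / 2)" for y p
  proof -
    have "0 \<le> (\<bar>y\<bar> - sqrt \<nu> * \<bar>p\<bar>)\<^sup>2" by simp
    then have "sqrt \<nu> * \<bar>y * p\<bar> \<le> (y\<^sup>2 + \<nu> * p\<^sup>2) / 2"
      using \<nu> by (simp add: power2_diff power_mult_distrib abs_mult mult.left_commute mult.commute)
    then have "sqrt \<nu> * (sqrt \<nu> * \<bar>y * p\<bar>) \<le> sqrt \<nu> * ((y\<^sup>2 + \<nu> * p\<^sup>2) / 2)"
      using \<nu> by (intro mult_left_mono) auto
    then show ?thesis using \<nu> by (simp flip: mult.assoc)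
  qed
  have "\<bar>c 1 * s + c 2 * t\<bar> \<le> \<bar>c 1\<bar> * \<bar>s\<bar> + \<bar>c 2\<bar> * \<bar>t\<bar>"
    by (metis abs_mult abs_triangle_ineq)
  also have "\<dots> \<le> K * \<bar>s\<bar> + K * \<bar>t\<bar>"
    using K by (intro add_mono mult_right_mono) auto
  also have "\<dots> = K * (\<bar>s\<bar> + \<bar>t\<bar>)" by (simp add: algebra_simps)
  also have "\<dots> \<le> K * (\<bar>V 1 x * p1\<bar> + \<bar>V 2 x * p2\<bar> + (\<bar>V 1 x * q1\<bar> + \<bar>V 2 x * q2\<bar>))"
    unfolding s using K0 by (intro mult_left_mono add_mono abs_triangle_ineq) auto
  finally have "\<nu> * \<bar>c 1 * s + c 2 * t\<bar> \<le> \<nu> * (K * (\<bar>V 1 x * p1\<bar> + \<bar>V 2 x * p2\<bar> + (\<bar>V 1 x * q1\<bar> + \<bar>V 2 x * q2\<bar>)))"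
    using \<nu> by (intro mult_left_mono) auto
  also have "\<dots> = K * (\<nu> * \<bar>V 1 x * p1\<bar> + \<nu> * \<bar>V 2 x * p2\<bar> + (\<nu> * \<bar>V 1 x * q1\<bar> + \<nu> * \<bar>V 2 x * q2\<bar>))"
    by (simp add: algebra_simps)
  also have "\<dots> \<le> K * (sqrt \<nu> * (((V 1 x)\<^sup>2 + \<nu> * p1\<^sup>2) / 2) + sqrt \<nu> * (((V 2 x)\<^sup>2 + \<nu> * p2\<^sup>2) / 2)
     + (sqrt \<nu> * (((V 1 x)\<^sup>2 + \<nu> * q1\<^sup>2) / 2) + sqrt \<nu> * (((V 2 x)\<^sup>2 + \<nu> * q2\<^sup>2) / 2)))"
    by (intro mult_left_mono add_mono am K0)
  \<comment> \<open>Each component of \<open>v\<close> occurs in two of the four products, which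
    undoes the factor 1/2 on the velocity but not the one on the gradient.\<close>
  also have "\<dots> = K * sqrt \<nu> * ((norm (v x))\<^sup>2 + \<nu> * (p1\<^sup>2 + p2\<^sup>2 + q1\<^sup>2 + q2\<^sup>2) / 2)"
    unfolding norm_sq_v by (simp add: field_simps)
  also have "\<dots> \<le> K * sqrt \<nu> * ((norm (v x))\<^sup>2 + \<nu> * grad_norm_sq v x)"
    unfolding g using K0 \<nu> by (intro mult_left_mono) auto
  finally show ?thesis .
qed

lemma
  fixes \<nu> K :: real
  assumes \<phi>: "C1per \<phi>" and \<nu>: "0 < \<nu>" and K: "\<And>j x. x \<in> cell \<Longrightarrow> \<bar>partial j \<phi> x\<bar> \<le> K"
  defines "E \<equiv> K * sqrt \<nu> * ((\<integral>x. (norm (v x))\<^sup>2 \<partial>torus) + (\<integral>x. \<nu> * grad_norm_sq v x \<partial>torus))"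
  shows grad_energy_bound: "\<bar>(\<integral>x. \<phi> x * (\<nu> * grad_norm_sq v x) \<partial>torus) + (\<integral>x. \<phi> x * (v x \<bullet> (\<nu> *\<^sub>R laplacian v x)) \<partial>torus)\<bar> \<le> E"
    and grad_curl_bound: "\<bar>(\<integral>x. \<phi> x * (\<nu> * grad_norm_sq v x) \<partial>torus) - (\<integral>x. \<nu> * (\<phi> x * (curl v x)\<^sup>2) \<partial>torus)\<bar> \<le> E"
proof -
  note [continuous_intros] = C1perD(2,3)[OF \<phi>]
  \<comment> \<open>Both identities end in derivatives of \<open>\<phi>\<close> times a field
    \<open>r\<close>; the pointwise premise on \<open>r\<close> is what
    \<open>commutator_bound\<close> delivers.\<close>
  have bd: "\<bar>\<nu> * - (\<integral>x. (\<Sum>j\<in>UNIV. partial j \<phi> x * r j x) \<partial>torus)\<bar> \<le> E"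
    if r: "\<And>j. continuous_on UNIV (r j)" and b: "\<And>x. x \<in> cell \<Longrightarrow> \<nu> * \<bar>(\<Sum>j\<in>UNIV. partial j \<phi> x * r j x)\<bar> \<le>
      K * sqrt \<nu> * ((norm (v x))\<^sup>2 + \<nu> * grad_norm_sq v x)" for r :: "2 \<Rightarrow> real^2 \<Rightarrow> real"
  proof -
    have "\<bar>\<nu> * - (\<integral>x. (\<Sum>j\<in>UNIV. partial j \<phi> x * r j x) \<partial>torus)\<bar>
       = \<nu> * \<bar>\<integral>x. (\<Sum>j\<in>UNIV. partial j \<phi> x * r j x) \<partial>torus\<bar>"
      using \<nu> by (simp add: abs_mult)
    also have "\<dots> \<le> \<nu> * (\<integral>x. \<bar>\<Sum>j\<in>UNIV. partial j \<phi> x * r j x\<bar> \<partial>torus)"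
      using \<nu> by (intro mult_left_mono integral_abs_bound) auto
    also have "\<dots> = (\<integral>x. \<nu> * \<bar>\<Sum>j\<in>UNIV. partial j \<phi> x * r j x\<bar> \<partial>torus)" by simp
    also have "\<dots> \<le> (\<integral>x. K * sqrt \<nu> * ((norm (v x))\<^sup>2 + \<nu> * grad_norm_sq v x) \<partial>torus)"
      using b by (intro integral_mono continuous_integrable_torus continuous_intros r) auto
    also have "\<dots> = E" unfolding E_def
      by (subst Bochner_Integration.integral_add[symmetric])
         (auto intro!: continuous_integrable_torus continuous_intros)
    finally show ?thesis .
  qed
  have "(\<integral>x. \<phi> x * (\<nu> * grad_norm_sq v x) \<partial>torus) + (\<integral>x. \<phi> x * (v x \<bullet> (\<nu> *\<^sub>R laplacian v x)) \<partial>torus)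
    = \<nu> * ((\<integral>x. \<phi> x * grad_norm_sq v x \<partial>torus) + (\<integral>x. \<phi> x * (v x \<bullet> laplacian v x) \<partial>torus))"
    by (simp add: distrib_left mult.left_commute flip: integral_mult_right_zero)
  then show "\<bar>(\<integral>x. \<phi> x * (\<nu> * grad_norm_sq v x) \<partial>torus) + (\<integral>x. \<phi> x * (v x \<bullet> (\<nu> *\<^sub>R laplacian v x)) \<partial>torus)\<bar> \<le> E"
    unfolding grad_energy[OF \<phi>]
  proof (simp only:, intro bd)
    fix x assume x: "x \<in> cell"
    show "\<nu> * \<bar>\<Sum>j\<in>UNIV. partial j \<phi> x * (V 1 x * partial j (V 1) x + V 2 x * partial j (V 2) x)\<bar>
         \<le> K * sqrt \<nu> * ((norm (v x))\<^sup>2 + \<nu> * grad_norm_sq v x)"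
      unfolding sum_2 by (rule commutator_bound[OF \<nu> K[OF x] refl refl]) (simp add: grad_norm_sq_eq)
  qed (intro continuous_intros)
  have "(\<integral>x. \<phi> x * (\<nu> * grad_norm_sq v x) \<partial>torus) - (\<integral>x. \<nu> * (\<phi> x * (curl v x)\<^sup>2) \<partial>torus)
    = \<nu> * ((\<integral>x. \<phi> x * grad_norm_sq v x \<partial>torus) - (\<integral>x. \<phi> x * (curl v x)\<^sup>2 \<partial>torus))"
    by (simp add: right_diff_distrib mult.left_commute flip: integral_mult_right_zero)
  then show "\<bar>(\<integral>x. \<phi> x * (\<nu> * grad_norm_sq v x) \<partial>torus) - (\<integral>x. \<nu> * (\<phi> x * (curl v x)\<^sup>2) \<partial>torus)\<bar> \<le> E"
    unfolding grad_curl[OF \<phi>]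
  proof (simp only:, intro bd)
    fix x assume x: "x \<in> cell"
    show "\<nu> * \<bar>\<Sum>j\<in>UNIV. partial j \<phi> x * (V 1 x * partial 1 (V j) x + V 2 x * partial 2 (V j) x)\<bar>
         \<le> K * sqrt \<nu> * ((norm (v x))\<^sup>2 + \<nu> * grad_norm_sq v x)"
      unfolding sum_2 by (rule commutator_bound[OF \<nu> K[OF x] refl refl]) (simp add: grad_norm_sq_eq)
  qed (intro continuous_intros)
qed

text \<open>Write \<open>\<omega> = curl v\<close> and \<open>P = p + \<bar>v\<bar>\<^sup>2 / 2\<close>. Then \<open>div (v \<otimes> v) + \<nabla>p = \<nabla>P + \<omega> v\<^sup>\<bottom>\<close> and \<open>\<Delta>v = \<nabla>\<^sup>\<bottom>\<omega>\<close>, and both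
  \<open>\<nabla>P \<bullet> \<nabla>\<^sup>\<bottom>\<omega>\<close> and \<open>\<omega> v\<^sup>\<bottom> \<bullet> \<nabla>\<^sup>\<bottom>\<omega> = v \<bullet> \<nabla>(\<omega>\<^sup>2 / 2)\<close> are divergences.\<close>

lemma enstrophy_balance:
  assumes NS: "stationary_NS \<nu> v p f" and p: "smooth_torus p" and f: "continuous_on UNIV f"
  shows "(\<integral>x. (norm (\<nu> *\<^sub>R laplacian v x))\<^sup>2 \<partial>torus) = - (\<integral>x. f x \<bullet> (\<nu> *\<^sub>R laplacian v x) \<partial>torus)"
proof -
  let ?w = "curl v"
  let ?P = "\<lambda>x. p x + (1/2) * (V 1 x * V 1 x + V 2 x * V 2 x)"
  \<comment> \<open>The components of half the squared vorticity times \<open>v\<close>, plus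
    \<open>?P\<close> times the rotated gradient of the vorticity. Both \<open>v\<close> and the
    rotated gradient are solenoidal.\<close>
  let ?G1 = "\<lambda>x. (1/2) * (V 1 x * (?w x * ?w x)) - ?P x * partial 2 ?w x"
  let ?G2 = "\<lambda>x. ?P x * partial 1 ?w x + (1/2) * (V 2 x * (?w x * ?w x))"
  note p1 = smooth_C1per[OF p]
  note C1 = C1per_add C1per_mult C1per_diff C1per_cmult p1 V_C1per curl_C1per
  note dr = partial_add partial_mult partial_diff partial_cmult
  have G: "C1per ?G1" "C1per ?G2" by (intro C1)+
  have mw: "partial 2 (partial 1 ?w) x = partial 1 (partial 2 ?w) x" for x
    by (rule smooth_partial_commute[OF smooth_curl])
  have NSc: "\<nu> * laplacian v x $ k + f x $ k =
     partial 1 (V k) x * V 1 x + partial 2 (V k) x * V 2 x + partial k p x" for x k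
  proof -
    have "(mat_divergence (\<lambda>y. outer (v y) (v y)) x + grad p x) $ k = (\<nu> *\<^sub>R laplacian v x + f x) $ k"
      using NS by (simp add: stationary_NS_def)
    moreover have "mat_divergence (\<lambda>y. outer (v y) (v y)) x $ k
        = partial 1 (\<lambda>y. V k y * V 1 y) x + partial 2 (\<lambda>y. V k y * V 2 y) x"
      by (simp add: mat_divergence_def outer_def sum_2 V_def)
    ultimately show ?thesis
      unfolding partial_mult[OF V_C1per(1) V_C1per(1)] by (simp add: grad_def div_V)
  qed
  have eq: "\<nu> * (norm (laplacian v x))\<^sup>2 + f x \<bullet> laplacian v x = partial 1 ?G1 x + partial 2 ?G2 x" for x
  proof -
    have "\<nu> * (norm (laplacian v x))\<^sup>2 + f x \<bullet> laplacian v x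
       = (\<nu> * laplacian v x $ 1 + f x $ 1) * laplacian v x $ 1 + (\<nu> * laplacian v x $ 2 + f x $ 2) * laplacian v x $ 2"
      unfolding power2_norm_eq_inner by (simp add: inner_vec_def sum_2 algebra_simps)
    also have "\<dots> = partial 1 ?G1 x + partial 2 ?G2 x" (is ?step)
    proof -
      have d1: "partial 1 ?G1 x = (1/2) * (V 1 x * (2 * ?w x * partial 1 ?w x) + partial 1 (V 1) x * (?w x * ?w x))
        - (?P x * partial 1 (partial 2 ?w) x
            + (partial 1 p x + V 1 x * partial 1 (V 1) x + V 2 x * partial 1 (V 2) x) * partial 2 ?w x)"
        by (simp only: dr C1 C1per_const) (simp add: algebra_simps)
      have d2: "partial 2 ?G2 x = ?P x * partial 2 (partial 1 ?w) x
            + (partial 2 p x + V 1 x * partial 2 (V 1) x + V 2 x * partial 2 (V 2) x) * partial 1 ?w x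
            + (1/2) * (V 2 x * (2 * ?w x * partial 2 ?w x) + partial 2 (V 2) x * (?w x * ?w x))"
        by (simp only: dr C1 C1per_const) (simp add: algebra_simps)
      have w: "?w x = partial 1 (V 2) x - partial 2 (V 1) x" by (simp add: curl_eq)
      have dv: "partial 2 (V 2) x = - partial 1 (V 1) x" by (simp add: div_V)
      show ?step
        unfolding NSc unfolding laplacian_curl d1 d2 mw dv w by (simp add: algebra_simps)
    qed
    finally show ?thesis .
  qed
  note [continuous_intros] = f
  have "0 = (\<integral>x. \<nu> * (norm (laplacian v x))\<^sup>2 + f x \<bullet> laplacian v x \<partial>torus)"
    unfolding eq using integral_div_zero[OF G] by simp
  also have "\<dots> = \<nu> * (\<integral>x. (norm (laplacian v x))\<^sup>2 \<partial>torus) + (\<integral>x. f x \<bullet> laplacian v x \<partial>torus)"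
    by (subst Bochner_Integration.integral_add) (auto intro!: continuous_integrable_torus continuous_intros)
  finally have *: "0 = \<nu> * (\<integral>x. (norm (laplacian v x))\<^sup>2 \<partial>torus) + (\<integral>x. f x \<bullet> laplacian v x \<partial>torus)" .
  have "(\<integral>x. (norm (\<nu> *\<^sub>R laplacian v x))\<^sup>2 \<partial>torus) + (\<integral>x. f x \<bullet> (\<nu> *\<^sub>R laplacian v x) \<partial>torus)
    = \<nu> * (\<nu> * (\<integral>x. (norm (laplacian v x))\<^sup>2 \<partial>torus) + (\<integral>x. f x \<bullet> laplacian v x \<partial>torus))"
    by (simp add: power_mult_distrib power2_eq_square algebra_simps)
  then show ?thesis unfolding *[symmetric] by simp
qed

end

text \<open>Preferred to the product form because the right side is linear in the two squares: it
  passes to the limit term by term, and \<open>\<delta>\<close> can be chosen after the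
  limit.\<close>

lemma Young:
  fixes a b \<delta> :: real
  assumes "0 < \<delta>"
  shows "\<bar>a * b\<bar> \<le> a\<^sup>2 / (2 * \<delta>) + \<delta> * b\<^sup>2 / 2"
proof -
  have "0 \<le> (\<bar>a\<bar> - \<delta> * \<bar>b\<bar>)\<^sup>2" by simp
  then have "2 * (\<delta> * \<bar>a * b\<bar>) \<le> a\<^sup>2 + \<delta>\<^sup>2 * b\<^sup>2"
    by (simp add: power2_diff power_mult_distrib abs_mult mult.left_commute mult.commute)
  then show ?thesis using assms by (simp add: field_simps power2_eq_square)
qed

section \<open>Bounds on the Laplacian against test fields and on the localized enstrophy\<close>

context solenoidal
begin

text \<open>One integration by parts moves a derivative onto \<open>w\<close>. What is left,
  \<open>\<nu>\<close> times the gradient of \<open>v\<close>, is \<open>sqrt \<nu>\<close> times a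
  quantity whose square is the dissipation density.\<close>

lemma integral_test_laplacian_bound:
  fixes \<nu> K :: real
  assumes w: "\<And>k. C1per (\<lambda>x. w x $ k)" and \<nu>: "0 < \<nu>"
    and K: "\<And>j k x. x \<in> cell \<Longrightarrow> \<bar>partial j (\<lambda>y. w y $ k) x\<bar> \<le> K"
  shows "\<bar>\<integral>x. w x \<bullet> (\<nu> *\<^sub>R laplacian v x) \<partial>torus\<bar>
     \<le> K * sqrt \<nu> * (2 * measure torus cell + (\<integral>x. \<nu> * grad_norm_sq v x \<partial>torus))"
proof -
  define W where "W k = (\<lambda>x. w x $ k)" for k
  have W: "C1per (W k)" for k using w by (simp add: W_def)
  note [continuous_intros] = C1perD(2,3)[OF W]
  let ?G = "\<lambda>j x. W 1 x * partial j (V 1) x + W 2 x * partial j (V 2) x"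
  let ?R = "\<lambda>x. partial 1 (W 1) x * partial 1 (V 1) x + partial 1 (W 2) x * partial 1 (V 2) x
     + (partial 2 (W 1) x * partial 2 (V 1) x + partial 2 (W 2) x * partial 2 (V 2) x)"
  have G: "C1per (?G j)" for j
    by (intro C1per_mult C1per_add W V_C1per)
  have dG: "partial 1 (?G 1) x + partial 2 (?G 2) x = w x \<bullet> laplacian v x + ?R x" for x
    by (simp add: partial_mult partial_add W V_C1per C1per_add C1per_mult inner_vec_def sum_2
        laplacian_component algebra_simps flip: W_def)
      (simp add: W_def algebra_simps)
  have cw: "continuous_on UNIV (\<lambda>x. w x \<bullet> laplacian v x)"
  proof -
    have "w = (\<lambda>x. \<chi> k. W k x)" by (auto simp: W_def vec_eq_iff)
    then show ?thesis by (simp only:) (intro continuous_intros)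
  qed
  have "0 = (\<integral>x. w x \<bullet> laplacian v x + ?R x \<partial>torus)"
    unfolding dG[symmetric] using integral_div_zero[OF G G] by simp
  also have "\<dots> = (\<integral>x. w x \<bullet> laplacian v x \<partial>torus) + (\<integral>x. ?R x \<partial>torus)"
    by (intro Bochner_Integration.integral_add continuous_integrable_torus cw) (intro continuous_intros)
  finally have "(\<integral>x. w x \<bullet> laplacian v x \<partial>torus) = - (\<integral>x. ?R x \<partial>torus)"
    by linarith
  then have "(\<integral>x. w x \<bullet> (\<nu> *\<^sub>R laplacian v x) \<partial>torus) = - (\<integral>x. \<nu> * ?R x \<partial>torus)"
    by simp
  then have "\<bar>\<integral>x. w x \<bullet> (\<nu> *\<^sub>R laplacian v x) \<partial>torus\<bar> = \<bar>\<integral>x. \<nu> * ?R x \<partial>torus\<bar>"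
    by (simp only: abs_minus_cancel)
  also have "\<bar>\<integral>x. \<nu> * ?R x \<partial>torus\<bar> \<le> (\<integral>x. \<bar>\<nu> * ?R x\<bar> \<partial>torus)" by (rule integral_abs_bound)
  also have "\<dots> \<le> (\<integral>x. K * sqrt \<nu> * (2 + \<nu> * grad_norm_sq v x) \<partial>torus)"
  proof (rule integral_mono)
    show "integrable torus (\<lambda>x. \<bar>\<nu> * ?R x\<bar>)"
      by (rule continuous_integrable_torus) (intro continuous_intros)
    show "integrable torus (\<lambda>x. K * sqrt \<nu> * (2 + \<nu> * grad_norm_sq v x))"
      by (rule continuous_integrable_torus) (intro continuous_intros)
  next
    fix x assume "x \<in> space torus"
    then have x: "x \<in> cell" by simp
    have K0: "0 \<le> K" using K[OF x, of 1 1] by linarith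
    have t: "\<nu> * \<bar>partial j (W k) x * p\<bar> \<le> K * (sqrt \<nu> * ((1 + \<nu> * p\<^sup>2) / 2))" for j k p
    proof -
      have "\<nu> * \<bar>p\<bar> \<le> sqrt \<nu> * ((1 + \<nu> * p\<^sup>2) / 2)"
      proof -
        \<comment> \<open>Here the first factor is the constant 1. Four entries with weight 1/2
          produce the 2 in the final bound.\<close>
        have "sqrt \<nu> * \<bar>1 * (sqrt \<nu> * p)\<bar> \<le> sqrt \<nu> * (1\<^sup>2 / (2 * 1) + 1 * (sqrt \<nu> * p)\<^sup>2 / 2)"
          using \<nu> by (intro mult_left_mono Young) auto
        then show ?thesis using \<nu>
          by (simp add: abs_mult power_mult_distrib add_divide_distrib flip: mult.assoc)
      qed
      then have "\<bar>partial j (W k) x\<bar> * (\<nu> * \<bar>p\<bar>) \<le> K * (sqrt \<nu> * ((1 + \<nu> * p\<^sup>2) / 2))"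
        using K[OF x, of j k] \<nu> K0 unfolding W_def[symmetric] by (rule_tac mult_mono) auto
      then show ?thesis by (simp add: abs_mult mult.left_commute)
    qed
    have "\<bar>\<nu> * ?R x\<bar> \<le> \<nu> * \<bar>partial 1 (W 1) x * partial 1 (V 1) x\<bar> + \<nu> * \<bar>partial 1 (W 2) x * partial 1 (V 2) x\<bar>
     + (\<nu> * \<bar>partial 2 (W 1) x * partial 2 (V 1) x\<bar> + \<nu> * \<bar>partial 2 (W 2) x * partial 2 (V 2) x\<bar>)"
      unfolding abs_mult[of \<nu>] distrib_left[symmetric] using \<nu>
      by (simp only: abs_of_pos) (intro mult_left_mono; linarith)
    also have "\<dots> \<le> K * (sqrt \<nu> * ((1 + \<nu> * (partial 1 (V 1) x)\<^sup>2) / 2)) + K * (sqrt \<nu> * ((1 + \<nu> * (partial 1 (V 2) x)\<^sup>2) / 2))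
       + (K * (sqrt \<nu> * ((1 + \<nu> * (partial 2 (V 1) x)\<^sup>2) / 2)) + K * (sqrt \<nu> * ((1 + \<nu> * (partial 2 (V 2) x)\<^sup>2) / 2)))"
      by (intro add_mono t)
    also have "\<dots> = K * sqrt \<nu> * (2 + \<nu> * grad_norm_sq v x / 2)"
      unfolding grad_norm_sq_eq by (simp add: field_simps)
    also have "\<dots> \<le> K * sqrt \<nu> * (2 + \<nu> * grad_norm_sq v x)"
      using K0 \<nu> by (intro mult_left_mono) (auto simp: grad_norm_sq_eq)
    finally show "\<bar>\<nu> * ?R x\<bar> \<le> K * sqrt \<nu> * (2 + \<nu> * grad_norm_sq v x)" .
  qed
  also have "\<dots> = K * sqrt \<nu> * (2 * measure torus cell + (\<integral>x. \<nu> * grad_norm_sq v x \<partial>torus))"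
    by (simp add: Bochner_Integration.integral_add continuous_integrable_torus continuous_intros)
  finally show ?thesis .
qed

lemma curl_sq_le: "(curl v x)\<^sup>2 \<le> 2 * grad_norm_sq v x"
proof -
  have "0 \<le> (partial 1 (V 2) x + partial 2 (V 1) x)\<^sup>2" by simp
  then have "(curl v x)\<^sup>2 \<le> 2 * ((partial 2 (V 1) x)\<^sup>2 + (partial 1 (V 2) x)\<^sup>2)"
    by (simp add: curl_eq power2_eq_square algebra_simps)
  also have "\<dots> \<le> 2 * grad_norm_sq v x" by (simp add: grad_norm_sq_eq)
  finally show ?thesis .
qed

text \<open>Nash's inequality for \<open>\<phi>\<close> times the vorticity, multiplied by
  \<open>\<nu>\<^sup>2\<close>. When the derivative hits the vorticity, that factor turns it into
  the squared length of the scaled Laplacian, still weighted by the square of \<open>\<phi>\<close>.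
  The remaining terms retain a spare factor \<open>\<nu>\<close>, and \<open>K\<close> occurs only
  there.\<close>

lemma local_enstrophy_bound:
  fixes \<nu> K \<delta> :: real
  assumes \<phi>: "C1per \<phi>" and \<nu>: "0 < \<nu>" and \<delta>: "0 < \<delta>"
    and K: "\<And>x. x \<in> cell \<Longrightarrow> \<bar>\<phi> x\<bar> \<le> K" "\<And>j x. x \<in> cell \<Longrightarrow> \<bar>partial j \<phi> x\<bar> \<le> K"
  shows "(\<integral>x. \<nu> * ((\<phi> x)\<^sup>2 * (curl v x)\<^sup>2) \<partial>torus) \<le> (\<integral>x. \<bar>\<phi> x\<bar> * \<bar>curl v x\<bar> \<partial>torus)\<^sup>2 / (2 * \<delta>)
     + \<delta> * (18 * K\<^sup>2 * \<nu> * (\<integral>x. \<nu> * grad_norm_sq v x \<partial>torus)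
           + 4 * (\<integral>x. (\<phi> x)\<^sup>2 * (norm (\<nu> *\<^sub>R laplacian v x))\<^sup>2 \<partial>torus))"
proof -
  note [continuous_intros] = C1perD(2,3)[OF \<phi>]
  let ?g = "\<lambda>x. \<phi> x * curl v x"
  have g: "C1per ?g" by (intro C1per_mult \<phi> curl_C1per)
  define N L A where "N = (\<integral>x. (?g x)\<^sup>2 \<partial>torus)" and "L = (\<integral>x. \<bar>?g x\<bar> \<partial>torus)"
    and "A = (\<integral>x. (partial 1 ?g x)\<^sup>2 \<partial>torus) + (\<integral>x. (partial 2 ?g x)\<^sup>2 \<partial>torus)"
  define G Z where "G = (\<integral>x. \<nu> * grad_norm_sq v x \<partial>torus)"
    and "Z = (\<integral>x. (\<phi> x)\<^sup>2 * (norm (\<nu> *\<^sub>R laplacian v x))\<^sup>2 \<partial>torus)"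
  note [continuous_intros] = C1perD(2,3)[OF g]
  have "N\<^sup>2 \<le> L\<^sup>2 * (2 * N + 4 * A)" using Nash[OF g] by (simp add: N_def L_def A_def)
  then have "\<nu>\<^sup>2 * N\<^sup>2 \<le> \<nu>\<^sup>2 * (L\<^sup>2 * (2 * N + 4 * A))" by (intro mult_left_mono) auto
  then have sq: "(\<nu> * N)\<^sup>2 \<le> L\<^sup>2 * (\<nu>\<^sup>2 * (2 * N + 4 * A))" by (simp add: power_mult_distrib mult.left_commute)
  have nn: "0 \<le> N" "0 \<le> A" "0 \<le> L" unfolding N_def A_def L_def by auto
  have young: "\<nu> * N \<le> L\<^sup>2 / (2 * \<delta>) + \<delta> * (\<nu>\<^sup>2 * (2 * N + 4 * A)) / 2"
  proof -
    have "\<nu> * N \<le> L * sqrt (\<nu>\<^sup>2 * (2 * N + 4 * A))"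
    proof (rule power2_le_imp_le)
      have "0 \<le> \<nu>\<^sup>2 * (2 * N + 4 * A)" using nn by simp
      then show "(\<nu> * N)\<^sup>2 \<le> (L * sqrt (\<nu>\<^sup>2 * (2 * N + 4 * A)))\<^sup>2"
        using sq by (simp only: power_mult_distrib[of L] real_sqrt_pow2)
      show "0 \<le> L * sqrt (\<nu>\<^sup>2 * (2 * N + 4 * A))"
        using nn by simp
    qed
    also have "\<dots> \<le> \<bar>L * sqrt (\<nu>\<^sup>2 * (2 * N + 4 * A))\<bar>" by simp
    also have "\<dots> \<le> L\<^sup>2 / (2 * \<delta>) + \<delta> * (sqrt (\<nu>\<^sup>2 * (2 * N + 4 * A)))\<^sup>2 / 2" by (rule Young[OF \<delta>])
    also have "(sqrt (\<nu>\<^sup>2 * (2 * N + 4 * A)))\<^sup>2 = \<nu>\<^sup>2 * (2 * N + 4 * A)"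
      using nn by (intro real_sqrt_pow2) simp
    finally show ?thesis .
  qed
  have "\<nu>\<^sup>2 * (2 * N + 4 * A) = (\<integral>x. \<nu>\<^sup>2 * (2 * (?g x)\<^sup>2 + 4 * ((partial 1 ?g x)\<^sup>2 + (partial 2 ?g x)\<^sup>2)) \<partial>torus)"
    unfolding N_def A_def by (simp add: continuous_integrable_torus continuous_intros)
  \<comment> \<open>The product rule with \<open>(a + b)^2 \<le> 2 a^2 + 2 b^2\<close> gives
    \<open>8 = 4 * 2\<close> for the Laplacian and \<open>2 + 4 * 2 * 2 = 18\<close> for the squared
    vorticity, which \<open>curl_sq_le\<close> doubles to 36.\<close>
  also have "\<dots> \<le> (\<integral>x. 36 * K\<^sup>2 * \<nu> * (\<nu> * grad_norm_sq v x) + 8 * ((\<phi> x)\<^sup>2 * (norm (\<nu> *\<^sub>R laplacian v x))\<^sup>2) \<partial>torus)"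
  proof (rule integral_mono)
    show "integrable torus (\<lambda>x. \<nu>\<^sup>2 * (2 * (?g x)\<^sup>2 + 4 * ((partial 1 ?g x)\<^sup>2 + (partial 2 ?g x)\<^sup>2)))"
      by (rule continuous_integrable_torus) (intro continuous_intros)
    show "integrable torus (\<lambda>x. 36 * K\<^sup>2 * \<nu> * (\<nu> * grad_norm_sq v x) + 8 * ((\<phi> x)\<^sup>2 * (norm (\<nu> *\<^sub>R laplacian v x))\<^sup>2))"
      by (rule continuous_integrable_torus) (intro continuous_intros)
  next
    fix x assume "x \<in> space torus"
    then have x: "x \<in> cell" by simp
    have K2: "(\<phi> x)\<^sup>2 \<le> K\<^sup>2" "(partial j \<phi> x)\<^sup>2 \<le> K\<^sup>2" for j
      using K(1)[OF x] K(2)[OF x, of j] power_mono[OF _ abs_ge_zero, of _ _ 2] by fastforce+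
    have d: "(partial j ?g x)\<^sup>2 \<le> 2 * ((\<phi> x)\<^sup>2 * (partial j (curl v) x)\<^sup>2) + 2 * (K\<^sup>2 * (curl v x)\<^sup>2)" for j
    proof -
      have "0 \<le> (\<phi> x * partial j (curl v) x - partial j \<phi> x * curl v x)\<^sup>2" by simp
      then have "(partial j ?g x)\<^sup>2 \<le> 2 * ((\<phi> x)\<^sup>2 * (partial j (curl v) x)\<^sup>2) + 2 * ((partial j \<phi> x)\<^sup>2 * (curl v x)\<^sup>2)"
        unfolding partial_mult[OF \<phi> curl_C1per(1)]
        by (simp add: power2_sum power2_diff power_mult_distrib mult.commute)
      moreover have "(partial j \<phi> x)\<^sup>2 * (curl v x)\<^sup>2 \<le> K\<^sup>2 * (curl v x)\<^sup>2" by (intro mult_right_mono K2) auto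
      ultimately show ?thesis by linarith
    qed
    have "(?g x)\<^sup>2 \<le> K\<^sup>2 * (curl v x)\<^sup>2" 
      unfolding power_mult_distrib by (intro mult_right_mono K2) auto
    then have "2 * (?g x)\<^sup>2 + 4 * ((partial 1 ?g x)\<^sup>2 + (partial 2 ?g x)\<^sup>2)
       \<le> 18 * (K\<^sup>2 * (curl v x)\<^sup>2) + 8 * ((\<phi> x)\<^sup>2 * (norm (laplacian v x))\<^sup>2)"
      using d[of 1] d[of 2] unfolding norm_sq_laplacian distrib_left by linarith
    also have "\<dots> \<le> 18 * (K\<^sup>2 * (2 * grad_norm_sq v x)) + 8 * ((\<phi> x)\<^sup>2 * (norm (laplacian v x))\<^sup>2)"
      by (intro add_mono mult_left_mono curl_sq_le) auto
    finally have "\<nu>\<^sup>2 * (2 * (?g x)\<^sup>2 + 4 * ((partial 1 ?g x)\<^sup>2 + (partial 2 ?g x)\<^sup>2))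
      \<le> \<nu>\<^sup>2 * (18 * (K\<^sup>2 * (2 * grad_norm_sq v x)) + 8 * ((\<phi> x)\<^sup>2 * (norm (laplacian v x))\<^sup>2))"
      by (intro mult_left_mono) auto
    then show "\<nu>\<^sup>2 * (2 * (?g x)\<^sup>2 + 4 * ((partial 1 ?g x)\<^sup>2 + (partial 2 ?g x)\<^sup>2))
      \<le> 36 * K\<^sup>2 * \<nu> * (\<nu> * grad_norm_sq v x) + 8 * ((\<phi> x)\<^sup>2 * (norm (\<nu> *\<^sub>R laplacian v x))\<^sup>2)"
      using \<nu> by (simp add: power_mult_distrib power2_eq_square algebra_simps)
  qed
  also have "\<dots> = 36 * K\<^sup>2 * \<nu> * G + 8 * Z" unfolding G_def Z_def
    by (subst Bochner_Integration.integral_add) (auto intro!: continuous_integrable_torus continuous_intros)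
  finally have "\<delta> * (\<nu>\<^sup>2 * (2 * N + 4 * A)) / 2 \<le> \<delta> * (36 * K\<^sup>2 * \<nu> * G + 8 * Z) / 2"
    using \<delta> by (intro divide_right_mono mult_left_mono) auto
  also have "\<dots> = \<delta> * (18 * K\<^sup>2 * \<nu> * G + 4 * Z)" by (simp add: algebra_simps)
  finally have "\<nu> * N \<le> L\<^sup>2 / (2 * \<delta>) + \<delta> * (18 * K\<^sup>2 * \<nu> * G + 4 * Z)"
    using young by linarith
  then show ?thesis
    unfolding N_def L_def G_def Z_def by (simp add: power_mult_distrib abs_mult)
qed

end

section \<open>Square-integrable fields and weak limits\<close>

lemma L2_torus_continuous:
  fixes g :: "real^2 \<Rightarrow> real^2"
  assumes "continuous_on UNIV g"
  shows "L2_torus g"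
  unfolding L2_torus_def using assms
  by (auto intro!: continuous_intros continuous_integrable_torus continuous_measurable_torus)

lemma integrable_inner_L2:
  assumes f: "L2_torus f" and g: "L2_torus g"
  shows "integrable torus (\<lambda>x. f x \<bullet> g x)"
proof (rule Bochner_Integration.integrable_bound)
  show "integrable torus (\<lambda>x. (norm (f x))\<^sup>2 + (norm (g x))\<^sup>2)"
    using f g by (auto simp: L2_torus_def)
  show "(\<lambda>x. f x \<bullet> g x) \<in> borel_measurable torus"
    using f g unfolding L2_torus_def by auto
  show "AE x in torus. norm (f x \<bullet> g x) \<le> norm ((norm (f x))\<^sup>2 + (norm (g x))\<^sup>2)"
  proof (rule AE_I2)
    fix x
    have "0 \<le> (norm (f x) - norm (g x))\<^sup>2" by simp
    then have "2 * (norm (f x) * norm (g x)) \<le> (norm (f x))\<^sup>2 + (norm (g x))\<^sup>2"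
      by (simp add: power2_diff)
    moreover have "norm (f x \<bullet> g x) \<le> norm (f x) * norm (g x)"
      using Cauchy_Schwarz_ineq2 by auto
    moreover have "0 \<le> norm (f x) * norm (g x)" by simp
    ultimately show "norm (f x \<bullet> g x) \<le> norm ((norm (f x))\<^sup>2 + (norm (g x))\<^sup>2)" by simp
  qed
qed

lemma L2_torus_add:
  assumes f: "L2_torus f" and g: "L2_torus g"
  shows "L2_torus (\<lambda>x. f x + g x)"
proof -
  have "(norm (f x + g x))\<^sup>2 = (norm (f x))\<^sup>2 + 2 * (f x \<bullet> g x) + (norm (g x))\<^sup>2" for x
    unfolding power2_norm_eq_inner by (simp add: algebra_simps inner_commute)
  then show ?thesis using f g integrable_inner_L2[OF f g] unfolding L2_torus_def by auto
qed

lemma L2_torus_scaleR: "L2_torus f \<Longrightarrow> L2_torus (\<lambda>x. c *\<^sub>R f x)"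
  unfolding L2_torus_def by (auto simp: power_mult_distrib)

lemma L2_torus_diff:
  assumes f: "L2_torus f" and g: "L2_torus g"
  shows "L2_torus (\<lambda>x. f x - g x)"
  using L2_torus_add[OF f L2_torus_scaleR[OF g, of "-1"]] by simp

lemma L2_torus_mult_bounded:
  fixes \<phi> :: "real^2 \<Rightarrow> real"
  assumes f: "L2_torus f" and \<phi>: "continuous_on UNIV \<phi>"
  shows "L2_torus (\<lambda>x. \<phi> x *\<^sub>R f x)"
proof -
  obtain B where B: "\<And>x. x \<in> cell \<Longrightarrow> norm (\<phi> x) \<le> B" using bounded_on_cell[OF \<phi>] by metis
  have [measurable]: "f \<in> borel_measurable torus" "\<phi> \<in> borel_measurable torus"
    using f \<phi> by (auto simp: L2_torus_def)
  have "integrable torus (\<lambda>x. (norm (\<phi> x *\<^sub>R f x))\<^sup>2)"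
  proof (rule Bochner_Integration.integrable_bound)
    show "integrable torus (\<lambda>x. B\<^sup>2 * (norm (f x))\<^sup>2)" using f by (simp add: L2_torus_def)
    show "AE x in torus. norm ((norm (\<phi> x *\<^sub>R f x))\<^sup>2) \<le> norm (B\<^sup>2 * (norm (f x))\<^sup>2)"
    proof (rule AE_I2)
      fix x assume "x \<in> space torus"
      then have "\<bar>\<phi> x\<bar>\<^sup>2 \<le> B\<^sup>2" using B by (intro power_mono) auto
      then show "norm ((norm (\<phi> x *\<^sub>R f x))\<^sup>2) \<le> norm (B\<^sup>2 * (norm (f x))\<^sup>2)"
        by (simp add: power_mult_distrib mult_right_mono)
    qed
  qed simp
  then show ?thesis by (simp add: L2_torus_def)
qed

lemma Young_integral:
  assumes f: "L2_torus f" and g: "L2_torus g" and \<delta>: "0 < \<delta>"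
  shows "\<bar>\<integral>x. f x \<bullet> g x \<partial>torus\<bar> \<le> (\<integral>x. (norm (f x))\<^sup>2 \<partial>torus) / (2 * \<delta>) + \<delta> * (\<integral>x. (norm (g x))\<^sup>2 \<partial>torus) / 2"
proof -
  have i: "integrable torus (\<lambda>x. (norm (f x))\<^sup>2)" "integrable torus (\<lambda>x. (norm (g x))\<^sup>2)"
    using f g by (auto simp: L2_torus_def)
  have "\<bar>\<integral>x. f x \<bullet> g x \<partial>torus\<bar> \<le> (\<integral>x. \<bar>f x \<bullet> g x\<bar> \<partial>torus)" by (rule integral_abs_bound)
  also have "\<dots> \<le> (\<integral>x. (norm (f x))\<^sup>2 / (2 * \<delta>) + \<delta> * (norm (g x))\<^sup>2 / 2 \<partial>torus)"
  proof (intro integral_mono)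
    fix x
    have "\<bar>f x \<bullet> g x\<bar> \<le> \<bar>norm (f x) * norm (g x)\<bar>" using Cauchy_Schwarz_ineq2[of "f x" "g x"] by simp
    also have "\<dots> \<le> (norm (f x))\<^sup>2 / (2 * \<delta>) + \<delta> * (norm (g x))\<^sup>2 / 2" by (rule Young[OF \<delta>])
    finally show "\<bar>f x \<bullet> g x\<bar> \<le> (norm (f x))\<^sup>2 / (2 * \<delta>) + \<delta> * (norm (g x))\<^sup>2 / 2" .
  qed (use i integrable_inner_L2[OF f g] in auto)
  also have "\<dots> = (\<integral>x. (norm (f x))\<^sup>2 \<partial>torus) / (2 * \<delta>) + \<delta> * (\<integral>x. (norm (g x))\<^sup>2 \<partial>torus) / 2"
    using i by simp
  finally show ?thesis .
qed

lemma norm_sq_add_L2: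
  assumes f: "L2_torus f" and g: "L2_torus g"
  shows "(\<integral>x. (norm (f x + g x))\<^sup>2 \<partial>torus) = (\<integral>x. (norm (f x))\<^sup>2 \<partial>torus) + 2 * (\<integral>x. f x \<bullet> g x \<partial>torus) + (\<integral>x. (norm (g x))\<^sup>2 \<partial>torus)"
proof -
  have "(norm (f x + g x))\<^sup>2 = (norm (f x))\<^sup>2 + 2 * (f x \<bullet> g x) + (norm (g x))\<^sup>2" for x
    unfolding power2_norm_eq_inner by (simp add: algebra_simps inner_commute)
  then show ?thesis using f g integrable_inner_L2[OF f g] unfolding L2_torus_def by simp
qed

lemma norm_sq_add_le_L2:
  assumes f: "L2_torus f" and g: "L2_torus g"
  shows "(\<integral>x. (norm (f x + g x))\<^sup>2 \<partial>torus) \<le> 2 * (\<integral>x. (norm (f x))\<^sup>2 \<partial>torus) + 2 * (\<integral>x. (norm (g x))\<^sup>2 \<partial>torus)"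
  using Young_integral[OF f g, of 1] norm_sq_add_L2[OF f g] by simp

definition C1vec :: "(real^2 \<Rightarrow> real^2) \<Rightarrow> bool" where
  "C1vec w \<longleftrightarrow> (\<forall>k. C1per (\<lambda>x. w x $ k))"

lemma C1vec_continuous: "C1vec w \<Longrightarrow> continuous_on UNIV w"
  unfolding C1vec_def
  by (intro continuous_on_vec_lambda[of UNIV "\<lambda>k x. w x $ k", simplified] C1perD(2)) auto

lemma C1vec_L2: "C1vec w \<Longrightarrow> L2_torus w"
  by (intro L2_torus_continuous C1vec_continuous)

lemma C1vec_lincomb:
  assumes "C1vec f" "C1vec g"
  shows "C1vec (\<lambda>x. f x + t *\<^sub>R (g x - f x))"
  using assms unfolding C1vec_def by (auto intro!: C1per_add C1per_cmult C1per_diff)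

text \<open>If \<open>d\<close> is the squared \<open>L\<^sup>2\<close>-distance of \<open>w\<^sub>0\<close> to the fields of class \<open>C\<^sup>1\<close> and \<open>c\<close> almost attains it, moving
  from \<open>c\<close> towards the \<open>w \<nu>\<close> by a small step \<open>t\<close> would lower the squared distance by about \<open>2td\<close>.\<close>

lemma weak_limit_approx:
  assumes nt: "\<F> \<noteq> bot" and w: "weak_L2 w w0 \<F>"
    and C1: "\<forall>\<^sub>F \<nu> in \<F>. C1vec (w \<nu>)" and C: "\<forall>\<^sub>F \<nu> in \<F>. (\<integral>x. (norm (w \<nu> x))\<^sup>2 \<partial>torus) \<le> C"
    and e: "0 < (e::real)"
  obtains c where "C1vec c" "(\<integral>x. (norm (w0 x - c x))\<^sup>2 \<partial>torus) < e"
proof -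
  have w0: "L2_torus w0" using w by (simp add: weak_L2_def)
  define q where "q c = (\<integral>x. (norm (w0 x - c x))\<^sup>2 \<partial>torus)" for c
  define d where "d = Inf (q ` Collect C1vec)"
  have bdd: "bdd_below (q ` Collect C1vec)"
    by (rule bdd_belowI[of _ 0]) (auto simp: q_def)
  have zero: "C1vec (\<lambda>x. 0)" by (simp add: C1vec_def C1per_const)
  have dle: "d \<le> q c" if "C1vec c" for c
    unfolding d_def using that bdd by (intro cInf_lower) auto
  have near: "\<exists>c. C1vec c \<and> q c < d + \<epsilon>" if "0 < \<epsilon>" for \<epsilon>
    using cInf_lessD[of "q ` Collect C1vec" "d + \<epsilon>"] that zero unfolding d_def by auto
  \<comment> \<open>Bounds the squared distance from \<open>w \<nu>\<close> to any \<open>c\<close>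
    within 1 of the infimum; the inner bracket is the bound \<open>c2\<close> for such a
    \<open>c\<close>.\<close>
  define R where "R = 2 * C + 2 * (2 * (\<integral>x. (norm (w0 x))\<^sup>2 \<partial>torus) + 2 * (d + 1))"
  have step: "2 * t * d \<le> \<epsilon> + t\<^sup>2 * R" if t: "0 < t" and \<epsilon>: "0 < \<epsilon>" "\<epsilon> \<le> 1" for t \<epsilon>
  proof -
    obtain c where c: "C1vec c" "q c < d + \<epsilon>" using near \<epsilon> by blast
    note cL = C1vec_L2[OF c(1)]
    note w0c = L2_torus_diff[OF w0 cL]
    have c2: "(\<integral>x. (norm (c x))\<^sup>2 \<partial>torus) \<le> 2 * (\<integral>x. (norm (w0 x))\<^sup>2 \<partial>torus) + 2 * (d + 1)"
    proof -
      have "(\<integral>x. (norm (c x))\<^sup>2 \<partial>torus) \<le> 2 * (\<integral>x. (norm (w0 x))\<^sup>2 \<partial>torus) + 2 * q c"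
        using norm_sq_add_le_L2[OF w0 L2_torus_scaleR[OF w0c, of "-1"]] by (simp add: q_def norm_minus_commute)
      then show ?thesis using c(2) \<epsilon> by simp
    qed
    have ev: "\<forall>\<^sub>F \<nu> in \<F>. d \<le> q c - 2 * t * ((\<integral>x. w \<nu> x \<bullet> (w0 x - c x) \<partial>torus) - (\<integral>x. c x \<bullet> (w0 x - c x) \<partial>torus)) + t\<^sup>2 * R"
      using C1 C
    proof eventually_elim
      case (elim \<nu>)
      note wL = C1vec_L2[OF elim(1)]
      note wc = L2_torus_diff[OF wL cL]
      have "d \<le> q (\<lambda>x. c x + t *\<^sub>R (w \<nu> x - c x))" by (intro dle C1vec_lincomb c elim)
      also have "\<dots> = (\<integral>x. (norm ((w0 x - c x) + (- t) *\<^sub>R (w \<nu> x - c x)))\<^sup>2 \<partial>torus)"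
        unfolding q_def by (simp add: algebra_simps)
      also have "\<dots> = q c + 2 * (\<integral>x. (w0 x - c x) \<bullet> ((- t) *\<^sub>R (w \<nu> x - c x)) \<partial>torus)
            + (\<integral>x. (norm ((- t) *\<^sub>R (w \<nu> x - c x)))\<^sup>2 \<partial>torus)"
        unfolding q_def by (rule norm_sq_add_L2[OF w0c L2_torus_scaleR[OF wc]])
      also have "(\<integral>x. (w0 x - c x) \<bullet> ((- t) *\<^sub>R (w \<nu> x - c x)) \<partial>torus)
         = - t * ((\<integral>x. w \<nu> x \<bullet> (w0 x - c x) \<partial>torus) - (\<integral>x. c x \<bullet> (w0 x - c x) \<partial>torus))"
        by (subst Bochner_Integration.integral_diff[symmetric])
           (auto intro!: integrable_inner_L2 wL cL w0c simp: inner_commute simp flip: inner_diff_left)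
      also have "(\<integral>x. (norm ((- t) *\<^sub>R (w \<nu> x - c x)))\<^sup>2 \<partial>torus) = t\<^sup>2 * (\<integral>x. (norm (w \<nu> x - c x))\<^sup>2 \<partial>torus)"
        by (simp add: power_mult_distrib)
      also have "(\<integral>x. (norm (w \<nu> x - c x))\<^sup>2 \<partial>torus) \<le> R"
        using norm_sq_add_le_L2[OF wL L2_torus_scaleR[OF cL, of "-1"]] elim(2) c2 by (simp add: R_def)
      finally show ?case by (simp add: mult_left_mono)
    qed
    have "((\<lambda>\<nu>. \<integral>x. w \<nu> x \<bullet> (w0 x - c x) \<partial>torus) \<longlongrightarrow> (\<integral>x. w0 x \<bullet> (w0 x - c x) \<partial>torus)) \<F>"
      using w w0c by (simp add: weak_L2_def)
    then have "((\<lambda>\<nu>. q c - 2 * t * ((\<integral>x. w \<nu> x \<bullet> (w0 x - c x) \<partial>torus) - (\<integral>x. c x \<bullet> (w0 x - c x) \<partial>torus)) + t\<^sup>2 * R)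
       \<longlongrightarrow> q c - 2 * t * ((\<integral>x. w0 x \<bullet> (w0 x - c x) \<partial>torus) - (\<integral>x. c x \<bullet> (w0 x - c x) \<partial>torus)) + t\<^sup>2 * R) \<F>"
      by (intro tendsto_intros)
    \<comment> \<open>In the limit \<open>w0\<close> replaces \<open>w \<nu>\<close>, so the
      coefficient of the linear term becomes the squared distance itself.\<close>
    moreover have "(\<integral>x. w0 x \<bullet> (w0 x - c x) \<partial>torus) - (\<integral>x. c x \<bullet> (w0 x - c x) \<partial>torus) = q c"
      unfolding q_def power2_norm_eq_inner
      by (subst Bochner_Integration.integral_diff[symmetric])
         (auto intro!: integrable_inner_L2 w0 cL w0c simp flip: inner_diff_left)
    ultimately have "d \<le> q c - 2 * t * q c + t\<^sup>2 * R"
      using tendsto_lowerbound[OF _ ev nt] by simp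
    moreover have "2 * t * d \<le> 2 * t * q c" using t dle[OF c(1)] by simp
    ultimately show ?thesis using c(2) by linarith
  qed
  have "d \<le> 0"
  proof (rule ccontr)
    assume "\<not> d \<le> 0"
    then have d: "0 < d" by simp
    \<comment> \<open>With this step the quadratic term is at most \<open>t * d\<close>, and
      \<open>\<epsilon>\<close> is at most half of that, so \<open>2 * t * d\<close> would be at
      most \<open>3/2 * t * d\<close>.\<close>
    define t where "t = d / (\<bar>R\<bar> + 1)"
    have t: "0 < t" using d by (simp add: t_def)
    define \<epsilon> where "\<epsilon> = min 1 (t * d / 2)"
    have "2 * t * d \<le> \<epsilon> + t\<^sup>2 * R" using step[OF t, of \<epsilon>] t d by (simp add: \<epsilon>_def)
    also have "\<dots> \<le> t * d / 2 + t * (t * (\<bar>R\<bar> + 1))"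
      by (intro add_mono) (auto simp: \<epsilon>_def power2_eq_square mult.assoc t intro!: mult_left_mono less_imp_le[OF t])
    also have "t * (\<bar>R\<bar> + 1) = d" by (simp add: t_def)
    finally show False using t d by (simp add: algebra_simps)
  qed
  then show ?thesis using near[OF e] that unfolding q_def by fastforce
qed

text \<open>Replace \<open>w0\<close> by a nearby C1 field, for which the claim is assumed; the
  remainder is small uniformly because the \<open>H \<nu>\<close> are bounded in L2.\<close>

lemma weak_limit_test:
  assumes nt: "\<F> \<noteq> bot" and w: "weak_L2 w w0 \<F>"
    and C1: "\<forall>\<^sub>F \<nu> in \<F>. C1vec (w \<nu>)" and C: "\<forall>\<^sub>F \<nu> in \<F>. (\<integral>x. (norm (w \<nu> x))\<^sup>2 \<partial>torus) \<le> C"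
    and H: "\<forall>\<^sub>F \<nu> in \<F>. L2_torus (H \<nu>)" and M: "\<forall>\<^sub>F \<nu> in \<F>. (\<integral>x. (norm (H \<nu> x))\<^sup>2 \<partial>torus) \<le> M"
    and test: "\<And>c. C1vec c \<Longrightarrow> ((\<lambda>\<nu>. \<integral>x. c x \<bullet> H \<nu> x \<partial>torus) \<longlongrightarrow> 0) \<F>"
  shows "((\<lambda>\<nu>. \<integral>x. w0 x \<bullet> H \<nu> x \<partial>torus) \<longlongrightarrow> 0) \<F>"
proof (rule tendstoI)
  fix e :: real assume e: "0 < e"
  have w0: "L2_torus w0" using w by (simp add: weak_L2_def)
  \<comment> \<open>Balances Young's inequality: both of its terms become \<open>e / 4\<close> once
    the squared approximation error is below \<open>\<delta> * e / 2\<close>.\<close>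
  define \<delta> where "\<delta> = e / (2 * (\<bar>M\<bar> + 1))"
  have \<delta>: "0 < \<delta>" using e by (simp add: \<delta>_def)
  have "0 < \<delta> * e / 2" using \<delta> e by simp
  then obtain c where c: "C1vec c" "(\<integral>x. (norm (w0 x - c x))\<^sup>2 \<partial>torus) < \<delta> * e / 2"
    using weak_limit_approx[OF nt w C1 C] by metis
  note cL = C1vec_L2[OF c(1)]
  have "\<forall>\<^sub>F \<nu> in \<F>. \<bar>\<integral>x. c x \<bullet> H \<nu> x \<partial>torus\<bar> < e / 4"
    using tendstoD[OF test[OF c(1)], of "e/4"] e by (simp add: dist_real_def)
  then show "\<forall>\<^sub>F \<nu> in \<F>. dist (\<integral>x. w0 x \<bullet> H \<nu> x \<partial>torus) 0 < e"
    using H M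
  proof eventually_elim
    case (elim \<nu>)
    have "(\<integral>x. w0 x \<bullet> H \<nu> x \<partial>torus) = (\<integral>x. c x \<bullet> H \<nu> x \<partial>torus) + (\<integral>x. (w0 x - c x) \<bullet> H \<nu> x \<partial>torus)"
      by (subst Bochner_Integration.integral_add[symmetric])
         (auto intro!: integrable_inner_L2 L2_torus_diff w0 cL elim simp flip: inner_add_left)
    moreover have "\<bar>\<integral>x. (w0 x - c x) \<bullet> H \<nu> x \<partial>torus\<bar> \<le> e / 4 + e / 4"
    proof -
      have "\<bar>\<integral>x. (w0 x - c x) \<bullet> H \<nu> x \<partial>torus\<bar> \<le> (\<integral>x. (norm (w0 x - c x))\<^sup>2 \<partial>torus) / (2 * \<delta>) + \<delta> * (\<integral>x. (norm (H \<nu> x))\<^sup>2 \<partial>torus) / 2"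
        by (intro Young_integral L2_torus_diff w0 cL elim \<delta>)
      also have "\<dots> \<le> (\<delta> * e / 2) / (2 * \<delta>) + \<delta> * (\<bar>M\<bar> + 1) / 2"
        using c(2) \<delta> elim by (intro add_mono divide_right_mono mult_left_mono) auto
      also have "\<delta> * (\<bar>M\<bar> + 1) = e / 2" unfolding \<delta>_def by (simp add: field_simps)
      finally show ?thesis using \<delta> by simp
    qed
    ultimately show ?case using elim(1) e by simp
  qed
qed

section \<open>Test functions and measures on the torus\<close>

text \<open>The torus, embedded as a product of two circles: functions of \<open>circles x\<close> are periodic, and
  \<open>circles\<close> separates the points of the cell.\<close>

definition circles :: "real^2 \<Rightarrow> (real \<times> real) \<times> (real \<times> real)" where
  "circles x = ((cos (2 * pi * x $ 1), sin (2 * pi * x $ 1)), (cos (2 * pi * x $ 2), sin (2 * pi * x $ 2)))"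

lemma continuous_circles [continuous_intros]: "continuous_on A circles"
  unfolding circles_def by (intro continuous_intros)

lemma cos_sin_periodic_axis:
  "cos (2 * pi * (x + axis i 1) $ k) = cos (2 * pi * x $ k)"
  "sin (2 * pi * (x + axis i 1) $ k) = sin (2 * pi * x $ k)"
  by (auto simp: axis_def distrib_left)

text \<open>Equal angles determine each coordinate up to an integer, and two points of a half-open
  unit interval differ by less than 1.\<close>

lemma inj_circles: "inj_on circles cell"
proof (rule inj_onI)
  fix x y assume x: "x \<in> cell" and y: "y \<in> cell" and eq: "circles x = circles y"
  have "x $ k = y $ k" for k
  proof -
    have "k = 1 \<or> k = 2" by (rule exhaust_2)
    then have "sin (2 * pi * x $ k) = sin (2 * pi * y $ k) \<and> cos (2 * pi * x $ k) = cos (2 * pi * y $ k)"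
      using eq by (auto simp: circles_def)
    then obtain n :: int where "2 * pi * x $ k = 2 * pi * y $ k + 2 * pi * n"
      unfolding sin_cos_eq_iff by auto
    then have "2 * pi * x $ k = 2 * pi * (y $ k + n)" by (simp add: distrib_left)
    then have n: "x $ k = y $ k + n" by simp
    have "0 \<le> x $ k" "x $ k < 1" "0 \<le> y $ k" "y $ k < 1"
      using x y by (auto simp: cell_def)
    with n have "-1 < real_of_int n" "real_of_int n < 1" by linarith+
    then have "n = 0" by linarith
    then show ?thesis using n by simp
  qed
  then show "x = y" by (simp add: vec_eq_iff)
qed

lemma C1per_cos: "C1per (\<lambda>x. cos (2 * pi * x $ k))"
  and C1per_sin: "C1per (\<lambda>x. sin (2 * pi * x $ k))"
proof -
  have p: "((\<lambda>t. cos (2 * pi * (x + t *\<^sub>R axis i 1) $ k)) has_real_derivative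
      - sin (2 * pi * x $ k) * (2 * pi * axis i 1 $ k)) (at 0)"
    "((\<lambda>t. sin (2 * pi * (x + t *\<^sub>R axis i 1) $ k)) has_real_derivative
      cos (2 * pi * x $ k) * (2 * pi * axis i 1 $ k)) (at 0)" for x :: "real^2" and i
    by (auto intro!: derivative_eq_intros)
  show "C1per (\<lambda>x. cos (2 * pi * x $ k))"
    by (rule C1perI(1)[OF _ _ p(1)]) (simp_all add: periodic_def cos_sin_periodic_axis continuous_intros
        del: vector_add_component)
  show "C1per (\<lambda>x. sin (2 * pi * x $ k))"
    by (rule C1perI(1)[OF _ _ p(2)]) (simp_all add: periodic_def cos_sin_periodic_axis continuous_intros
        del: vector_add_component)
qed

text \<open>These are the trigonometric polynomials, the reservoir of differentiable periodic test
  functions.\<close>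

lemma C1per_polynomial_circles:
  assumes "real_polynomial_function q"
  shows "C1per (\<lambda>x. q (circles x))"
  using assms
proof induction
  case (linear l)
  interpret bounded_linear l by fact
  have "l ((a, b), (c, d)) = l ((1, 0), 0) * a + l ((0, 1), 0) * b + (l (0, (1, 0)) * c + l (0, (0, 1)) * d)" for a b c d
  proof -
    have "l ((a, b), (c, d)) = l (a *\<^sub>R ((1, 0), 0) + b *\<^sub>R ((0, 1), 0) + (c *\<^sub>R (0, (1, 0)) + d *\<^sub>R (0, (0, 1))))"
      by (simp add: zero_prod_def)
    then show ?thesis by (simp only: add scaleR real_scaleR_def mult.commute)
  qed
  then show ?case unfolding circles_def
    by (simp only:) (intro C1per_add C1per_cmult C1per_cos C1per_sin)
next
  case (const c) show ?case by (rule C1per_const)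
next
  case (add f g) then show ?case by (intro C1per_add)
next
  case (mult f g) then show ?case by (intro C1per_mult)
qed

lemma circles_bounded: "circles x \<in> (cbox (-1) 1 \<times> cbox (-1) 1) \<times> (cbox (-1) 1 \<times> cbox (-1) 1)"
  by (auto simp: circles_def)

text \<open>Tent functions of the distance to the embedded compact sets are normalized to have sum
  at most 1, then approximated by polynomials through Stone-Weierstrass. Disjointness makes the
  normalizing factor tend to 1, so the limits are the indicators.\<close>

lemma test_functions:
  fixes K :: "'i \<Rightarrow> (real^2) set"
  assumes I: "finite I" and K: "\<And>i. i \<in> I \<Longrightarrow> compact (K i)" "\<And>i. i \<in> I \<Longrightarrow> K i \<subseteq> cell"
    and dis: "disjoint_family_on K I"
  obtains \<phi> :: "nat \<Rightarrow> 'i \<Rightarrow> real^2 \<Rightarrow> real" where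
    "\<And>n i. i \<in> I \<Longrightarrow> C1per (\<phi> n i)" "\<And>n i x. i \<in> I \<Longrightarrow> 0 \<le> \<phi> n i x"
    "\<And>n x. (\<Sum>i\<in>I. \<phi> n i x) \<le> 3"
    "\<And>i x. i \<in> I \<Longrightarrow> x \<in> cell \<Longrightarrow> (\<lambda>n. \<phi> n i x) \<longlonglongrightarrow> indicator (K i) x"
proof -
  \<comment> \<open>\<open>infdist z {} = 0\<close>, so empty sets need a separate case\<close>
  define \<psi> where "\<psi> n i z = (if K i = {} then 0 else max 0 (1 - real n * infdist z (circles ` K i)))" for n i z
  define F where "F n i z = \<psi> n i z / max 1 (\<Sum>j\<in>I. \<psi> n j z)" for n i z
  \<comment> \<open>The factor with \<open>card I\<close> keeps the total error, at most
    \<open>2 * \<epsilon> n\<close> per function, below 2; with the normalized sum this makes the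
    bound 3.\<close>
  define \<epsilon> where "\<epsilon> n = 1 / (real (Suc n) * real (Suc (card I)))" for n
  let ?S = "(cbox (-1) 1 \<times> cbox (-1) 1) \<times> (cbox (-1::real) 1 \<times> cbox (-1::real) 1) :: ((real \<times> real) \<times> (real \<times> real)) set"
  have \<epsilon>: "0 < \<epsilon> n" for n by (simp add: \<epsilon>_def)
  have \<epsilon>0: "\<epsilon> \<longlonglongrightarrow> 0"
  proof -
    have "(\<lambda>n. inverse (real (Suc n)) * inverse (real (Suc (card I)))) \<longlonglongrightarrow> 0"
      by (rule tendsto_mult_left_zero[OF LIMSEQ_inverse_real_of_nat])
    then show ?thesis unfolding \<epsilon>_def by (simp add: field_simps)
  qed
  have \<psi>0: "0 \<le> \<psi> n i z" for n i z by (simp add: \<psi>_def)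
  have c\<psi>: "continuous_on A (\<psi> n i)" for A n i
  proof (cases "K i = {}")
    case True then show ?thesis unfolding \<psi>_def by simp
  next
    case False then show ?thesis unfolding \<psi>_def by (simp only: if_False) (intro continuous_intros)
  qed
  have F0: "0 \<le> F n i z" for n i z using \<psi>0 by (simp add: F_def)
  have sF: "(\<Sum>i\<in>I. F n i z) \<le> 1" for n z
    unfolding F_def sum_divide_distrib[symmetric] by (simp add: divide_le_eq)
  have cF: "continuous_on A (F n i)" for A n i
    unfolding F_def by (intro continuous_intros c\<psi>) (smt (verit))
  have "compact ?S" by (intro compact_Times compact_cbox)
  then have "\<exists>q. real_polynomial_function q \<and> (\<forall>z\<in>?S. \<bar>F n i z - q z\<bar> < \<epsilon> n)" for n i
    using Stone_Weierstrass_real_polynomial_function[OF _ cF \<epsilon>] by metis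
  then obtain q where q: "\<And>n i. real_polynomial_function (q n i)" "\<And>n i z. z \<in> ?S \<Longrightarrow> \<bar>F n i z - q n i z\<bar> < \<epsilon> n"
    by metis
  have qF: "\<bar>F n i (circles x) - q n i (circles x)\<bar> < \<epsilon> n" for n i x
    using q(2)[OF circles_bounded] .
  \<comment> \<open>Raising the polynomial by its approximation error restores
    nonnegativity.\<close>
  define \<phi> where "\<phi> n i x = q n i (circles x) + \<epsilon> n" for n i x
  have lim\<psi>: "(\<lambda>n. \<psi> n i (circles x)) \<longlonglongrightarrow> indicator (K i) x" if i: "i \<in> I" and x: "x \<in> cell" for i x
  proof (cases "x \<in> K i")
    case True
    then have "infdist (circles x) (circles ` K i) = 0" by (intro infdist_zero) auto
    then have "\<psi> n i (circles x) = 1" for n using True by (auto simp: \<psi>_def)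
    then show ?thesis using True by simp
  next
    case xK: False
    show ?thesis
    proof (cases "K i = {}")
      case True then show ?thesis by (simp add: \<psi>_def)
    next
      case False
      have "closed (circles ` K i)"
        by (intro compact_imp_closed compact_continuous_image continuous_circles K i)
      moreover have "circles x \<notin> circles ` K i"
        using inj_circles x K(2)[OF i] xK by (auto simp: inj_on_def)
      ultimately have pos: "0 < infdist (circles x) (circles ` K i)"
        using False by (intro infdist_pos_not_in_closed) auto
      obtain N where N: "1 < real N * infdist (circles x) (circles ` K i)"
        using reals_Archimedean3[OF pos] by blast
      have "\<psi> n i (circles x) = 0" if "N \<le> n" for n
      proof -
        have "real N * infdist (circles x) (circles ` K i) \<le> real n * infdist (circles x) (circles ` K i)"
          using that pos by (intro mult_right_mono) auto
        then show ?thesis using N by (simp add: \<psi>_def)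
      qed
      then have "(\<lambda>n. \<psi> n i (circles x)) \<longlonglongrightarrow> 0"
        by (intro tendsto_eventually eventually_sequentiallyI)
      then show ?thesis using xK by simp
    qed
  qed
  have ind: "(\<Sum>j\<in>I. indicator (K j) x :: real) \<le> 1" for x
  proof (cases "\<exists>i\<in>I. x \<in> K i")
    case True
    then obtain i where i: "i \<in> I" "x \<in> K i" by blast
    have "indicator (K j) x = (if j = i then 1 else 0 :: real)" if "j \<in> I" for j
      using dis i that by (auto simp: disjoint_family_on_def indicator_def)
    then have "(\<Sum>j\<in>I. indicator (K j) x :: real) = (\<Sum>j\<in>I. if j = i then 1 else 0)" by (intro sum.cong) auto
    then show ?thesis using I by simp
  next
    case False
    then have "(\<Sum>j\<in>I. indicator (K j) x :: real) = 0" by (intro sum.neutral) auto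
    then show ?thesis by simp
  qed
  have limF: "(\<lambda>n. F n i (circles x)) \<longlonglongrightarrow> indicator (K i) x" if i: "i \<in> I" and x: "x \<in> cell" for i x
  proof -
    have "(\<lambda>n. F n i (circles x)) \<longlonglongrightarrow> indicator (K i) x / max 1 (\<Sum>j\<in>I. indicator (K j) x)"
      unfolding F_def using x by (intro tendsto_intros lim\<psi> i) auto
    then show ?thesis using ind[of x] by (simp add: max_absorb1)
  qed
  show thesis
  proof (rule that[of \<phi>])
    show "C1per (\<phi> n i)" for n i
      unfolding \<phi>_def by (intro C1per_add C1per_const C1per_polynomial_circles q)
    show "0 \<le> \<phi> n i x" for n i x
      using qF[of n i x] F0[of n i "circles x"] by (simp add: \<phi>_def)
    show "(\<Sum>i\<in>I. \<phi> n i x) \<le> 3" for n x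
    proof -
      have "(\<Sum>i\<in>I. \<phi> n i x) \<le> (\<Sum>i\<in>I. F n i (circles x) + 2 * \<epsilon> n)"
        using qF[of n _ x] by (intro sum_mono) (smt (verit) \<phi>_def)
      also have "\<dots> \<le> 1 + card I * (2 * \<epsilon> n)"
        using sF[of n "circles x"] by (simp add: sum.distrib)
      also have "card I * (2 * \<epsilon> n) \<le> 2"
      proof -
        have "real (card I) \<le> real (Suc n) * real (Suc (card I))"
          by (simp add: algebra_simps)
        then show ?thesis unfolding \<epsilon>_def by (simp add: divide_le_eq)
      qed
      finally show ?thesis by simp
    qed
    show "(\<lambda>n. \<phi> n i x) \<longlonglongrightarrow> indicator (K i) x" if i: "i \<in> I" and x: "x \<in> cell" for i x
    proof -
      have "(\<lambda>n. q n i (circles x) - F n i (circles x)) \<longlonglongrightarrow> 0"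
        by (rule tendsto_rabs_zero_cancel, rule tendsto_sandwich[OF _ _ tendsto_const \<epsilon>0])
           (use qF[of _ i x] in \<open>auto intro!: always_eventually less_imp_le simp: abs_minus_commute\<close>)
      from tendsto_add[OF tendsto_add[OF limF[OF i x] this] \<epsilon>0]
      show ?thesis unfolding \<phi>_def by simp
    qed
  qed
qed

section \<open>Finite Borel measures on the cell\<close>

lemma finite_borel_torusD:
  assumes "finite_borel_torus \<mu>"
  shows "finite_measure \<mu>" "sets \<mu> = sets torus" "space \<mu> = cell"
    "sets \<mu> = sets (restrict_space borel cell)"
  using assms sets_eq_imp_space_eq[of \<mu> torus] sets_torus by (auto simp: finite_borel_torus_def)

lemma borel_sets_torus_measure:
  assumes "finite_borel_torus \<mu>"
  shows "A \<in> sets \<mu> \<longleftrightarrow> A \<in> sets borel \<and> A \<subseteq> cell"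
  unfolding finite_borel_torusD(4)[OF assms] by (subst sets_restrict_space_iff) auto

lemma continuous_measurable_torus_measure:
  assumes "finite_borel_torus \<mu>" "continuous_on UNIV g"
  shows "g \<in> borel_measurable \<mu>"
  using continuous_measurable_torus[OF assms(2)] finite_borel_torusD(2)[OF assms(1)]
  by (simp cong: measurable_cong_sets)

text \<open>The measure is pushed forward to the Borel sets of the plane, where finite measures are
  inner regular. The cell is not closed, but compact subsets of \<open>A\<close> stay inside
  it.\<close>

lemma compact_inner_approx:
  assumes \<mu>: "finite_borel_torus \<mu>" and A: "A \<in> sets \<mu>" and e: "0 < (e::real)"
  obtains K where "compact K" "K \<subseteq> A" "K \<in> sets \<mu>" "measure \<mu> A \<le> measure \<mu> K + e"
proof -
  interpret finite_measure \<mu> by (rule finite_borel_torusD[OF \<mu>])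
  note sp = finite_borel_torusD(3)[OF \<mu>] and st = borel_sets_torus_measure[OF \<mu>]
  define N where "N = distr \<mu> borel (\<lambda>x. x)"
  have id: "(\<lambda>x. x) \<in> measurable \<mu> borel"
    by (rule continuous_measurable_torus_measure[OF \<mu>]) simp
  have N: "emeasure N B = emeasure \<mu> B" if "B \<in> sets borel" "B \<subseteq> cell" for B
    unfolding N_def using that by (subst emeasure_distr[OF id]) (auto simp: sp Int_absorb2)
  have A': "A \<in> sets borel" "A \<subseteq> cell" using A st by auto
  have "emeasure N (space N) \<noteq> \<infinity>"
    unfolding N_def using emeasure_finite by (subst emeasure_distr[OF id]) auto
  then have sup: "emeasure N A = (SUP K\<in>{K. K \<subseteq> A \<and> compact K}. emeasure N K)"
    by (intro inner_regular A') (auto simp: N_def)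
  show ?thesis
  \<comment> \<open>The empty set serves if \<open>A\<close> is already small; otherwise the
    difference below is positive and survives the passage to \<open>ennreal\<close>.\<close>
  proof (cases "measure \<mu> A \<le> e")
    case True
    then show ?thesis using that[of "{}"] by simp
  next
    case False
    have "ennreal (measure \<mu> A - e) < emeasure N A"
      unfolding N[OF A'] emeasure_eq_measure using e False by (intro ennreal_lessI) auto
    then obtain K where K: "K \<subseteq> A" "compact K" "ennreal (measure \<mu> A - e) < emeasure N K"
      unfolding sup less_SUP_iff by auto
    have K': "K \<in> sets borel" "K \<subseteq> cell" using K A' by (auto intro: borel_closed compact_imp_closed)
    have "measure \<mu> A - e < measure \<mu> K"
      using K(3) False unfolding N[OF K'] emeasure_eq_measure by (simp add: ennreal_less_iff)
    then show ?thesis using that[of K] K K' st by auto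
  qed
qed

text \<open>Dominated convergence. The squares have the same limit because an indicator is its own
  square; the vorticity estimate tests \<open>D\<close> with squares and \<open>\<Omega>\<close>
  with the functions themselves.\<close>

lemma
  assumes \<mu>: "finite_borel_torus \<mu>" and K: "K \<in> sets \<mu>"
    and c: "\<And>n. C1per (\<phi> n)" and nn: "\<And>n x. 0 \<le> \<phi> n x" and le: "\<And>n x. \<phi> n x \<le> (B::real)"
    and lim: "\<And>x. x \<in> cell \<Longrightarrow> (\<lambda>n. \<phi> n x) \<longlonglongrightarrow> indicator K x"
  shows integral_test_limit: "(\<lambda>n. \<integral>x. \<phi> n x \<partial>\<mu>) \<longlonglongrightarrow> measure \<mu> K"
    and integral_test_sq_limit: "(\<lambda>n. \<integral>x. (\<phi> n x)\<^sup>2 \<partial>\<mu>) \<longlonglongrightarrow> measure \<mu> K"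
proof -
  interpret finite_measure \<mu> by (rule finite_borel_torusD[OF \<mu>])
  note sp = finite_borel_torusD(3)[OF \<mu>]
  have m: "\<phi> n \<in> borel_measurable \<mu>" for n
    by (intro continuous_measurable_torus_measure \<mu> C1perD c)
  have ind: "(\<integral>x. indicator K x \<partial>\<mu>) = measure \<mu> K" using K by simp
  have "(\<lambda>n. \<integral>x. \<phi> n x \<partial>\<mu>) \<longlonglongrightarrow> (\<integral>x. indicator K x \<partial>\<mu>)"
    by (rule integral_dominated_convergence[where w="\<lambda>_. B"])
       (use m K nn le lim sp in \<open>auto intro!: AE_I2\<close>)
  then show "(\<lambda>n. \<integral>x. \<phi> n x \<partial>\<mu>) \<longlonglongrightarrow> measure \<mu> K" unfolding ind .
  have l2: "(\<lambda>n. (\<phi> n x)\<^sup>2) \<longlonglongrightarrow> indicator K x" if "x \<in> cell" for x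
  proof -
    have "(indicator K x)\<^sup>2 = (indicator K x :: real)" by (simp add: indicator_def)
    then show ?thesis using tendsto_power[OF lim[OF that], of 2] by (simp only:)
  qed
  have "(\<lambda>n. \<integral>x. (\<phi> n x)\<^sup>2 \<partial>\<mu>) \<longlonglongrightarrow> (\<integral>x. indicator K x \<partial>\<mu>)"
  proof (rule integral_dominated_convergence[where w="\<lambda>_. B\<^sup>2"])
    show "AE x in \<mu>. norm ((\<phi> n x)\<^sup>2) \<le> B\<^sup>2" for n
      using nn le by (auto intro!: AE_I2 power_mono)
  qed (use m K sp l2 in \<open>auto intro!: AE_I2\<close>)
  then show "(\<lambda>n. \<integral>x. (\<phi> n x)\<^sup>2 \<partial>\<mu>) \<longlonglongrightarrow> measure \<mu> K" unfolding ind .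
qed

section \<open>From test-function inequalities to properties of measures\<close>

text \<open>On a compact subset of a \<open>\<Lambda>\<close>-null set the first term disappears
  after sharpening the tests to the indicator, and \<open>\<delta>\<close> is arbitrary. Inner
  regularity of \<open>D\<close> passes from compact sets to the whole null set.\<close>

lemma absolutely_continuous_by_tests:
  assumes \<Lambda>: "finite_borel_torus \<Lambda>" and D: "finite_borel_torus D"
    and test: "\<And>\<phi> \<delta>. C1per \<phi> \<Longrightarrow> (\<And>x. 0 \<le> \<phi> x) \<Longrightarrow> (\<And>x. \<phi> x \<le> 3) \<Longrightarrow> 0 < \<delta> \<Longrightarrow>
       (\<integral>x. \<phi> x \<partial>D) \<le> (\<integral>x. \<phi> x \<partial>\<Lambda>) / (2 * \<delta>) + \<delta> * R"
  shows "absolutely_continuous \<Lambda> D"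
  unfolding absolutely_continuous_def
proof
  fix A assume A: "A \<in> null_sets \<Lambda>"
  interpret D: finite_measure D by (rule finite_borel_torusD[OF D])
  interpret \<Lambda>: finite_measure \<Lambda> by (rule finite_borel_torusD[OF \<Lambda>])
  have AD: "A \<in> sets D" using A finite_borel_torusD(2)[OF D] finite_borel_torusD(2)[OF \<Lambda>] by auto
  have K0: "measure D K \<le> 0" if K: "compact K" "K \<subseteq> A" "K \<in> sets D" for K
  proof -
    have cell: "K \<subseteq> cell" and Ks: "K \<in> sets \<Lambda>"
      using K(3) borel_sets_torus_measure[OF D] borel_sets_torus_measure[OF \<Lambda>] by auto
    have KL: "measure \<Lambda> K = 0"
      using null_sets_subset[OF A Ks K(2)] by (simp add: measure_def null_setsD1)
    \<comment> \<open>A family with a single member is enough here.\<close>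
    obtain \<phi> where \<phi>: "\<And>n i::unit. C1per (\<phi> n i)" "\<And>n i x. 0 \<le> \<phi> n i x" "\<And>n x. (\<Sum>i\<in>UNIV. \<phi> n i x) \<le> 3"
      "\<And>i x. x \<in> cell \<Longrightarrow> (\<lambda>n. \<phi> n i x) \<longlonglongrightarrow> indicator K x"
      using test_functions[of "UNIV :: unit set" "\<lambda>_. K"] K(1) cell by (auto simp: disjoint_family_on_def)
    have le3: "\<phi> n () x \<le> 3" for n x using \<phi>(3)[of n x] by (simp add: UNIV_unit)
    note * = \<phi>(1)[of _ "()"] \<phi>(2)[of _ "()"] le3 \<phi>(4)[of _ "()"]
    have le: "measure D K \<le> \<delta> * R" if \<delta>: "0 < \<delta>" for \<delta>
    proof -
      have "measure D K \<le> measure \<Lambda> K / (2 * \<delta>) + \<delta> * R"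
      proof (rule LIMSEQ_le)
        show "(\<lambda>n. \<integral>x. \<phi> n () x \<partial>D) \<longlonglongrightarrow> measure D K"
          by (rule integral_test_limit[OF D K(3) *])
        show "(\<lambda>n. (\<integral>x. \<phi> n () x \<partial>\<Lambda>) / (2 * \<delta>) + \<delta> * R) \<longlonglongrightarrow> measure \<Lambda> K / (2 * \<delta>) + \<delta> * R"
          using \<delta> by (intro tendsto_intros integral_test_limit[OF \<Lambda> Ks *]) auto
      qed (use test[OF *(1-3) \<delta>] in auto)
      then show ?thesis using KL by simp
    qed
    show ?thesis
    proof (rule field_le_epsilon)
      fix e :: real assume e: "0 < e"
      have "measure D K \<le> e / (\<bar>R\<bar> + 1) * R" by (rule le) (use e in simp)
      also have "\<dots> \<le> e / (\<bar>R\<bar> + 1) * (\<bar>R\<bar> + 1)" using e by (intro mult_left_mono) auto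
      finally show "measure D K \<le> 0 + e" using e by simp
    qed
  qed
  have "measure D A \<le> 0"
  proof (rule field_le_epsilon)
    fix e :: real assume "0 < e"
    then obtain K where "compact K" "K \<subseteq> A" "K \<in> sets D" "measure D A \<le> measure D K + e"
      using compact_inner_approx[OF D AD] by metis
    then show "measure D A \<le> 0 + e" using K0[of K] by simp
  qed
  then have "measure D A = 0" using measure_nonneg[of D A] by linarith
  then show "A \<in> null_sets D" using AD by (intro null_setsI) (simp_all add: D.emeasure_eq_measure)
qed

lemma atoms_sets:
  assumes \<mu>: "finite_borel_torus \<mu>"
  shows "countable (atoms \<mu>)" "B \<subseteq> atoms \<mu> \<Longrightarrow> B \<in> sets \<mu>" "x \<in> cell \<Longrightarrow> {x} \<in> sets \<mu>"
proof -
  interpret finite_measure \<mu> by (rule finite_borel_torusD[OF \<mu>])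
  show c: "countable (atoms \<mu>)"
    by (rule countable_subset[OF _ countable_support]) (auto simp: atoms_def emeasure_eq_measure)
  show s: "{x} \<in> sets \<mu>" if "x \<in> cell" for x
    using that borel_sets_torus_measure[OF \<mu>] by auto
  show "B \<in> sets \<mu>" if B: "B \<subseteq> atoms \<mu>"
  proof (rule sets.countable)
    show "countable B" using B c by (rule countable_subset)
    show "{x} \<in> sets \<mu>" if "x \<in> B" for x
      using that B finite_borel_torusD(3)[OF \<mu>] by (intro s) (auto simp: atoms_def)
  qed
qed

text \<open>Around every point a ball of small radius meets the non-atomic part in small measure, by
  continuity from above. Compactness leaves finitely many balls, which are then made
  disjoint.\<close>

lemma small_partition:
  assumes \<mu>: "finite_borel_torus \<mu>" and e: "0 < (e::real)"
  obtains n and E :: "nat \<Rightarrow> (real^2) set" where "disjoint_family E" "\<And>i. E i \<in> sets \<mu>"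
    "(\<Union>i<n. E i) = cell - atoms \<mu>" "\<And>i. i < n \<Longrightarrow> measure \<mu> (E i) \<le> e"
proof -
  interpret finite_measure \<mu> by (rule finite_borel_torusD[OF \<mu>])
  note sp = finite_borel_torusD(3)[OF \<mu>] and st = borel_sets_torus_measure[OF \<mu>]
  define N where "N = cell - atoms \<mu>"
  have N: "N \<in> sets \<mu>" "N \<subseteq> cell" unfolding N_def sp[symmetric] using atoms_sets(2)[OF \<mu>] by auto
  have BN: "B \<inter> N \<in> sets \<mu>" if "B \<in> sets borel" for B
    using that N st by auto
  have "\<exists>r>0. measure \<mu> (ball x r \<inter> N) \<le> e" for x
  proof -
    have lim: "(\<lambda>n. measure \<mu> (ball x (1 / Suc n) \<inter> N)) \<longlonglongrightarrow> measure \<mu> (\<Inter>n. ball x (1 / Suc n) \<inter> N)"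
    proof (rule finite_Lim_measure_decseq)
      show "range (\<lambda>n. ball x (1 / Suc n) \<inter> N) \<subseteq> sets \<mu>" using BN by auto
      show "decseq (\<lambda>n. ball x (1 / Suc n) \<inter> N)"
        unfolding decseq_def by (intro allI impI Int_mono subset_ball frac_le order_refl) auto
    qed
    have "(\<Inter>n. ball x (1 / Suc n) \<inter> N) \<subseteq> {x} \<inter> N"
    proof
      fix y assume y: "y \<in> (\<Inter>n. ball x (1 / Suc n) \<inter> N)"
      then have d: "dist x y < inverse (real (Suc n))" for n by (auto simp: inverse_eq_divide)
      have "dist x y \<le> 0"
      proof (rule ccontr)
        assume "\<not> dist x y \<le> 0"
        then obtain n where "inverse (real (Suc n)) < dist x y"
          using reals_Archimedean[of "dist x y"] by auto
        then show False using d[of n] by simp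
      qed
      then show "y \<in> {x} \<inter> N" using y by auto
    qed
    \<comment> \<open>A point of \<open>N\<close> carries no mass; for an atom or a point outside
      the cell the intersection is empty.\<close>
    moreover have "measure \<mu> ({x} \<inter> N) = 0"
    proof (cases "x \<in> N")
      case True
      then have "emeasure \<mu> {x} = 0" by (auto simp: N_def atoms_def sp)
      then show ?thesis using True by (simp add: measure_def)
    qed simp
    moreover have "{x} \<inter> N \<in> sets \<mu>" by (rule BN) simp
    ultimately have "measure \<mu> (\<Inter>n. ball x (1 / Suc n) \<inter> N) = 0"
      using finite_measure_mono[of "\<Inter>n. ball x (1 / Suc n) \<inter> N" "{x} \<inter> N"] measure_nonneg
      by (metis order_antisym)
    with lim have "(\<lambda>n. measure \<mu> (ball x (1 / Suc n) \<inter> N)) \<longlonglongrightarrow> 0" by simp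
    then have "\<forall>\<^sub>F n in sequentially. measure \<mu> (ball x (1 / Suc n) \<inter> N) < e"
      using e by (rule order_tendstoD)
    then obtain n where "measure \<mu> (ball x (1 / Suc n) \<inter> N) < e"
      using eventually_happens'[OF sequentially_bot] by blast
    then show ?thesis by (intro exI[of _ "1 / Suc n"]) auto
  qed
  then obtain r where r: "\<And>x. 0 < r x" "\<And>x. measure \<mu> (ball x (r x) \<inter> N) \<le> e" by metis
  \<comment> \<open>The closed square is covered instead of the cell, which is not compact.\<close>
  have cov: "cbox (vec2 0 0) (vec2 1 1) \<subseteq> (\<Union>x\<in>UNIV. ball x (r x))"
  proof
    fix x show "x \<in> (\<Union>x\<in>UNIV. ball x (r x))" using r(1)[of x] by (intro UN_I[of x]) auto
  qed
  obtain C where C: "finite C" "cbox (vec2 0 0) (vec2 1 1) \<subseteq> (\<Union>x\<in>C. ball x (r x))"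
    using compactE_image[OF compact_cbox _ cov] by auto
  obtain n b where b: "C = b ` {i::nat. i < n}"
    using finite_imp_nat_seg_image_inj_on[OF C(1)] by blast
  define A where "A i = ball (b i) (r (b i)) \<inter> N" for i
  have A: "A i \<in> sets \<mu>" for i unfolding A_def by (intro BN) simp
  show thesis
  proof (rule that[of "disjointed A" n])
    show "disjoint_family (disjointed A)" by (rule disjoint_family_disjointed)
    show "disjointed A i \<in> sets \<mu>" for i
      using sets.range_disjointed_sets[of A \<mu>] A by blast
    have "cell \<subseteq> cbox (vec2 0 0) (vec2 1 1)"
      by (auto simp: mem_box_cart forall_2 cell_def)
    then have "N \<subseteq> (\<Union>x\<in>C. ball x (r x))" using C(2) N(2) by auto
    then have "(\<Union>i<n. A i) = N" unfolding b A_def by fastforce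
    then show "(\<Union>i<n. disjointed A i) = cell - atoms \<mu>"
      using finite_UN_disjointed_eq[of A n] by (simp add: atLeast0LessThan N_def)
    show "measure \<mu> (disjointed A i) \<le> e" if "i < n" for i
    proof -
      have "measure \<mu> (disjointed A i) \<le> measure \<mu> (A i)"
        by (intro finite_measure_mono disjointed_subset A)
      also have "\<dots> \<le> e" unfolding A_def by (rule r(2))
      finally show ?thesis .
    qed
  qed
qed

text \<open>The right side is quadratic in \<open>\<Omega>\<close>: on pieces of measure at most
  \<open>e\<close> the sum of squares is at most \<open>e\<close> times the total mass, however many
  pieces there are. Letting \<open>e\<close> shrink for fixed \<open>\<delta>\<close>, then
  \<open>\<delta>\<close>, leaves nothing.\<close>

lemma concentrated_on_atoms_by_tests:
  assumes \<Omega>: "finite_borel_torus \<Omega>" and D: "finite_borel_torus D"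
    and test: "\<And>(I :: nat set) \<phi> \<delta>. finite I \<Longrightarrow> (\<And>i. i \<in> I \<Longrightarrow> C1per (\<phi> i)) \<Longrightarrow> (\<And>i x. i \<in> I \<Longrightarrow> 0 \<le> \<phi> i x) \<Longrightarrow>
       (\<And>x. (\<Sum>i\<in>I. \<phi> i x) \<le> 3) \<Longrightarrow> 0 < \<delta> \<Longrightarrow>
       (\<Sum>i\<in>I. \<integral>x. (\<phi> i x)\<^sup>2 \<partial>D) \<le> (\<Sum>i\<in>I. (\<integral>x. \<phi> i x \<partial>\<Omega>)\<^sup>2) / (2 * \<delta>) + \<delta> * R"
  shows "measure D (cell - atoms \<Omega>) = 0"
proof -
  interpret D: finite_measure D by (rule finite_borel_torusD[OF D])
  interpret \<Omega>: finite_measure \<Omega> by (rule finite_borel_torusD[OF \<Omega>])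
  have sets: "sets D = sets \<Omega>" using finite_borel_torusD(2)[OF D] finite_borel_torusD(2)[OF \<Omega>] by simp
  have compacts: "(\<Sum>i\<in>I. measure D (K i)) \<le> (\<Sum>i\<in>I. (measure \<Omega> (K i))\<^sup>2) / (2 * \<delta>) + \<delta> * R"
    if I: "finite I" and K: "\<And>i. i \<in> I \<Longrightarrow> compact (K i)" "\<And>i. i \<in> I \<Longrightarrow> K i \<in> sets D"
      and dis: "disjoint_family_on K I" and \<delta>: "0 < \<delta>" for I :: "nat set" and K \<delta>
  proof -
    have Kc: "K i \<subseteq> cell" if "i \<in> I" for i using K(2)[OF that] borel_sets_torus_measure[OF D] by auto
    obtain \<phi> where \<phi>: "\<And>n i. i \<in> I \<Longrightarrow> C1per (\<phi> n i)" "\<And>n i x. i \<in> I \<Longrightarrow> 0 \<le> \<phi> n i x" "\<And>n x. (\<Sum>i\<in>I. \<phi> n i x) \<le> 3"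
      "\<And>i x. i \<in> I \<Longrightarrow> x \<in> cell \<Longrightarrow> (\<lambda>n. \<phi> n i x) \<longlonglongrightarrow> indicator (K i) x"
      using test_functions[OF I K(1) Kc dis] by metis
    have le3: "\<phi> n i x \<le> 3" if "i \<in> I" for n i x
    proof -
      have "\<phi> n i x \<le> (\<Sum>i\<in>I. \<phi> n i x)" using \<phi>(2) I that by (intro member_le_sum) auto
      then show ?thesis using \<phi>(3)[of n x] by linarith
    qed
    show ?thesis
    proof (rule LIMSEQ_le)
      show "(\<lambda>n. \<Sum>i\<in>I. \<integral>x. (\<phi> n i x)\<^sup>2 \<partial>D) \<longlonglongrightarrow> (\<Sum>i\<in>I. measure D (K i))"
        by (intro tendsto_sum integral_test_sq_limit[OF D K(2), where B=3] \<phi> le3)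
      show "(\<lambda>n. (\<Sum>i\<in>I. (\<integral>x. \<phi> n i x \<partial>\<Omega>)\<^sup>2) / (2 * \<delta>) + \<delta> * R) \<longlonglongrightarrow> (\<Sum>i\<in>I. (measure \<Omega> (K i))\<^sup>2) / (2 * \<delta>) + \<delta> * R"
        using \<delta> K(2) sets by (intro tendsto_intros integral_test_limit[OF \<Omega>, where B=3] \<phi> le3) auto
    qed (use test[OF I \<phi>(1,2,3) \<delta>] in auto)
  qed
  let ?N = "cell - atoms \<Omega>"
  have main: "measure D ?N \<le> e * measure \<Omega> cell / (2 * \<delta>) + \<delta> * R + \<eta>"
    if e: "0 < e" and \<delta>: "0 < \<delta>" and \<eta>: "0 < \<eta>" for e \<delta> \<eta> :: real
  proof -
    obtain n and E :: "nat \<Rightarrow> (real^2) set" where E: "disjoint_family E" "\<And>i. E i \<in> sets \<Omega>"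
      "(\<Union>i<n. E i) = ?N" "\<And>i. i < n \<Longrightarrow> measure \<Omega> (E i) \<le> e"
      using small_partition[OF \<Omega> e] by metis
    \<comment> \<open>With \<open>n\<close> pieces the total loss in \<open>D\<close> stays below
      \<open>\<eta>\<close>.\<close>
    have "\<exists>K. compact K \<and> K \<subseteq> E i \<and> K \<in> sets D \<and> measure D (E i) \<le> measure D K + \<eta> / real (Suc n)" for i
      using compact_inner_approx[OF D, of "E i" "\<eta> / real (Suc n)"] E(2) sets \<eta> by (metis divide_pos_pos of_nat_0_less_iff zero_less_Suc)
    then obtain K where K: "\<And>i. compact (K i)" "\<And>i. K i \<subseteq> E i" "\<And>i. K i \<in> sets D"
      "\<And>i. measure D (E i) \<le> measure D (K i) + \<eta> / real (Suc n)" by metis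
    have disE: "disjoint_family_on E {..<n}" using E(1) by (rule disjoint_family_on_mono[rotated]) simp
    have disK: "disjoint_family_on K {..<n}"
      using disE K(2) unfolding disjoint_family_on_def by blast
    have "measure D ?N = (\<Sum>i<n. measure D (E i))"
      unfolding E(3)[symmetric] using E(2) sets by (intro D.finite_measure_finite_Union disE) auto
    also have "\<dots> \<le> (\<Sum>i<n. measure D (K i) + \<eta> / real (Suc n))" by (intro sum_mono K)
    also have "\<dots> = (\<Sum>i<n. measure D (K i)) + real n * (\<eta> / real (Suc n))" by (simp add: sum.distrib)
    also have "\<dots> \<le> ((\<Sum>i<n. (measure \<Omega> (K i))\<^sup>2) / (2 * \<delta>) + \<delta> * R) + \<eta>"
      using \<eta> by (intro add_mono compacts K disK \<delta>) (auto simp: field_simps)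
    also have "(\<Sum>i<n. (measure \<Omega> (K i))\<^sup>2) \<le> (\<Sum>i<n. e * measure \<Omega> (E i))"
    proof (rule sum_mono)
      fix i assume i: "i \<in> {..<n}"
      have "measure \<Omega> (K i) \<le> measure \<Omega> (E i)" by (intro \<Omega>.finite_measure_mono K E)
      moreover have "measure \<Omega> (E i) \<le> e" using E(4) i by simp
      ultimately show "(measure \<Omega> (K i))\<^sup>2 \<le> e * measure \<Omega> (E i)"
        unfolding power2_eq_square using e by (intro mult_mono) auto
    qed
    also have "(\<Sum>i<n. e * measure \<Omega> (E i)) = e * measure \<Omega> ?N"
    proof -
      have "measure \<Omega> (\<Union>i<n. E i) = (\<Sum>i<n. measure \<Omega> (E i))"
        using E(2) by (intro \<Omega>.finite_measure_finite_Union disE) auto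
      then show ?thesis unfolding E(3) by (simp add: sum_distrib_left)
    qed
    also have "\<dots> \<le> e * measure \<Omega> cell"
    proof -
      have "cell \<in> sets \<Omega>" using sets.top[of \<Omega>] finite_borel_torusD(3)[OF \<Omega>] by simp
      then show ?thesis using e by (intro mult_left_mono \<Omega>.finite_measure_mono) auto
    qed
    finally show ?thesis using \<delta> by (simp add: divide_right_mono)
  qed
  have "measure D ?N \<le> 0"
  proof (rule field_le_epsilon)
    fix \<eta> :: real assume \<eta>: "0 < \<eta>"
    \<comment> \<open>The order matters: \<open>\<delta>\<close> first makes
      \<open>\<delta> * R\<close> at most a third of \<open>\<eta>\<close>, then \<open>e\<close>,
      depending on \<open>\<delta>\<close>, does the same for the quadratic term.\<close>
    define \<delta> where "\<delta> = \<eta> / (3 * (\<bar>R\<bar> + 1))"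
    define m e where "m = measure \<Omega> cell + 1" and "e = 2 * \<delta> * \<eta> / (3 * m)"
    have \<delta>: "0 < \<delta>" using \<eta> by (simp add: \<delta>_def)
    have m: "0 < m" "measure \<Omega> cell \<le> m"
      using measure_nonneg[of \<Omega> cell] unfolding m_def by linarith+
    have e: "0 < e" unfolding e_def using \<delta> \<eta> m by simp
    have "e * measure \<Omega> cell \<le> e * m" using e m by (intro mult_left_mono) auto
    also have "\<dots> = 2 * \<delta> * \<eta> / 3" using m by (simp add: e_def)
    finally have "e * measure \<Omega> cell / (2 * \<delta>) \<le> (2 * \<delta> * \<eta> / 3) / (2 * \<delta>)"
      using \<delta> by (intro divide_right_mono) auto
    also have "\<dots> = \<eta> / 3" using \<delta> by simp
    finally have 1: "e * measure \<Omega> cell / (2 * \<delta>) \<le> \<eta> / 3" .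
    have "\<delta> * R \<le> \<delta> * (\<bar>R\<bar> + 1)" using \<delta> by (intro mult_left_mono) auto
    also have "\<dots> = \<eta> / 3" unfolding \<delta>_def by (simp add: field_simps)
    finally have 2: "\<delta> * R \<le> \<eta> / 3" .
    show "measure D ?N \<le> 0 + \<eta>" using main[OF e \<delta>, of "\<eta> / 3"] 1 2 \<eta> by simp
  qed
  then show ?thesis using measure_nonneg[of D ?N] by linarith
qed

section \<open>The vanishing viscosity limit\<close>

locale vanishing_viscosity =
  fixes S :: "real set"
    and u f :: "real \<Rightarrow> real^2 \<Rightarrow> real^2"
    and u0 f0 :: "real^2 \<Rightarrow> real^2"
    and \<Lambda> F D :: "(real^2) measure"
  assumes S_pos: "S \<subseteq> {0<..}" and S_acc: "0 islimpt S"
    and smooth_u: "\<And>\<nu>. \<nu> \<in> S \<Longrightarrow> smooth_torus (u \<nu>)"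
    and smooth_f: "\<And>\<nu>. \<nu> \<in> S \<Longrightarrow> smooth_torus (f \<nu>)"
    and NS: "\<And>\<nu>. \<nu> \<in> S \<Longrightarrow> \<exists>p. smooth_torus p \<and> stationary_NS \<nu> (u \<nu>) p (f \<nu>)"
    and weak_u: "weak_L2 u u0 (at 0 within S)"
    and weak_f: "weak_L2 f f0 (at 0 within S)"
    and star_\<Lambda>: "weak_star (\<lambda>\<nu> x. (norm (u \<nu> x - u0 x))\<^sup>2) \<Lambda> (at 0 within S)"
    and star_F: "weak_star (\<lambda>\<nu> x. (norm (f \<nu> x - f0 x))\<^sup>2) F (at 0 within S)"
    and star_D: "weak_star (\<lambda>\<nu> x. \<nu> * grad_norm_sq (u \<nu>) x) D (at 0 within S)"
begin

abbreviation "\<F> \<equiv> at 0 within S"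

definition H :: "real \<Rightarrow> real^2 \<Rightarrow> real^2" where
  "H \<nu> x = \<nu> *\<^sub>R laplacian (u \<nu>) x"

lemma nontrivial: "\<F> \<noteq> bot"
  using S_acc trivial_limit_within by blast

lemma eventually_S: "\<forall>\<^sub>F \<nu> in \<F>. \<nu> \<in> S"
  by (simp add: eventually_at_filter)

lemma eventually_SI: "(\<And>\<nu>. \<nu> \<in> S \<Longrightarrow> P \<nu>) \<Longrightarrow> \<forall>\<^sub>F \<nu> in \<F>. P \<nu>"
  using eventually_mono[OF eventually_S] by blast

lemma pos: "\<nu> \<in> S \<Longrightarrow> 0 < \<nu>"
  using S_pos by auto

lemma solenoidal_u: "\<nu> \<in> S \<Longrightarrow> solenoidal (u \<nu>)"
  using NS smooth_u by unfold_locales (auto simp: stationary_NS_def)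

lemma C1vec_smooth: "smooth_torus v \<Longrightarrow> C1vec v"
  unfolding C1vec_def by (intro allI smooth_C1per smooth_component)

lemma L2:
  "\<nu> \<in> S \<Longrightarrow> L2_torus (u \<nu>)" "\<nu> \<in> S \<Longrightarrow> L2_torus (f \<nu>)" "\<nu> \<in> S \<Longrightarrow> L2_torus (H \<nu>)"
  "L2_torus u0" "L2_torus f0"
proof -
  show "\<nu> \<in> S \<Longrightarrow> L2_torus (u \<nu>)" "\<nu> \<in> S \<Longrightarrow> L2_torus (f \<nu>)"
    by (intro C1vec_L2 C1vec_smooth smooth_u smooth_f; assumption)+
  show "\<nu> \<in> S \<Longrightarrow> L2_torus (H \<nu>)"
    unfolding H_def[abs_def]
    by (intro L2_torus_scaleR L2_torus_continuous solenoidal.continuous_laplacian solenoidal_u)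
  show "L2_torus u0" "L2_torus f0" using weak_u weak_f by (auto simp: weak_L2_def)
qed

lemma norm_sq_H: "\<nu> \<in> S \<Longrightarrow> (\<integral>x. (norm (H \<nu> x))\<^sup>2 \<partial>torus) = - (\<integral>x. f \<nu> x \<bullet> H \<nu> x \<partial>torus)"
  using NS solenoidal.enstrophy_balance[OF solenoidal_u] C1vec_continuous[OF C1vec_smooth[OF smooth_f]]
  unfolding H_def by blast

lemma finite_measures: "finite_borel_torus \<Lambda>" "finite_borel_torus F" "finite_borel_torus D"
  using star_\<Lambda> star_F star_D by (auto simp: weak_star_def)

lemma weak_starD:
  assumes "weak_star h \<mu> \<G>" "C1per \<phi>"
  shows "((\<lambda>\<nu>. \<integral>x. \<phi> x * h \<nu> x \<partial>torus) \<longlongrightarrow> (\<integral>x. \<phi> x \<partial>\<mu>)) \<G>"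
  using assms C1perD[OF assms(2)] by (auto simp: weak_star_def)

text \<open>The constant 1 is periodic and continuous, so no mass is lost in the limit.\<close>

lemma weak_star_total:
  assumes "weak_star h \<mu> \<G>"
  shows "((\<lambda>\<nu>. \<integral>x. h \<nu> x \<partial>torus) \<longlongrightarrow> measure \<mu> cell) \<G>"
  using weak_starD[OF assms C1per_const(1), of 1] finite_borel_torusD(3)[of \<mu>] assms
  by (simp add: weak_star_def)

text \<open>The total mass of the defect measure yields the uniform L2 bound; the added 1 turns the
  limit into an eventual inequality.\<close>

lemma norm_sq_bounded:
  assumes "weak_star (\<lambda>\<nu> x. (norm (w \<nu> x - w0 x))\<^sup>2) \<mu> \<F>"
    and "\<And>\<nu>. \<nu> \<in> S \<Longrightarrow> L2_torus (w \<nu>)" and w0: "L2_torus w0"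
  shows "\<forall>\<^sub>F \<nu> in \<F>. (\<integral>x. (norm (w \<nu> x))\<^sup>2 \<partial>torus) \<le> 2 * (measure \<mu> cell + 1) + 2 * (\<integral>x. (norm (w0 x))\<^sup>2 \<partial>torus)"
proof -
  have "\<forall>\<^sub>F \<nu> in \<F>. (\<integral>x. (norm (w \<nu> x - w0 x))\<^sup>2 \<partial>torus) < measure \<mu> cell + 1"
    by (rule order_tendstoD[OF weak_star_total[OF assms(1)]]) simp
  then show ?thesis using eventually_S
  proof eventually_elim
    case (elim \<nu>)
    show ?case
      using norm_sq_add_le_L2[OF L2_torus_diff[OF assms(2)[OF elim(2)] w0] w0] elim(1) by simp
  qed
qed

definition "Cu = 2 * (measure \<Lambda> cell + 1) + 2 * (\<integral>x. (norm (u0 x))\<^sup>2 \<partial>torus)"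
definition "Cf = 2 * (measure F cell + 1) + 2 * (\<integral>x. (norm (f0 x))\<^sup>2 \<partial>torus)"
definition "CD = measure D cell + 1"

lemma bound_u: "\<forall>\<^sub>F \<nu> in \<F>. (\<integral>x. (norm (u \<nu> x))\<^sup>2 \<partial>torus) \<le> Cu"
  unfolding Cu_def by (rule norm_sq_bounded[OF star_\<Lambda> L2(1) L2(4)])

lemma bound_f: "\<forall>\<^sub>F \<nu> in \<F>. (\<integral>x. (norm (f \<nu> x))\<^sup>2 \<partial>torus) \<le> Cf"
  unfolding Cf_def by (rule norm_sq_bounded[OF star_F L2(2) L2(5)])

lemma bound_D: "\<forall>\<^sub>F \<nu> in \<F>. (\<integral>x. \<nu> * grad_norm_sq (u \<nu>) x \<partial>torus) \<le> CD"
proof -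
  have "\<forall>\<^sub>F \<nu> in \<F>. (\<integral>x. \<nu> * grad_norm_sq (u \<nu>) x \<partial>torus) < CD"
    by (rule order_tendstoD[OF weak_star_total[OF star_D]]) (simp add: CD_def)
  then show ?thesis by (rule eventually_mono) simp
qed

text \<open>Young's inequality with parameter 1 in \<open>norm_sq_H\<close> absorbs half of the left
  side, so \<open>H\<close> inherits the bound of the force.\<close>

lemma bound_H: "\<forall>\<^sub>F \<nu> in \<F>. (\<integral>x. (norm (H \<nu> x))\<^sup>2 \<partial>torus) \<le> Cf"
  using bound_f eventually_S
proof eventually_elim
  case (elim \<nu>)
  have "\<bar>\<integral>x. f \<nu> x \<bullet> H \<nu> x \<partial>torus\<bar> \<le> (\<integral>x. (norm (f \<nu> x))\<^sup>2 \<partial>torus) / (2 * 1) + 1 * (\<integral>x. (norm (H \<nu> x))\<^sup>2 \<partial>torus) / 2"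
    by (intro Young_integral L2 elim) simp
  then show ?case using elim(1) norm_sq_H[OF elim(2)] by simp
qed

lemma sqrt_tendsto_0: "((\<lambda>\<nu>. c * sqrt \<nu> * d) \<longlongrightarrow> 0) \<F>"
proof -
  have "((\<lambda>\<nu>. c * sqrt \<nu> * d) \<longlongrightarrow> c * sqrt 0 * d) \<F>"
    by (intro tendsto_intros)
  then show ?thesis by simp
qed

lemma C1_bounds:
  assumes "C1per \<phi>"
  obtains K where "\<And>x. x \<in> cell \<Longrightarrow> \<bar>\<phi> x\<bar> \<le> K" "\<And>j x. x \<in> cell \<Longrightarrow> \<bar>partial j \<phi> x\<bar> \<le> K"
proof -
  obtain B0 B1 B2 where B: "\<And>x. x \<in> cell \<Longrightarrow> norm (\<phi> x) \<le> B0"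
    "\<And>x. x \<in> cell \<Longrightarrow> norm (partial 1 \<phi> x) \<le> B1" "\<And>x. x \<in> cell \<Longrightarrow> norm (partial 2 \<phi> x) \<le> B2"
    using bounded_on_cell C1perD(2,3)[OF assms] by metis
  show thesis
  proof (rule that[of "max B0 (max B1 B2)"])
    show "\<bar>partial j \<phi> x\<bar> \<le> max B0 (max B1 B2)" if "x \<in> cell" for j x
      using B(2,3)[OF that] exhaust_2[of j] by auto
    show "\<bar>\<phi> x\<bar> \<le> max B0 (max B1 B2)" if "x \<in> cell" for x
      using B(1)[OF that] by auto
  qed
qed

lemma test_H:
  assumes c: "C1vec c"
  shows "((\<lambda>\<nu>. \<integral>x. c x \<bullet> H \<nu> x \<partial>torus) \<longlongrightarrow> 0) \<F>"
proof -
  have c1: "C1per (\<lambda>x. c x $ k)" for k using c by (simp add: C1vec_def)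
  obtain K1 where K1: "\<And>j x. x \<in> cell \<Longrightarrow> \<bar>partial j (\<lambda>x. c x $ 1) x\<bar> \<le> K1"
    using C1_bounds[OF c1] by metis
  obtain K2 where K2: "\<And>j x. x \<in> cell \<Longrightarrow> \<bar>partial j (\<lambda>x. c x $ 2) x\<bar> \<le> K2"
    using C1_bounds[OF c1] by metis
  define K where "K = max 0 (max K1 K2)"
  have K: "\<bar>partial j (\<lambda>x. c x $ k) x\<bar> \<le> K" if "x \<in> cell" for j k x
    using K1[OF that, of j] K2[OF that, of j] exhaust_2[of k] by (auto simp: K_def)
  have "\<forall>\<^sub>F \<nu> in \<F>. norm (\<integral>x. c x \<bullet> H \<nu> x \<partial>torus) \<le> K * sqrt \<nu> * (2 * measure torus cell + CD)"
    using eventually_S bound_D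
  proof eventually_elim
    case (elim \<nu>)
    interpret solenoidal "u \<nu>" by (rule solenoidal_u[OF elim(1)])
    have "norm (\<integral>x. c x \<bullet> H \<nu> x \<partial>torus) \<le> K * sqrt \<nu> * (2 * measure torus cell + (\<integral>x. \<nu> * grad_norm_sq (u \<nu>) x \<partial>torus))"
      unfolding H_def real_norm_def by (rule integral_test_laplacian_bound[OF c1 pos[OF elim(1)] K])
    also have "\<dots> \<le> K * sqrt \<nu> * (2 * measure torus cell + CD)"
      using elim(2) pos[OF elim(1)] by (intro mult_left_mono) (auto simp: K_def)
    finally show ?case .
  qed
  then show ?thesis by (rule Lim_null_comparison[OF _ sqrt_tendsto_0])
qed

lemma weak_limit_test_H:
  assumes "weak_L2 w w0 \<F>" "\<And>\<nu>. \<nu> \<in> S \<Longrightarrow> C1vec (w \<nu>)"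
    "\<forall>\<^sub>F \<nu> in \<F>. (\<integral>x. (norm (w \<nu> x))\<^sup>2 \<partial>torus) \<le> C"
  shows "((\<lambda>\<nu>. \<integral>x. w0 x \<bullet> H \<nu> x \<partial>torus) \<longlongrightarrow> 0) \<F>"
  by (rule weak_limit_test[OF nontrivial assms(1) eventually_SI[OF assms(2)] assms(3)
        eventually_SI[OF L2(3)] bound_H test_H])

lemma test_f0_H: "((\<lambda>\<nu>. \<integral>x. f0 x \<bullet> H \<nu> x \<partial>torus) \<longlongrightarrow> 0) \<F>"
  by (rule weak_limit_test_H[OF weak_f C1vec_smooth[OF smooth_f] bound_f])

text \<open>The localized field is itself the weak limit of the C1 fields
  \<open>\<phi> x *\<^sub>R u \<nu> x\<close>, so the approximation argument applies to it
  directly.\<close>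

lemma test_u0_H:
  assumes \<phi>: "C1per \<phi>"
  shows "((\<lambda>\<nu>. \<integral>x. (\<phi> x *\<^sub>R u0 x) \<bullet> H \<nu> x \<partial>torus) \<longlongrightarrow> 0) \<F>"
proof -
  obtain K where K: "\<And>x. x \<in> cell \<Longrightarrow> \<bar>\<phi> x\<bar> \<le> K" using C1_bounds[OF \<phi>] by metis
  note c\<phi> = C1perD(2)[OF \<phi>]
  show ?thesis
  proof (rule weak_limit_test_H)
    show "weak_L2 (\<lambda>\<nu> x. \<phi> x *\<^sub>R u \<nu> x) (\<lambda>x. \<phi> x *\<^sub>R u0 x) \<F>"
      unfolding weak_L2_def
    proof (intro conjI allI impI L2_torus_mult_bounded L2 c\<phi>)
      fix \<psi> :: "real^2 \<Rightarrow> real^2" assume "L2_torus \<psi>"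
      then have "L2_torus (\<lambda>x. \<phi> x *\<^sub>R \<psi> x)" by (intro L2_torus_mult_bounded c\<phi>)
      then show "((\<lambda>\<nu>. \<integral>x. (\<phi> x *\<^sub>R u \<nu> x) \<bullet> \<psi> x \<partial>torus) \<longlongrightarrow> (\<integral>x. (\<phi> x *\<^sub>R u0 x) \<bullet> \<psi> x \<partial>torus)) \<F>"
        using weak_u by (auto simp: weak_L2_def)
    qed
    show "C1vec (\<lambda>x. \<phi> x *\<^sub>R u \<nu> x)" if "\<nu> \<in> S" for \<nu>
      using C1vec_smooth[OF smooth_u[OF that]] unfolding C1vec_def by (auto intro!: C1per_mult \<phi>)
    show "\<forall>\<^sub>F \<nu> in \<F>. (\<integral>x. (norm (\<phi> x *\<^sub>R u \<nu> x))\<^sup>2 \<partial>torus) \<le> K\<^sup>2 * Cu"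
      using eventually_S bound_u
    proof eventually_elim
      case (elim \<nu>)
      have "(\<integral>x. (norm (\<phi> x *\<^sub>R u \<nu> x))\<^sup>2 \<partial>torus) \<le> (\<integral>x. K\<^sup>2 * (norm (u \<nu> x))\<^sup>2 \<partial>torus)"
      proof (rule integral_mono)
        show "integrable torus (\<lambda>x. (norm (\<phi> x *\<^sub>R u \<nu> x))\<^sup>2)" "integrable torus (\<lambda>x. K\<^sup>2 * (norm (u \<nu> x))\<^sup>2)"
          using L2_torus_mult_bounded[OF L2(1)[OF elim(1)] c\<phi>] L2(1)[OF elim(1)] by (auto simp: L2_torus_def)
        fix x assume "x \<in> space torus"
        then have "\<bar>\<phi> x\<bar>\<^sup>2 \<le> K\<^sup>2" using K by (intro power_mono) auto
        then show "(norm (\<phi> x *\<^sub>R u \<nu> x))\<^sup>2 \<le> K\<^sup>2 * (norm (u \<nu> x))\<^sup>2"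
          by (simp add: power_mult_distrib mult_right_mono)
      qed
      also have "\<dots> = K\<^sup>2 * (\<integral>x. (norm (u \<nu> x))\<^sup>2 \<partial>torus)" by simp
      also have "\<dots> \<le> K\<^sup>2 * Cu" using elim(2) by (intro mult_left_mono) auto
      finally show ?case .
    qed
  qed
qed

text \<open>Common to both localized identities: the derivative falls on \<open>\<phi>\<close> and a
  factor \<open>sqrt \<nu>\<close> remains in front of bounded quantities.\<close>

lemma error_term_tendsto_0:
  assumes \<phi>: "C1per \<phi>"
    and b: "\<And>\<nu> K. \<nu> \<in> S \<Longrightarrow> (\<And>j x. x \<in> cell \<Longrightarrow> \<bar>partial j \<phi> x\<bar> \<le> K) \<Longrightarrow>
      \<bar>r \<nu>\<bar> \<le> K * sqrt \<nu> * ((\<integral>x. (norm (u \<nu> x))\<^sup>2 \<partial>torus) + (\<integral>x. \<nu> * grad_norm_sq (u \<nu>) x \<partial>torus))"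
  shows "(r \<longlongrightarrow> 0) \<F>"
proof -
  obtain K0 where K0: "\<And>j x. x \<in> cell \<Longrightarrow> \<bar>partial j \<phi> x\<bar> \<le> K0" using C1_bounds[OF \<phi>] by metis
  define K where "K = max 0 K0"
  have K: "\<bar>partial j \<phi> x\<bar> \<le> K" if "x \<in> cell" for j x using K0[OF that, of j] by (simp add: K_def)
  have "\<forall>\<^sub>F \<nu> in \<F>. norm (r \<nu>) \<le> K * sqrt \<nu> * (Cu + CD)"
    using eventually_S bound_u bound_D
  proof eventually_elim
    case (elim \<nu>)
    have "norm (r \<nu>) \<le> K * sqrt \<nu> * ((\<integral>x. (norm (u \<nu> x))\<^sup>2 \<partial>torus) + (\<integral>x. \<nu> * grad_norm_sq (u \<nu>) x \<partial>torus))"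
      unfolding real_norm_def by (rule b[OF elim(1) K])
    also have "\<dots> \<le> K * sqrt \<nu> * (Cu + CD)"
      using elim pos[OF elim(1)] by (intro mult_left_mono add_mono) (auto simp: K_def)
    finally show ?case .
  qed
  then show ?thesis by (rule Lim_null_comparison[OF _ sqrt_tendsto_0])
qed

text \<open>The localized energy identity expresses the dissipation through \<open>u \<nu>\<close>
  and \<open>H\<close>. Subtracting \<open>u0\<close> costs nothing by \<open>test_u0_H\<close>, and
  it brings in the field whose squared length converges to \<open>\<Lambda>\<close>.\<close>

lemma dissipation_limit:
  assumes \<phi>: "C1per \<phi>"
  shows "((\<lambda>\<nu>. \<integral>x. (\<phi> x *\<^sub>R (u \<nu> x - u0 x)) \<bullet> H \<nu> x \<partial>torus) \<longlongrightarrow> - (\<integral>x. \<phi> x \<partial>D)) \<F>"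
proof -
  note c\<phi> = C1perD(2)[OF \<phi>]
  have "((\<lambda>\<nu>. (\<integral>x. \<phi> x * (\<nu> * grad_norm_sq (u \<nu>) x) \<partial>torus) + (\<integral>x. \<phi> x * (u \<nu> x \<bullet> H \<nu> x) \<partial>torus)) \<longlongrightarrow> 0) \<F>"
    unfolding H_def
    by (rule error_term_tendsto_0[OF \<phi>])
       (rule solenoidal.grad_energy_bound[OF solenoidal_u \<phi> pos])
  from tendsto_diff[OF tendsto_diff[OF this weak_starD[OF star_D \<phi>]] test_u0_H[OF \<phi>]]
  have lim: "((\<lambda>\<nu>. (\<integral>x. \<phi> x * (\<nu> * grad_norm_sq (u \<nu>) x) \<partial>torus) + (\<integral>x. \<phi> x * (u \<nu> x \<bullet> H \<nu> x) \<partial>torus)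
      - (\<integral>x. \<phi> x * (\<nu> * grad_norm_sq (u \<nu>) x) \<partial>torus) - (\<integral>x. (\<phi> x *\<^sub>R u0 x) \<bullet> H \<nu> x \<partial>torus))
       \<longlongrightarrow> - (\<integral>x. \<phi> x \<partial>D)) \<F>" by simp
  show ?thesis
  proof (rule Lim_transform_eventually[OF lim])
    show "\<forall>\<^sub>F \<nu> in \<F>. (\<integral>x. \<phi> x * (\<nu> * grad_norm_sq (u \<nu>) x) \<partial>torus) + (\<integral>x. \<phi> x * (u \<nu> x \<bullet> H \<nu> x) \<partial>torus)
      - (\<integral>x. \<phi> x * (\<nu> * grad_norm_sq (u \<nu>) x) \<partial>torus) - (\<integral>x. (\<phi> x *\<^sub>R u0 x) \<bullet> H \<nu> x \<partial>torus)
      = (\<integral>x. (\<phi> x *\<^sub>R (u \<nu> x - u0 x)) \<bullet> H \<nu> x \<partial>torus)"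
    proof (rule eventually_SI)
      fix \<nu> assume \<nu>: "\<nu> \<in> S"
      have "(\<integral>x. (\<phi> x *\<^sub>R u \<nu> x) \<bullet> H \<nu> x \<partial>torus) - (\<integral>x. (\<phi> x *\<^sub>R u0 x) \<bullet> H \<nu> x \<partial>torus)
         = (\<integral>x. (\<phi> x *\<^sub>R (u \<nu> x - u0 x)) \<bullet> H \<nu> x \<partial>torus)"
        by (subst Bochner_Integration.integral_diff[symmetric])
           (auto intro!: integrable_inner_L2[OF L2_torus_mult_bounded[OF _ c\<phi>]] L2 \<nu>
             simp: inner_diff_left right_diff_distrib simp del: inner_scaleR_left simp flip: inner_diff_left scaleR_diff_right)
      then show "(\<integral>x. \<phi> x * (\<nu> * grad_norm_sq (u \<nu>) x) \<partial>torus) + (\<integral>x. \<phi> x * (u \<nu> x \<bullet> H \<nu> x) \<partial>torus)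
      - (\<integral>x. \<phi> x * (\<nu> * grad_norm_sq (u \<nu>) x) \<partial>torus) - (\<integral>x. (\<phi> x *\<^sub>R u0 x) \<bullet> H \<nu> x \<partial>torus)
      = (\<integral>x. (\<phi> x *\<^sub>R (u \<nu> x - u0 x)) \<bullet> H \<nu> x \<partial>torus)" by simp
    qed
  qed
qed

text \<open>Young's inequality under the weight \<open>\<phi>\<close>, which is kept in the
  \<open>\<Lambda>\<close> term and bounded by 3 in the other. \<open>M\<close> is left free: a
  fixed bound gives absolute continuity, an arbitrarily small one gives vanishing
  dissipation.\<close>

lemma dissipation_le:
  assumes \<phi>: "C1per \<phi>" and nn: "\<And>x. 0 \<le> \<phi> x" and le: "\<And>x. \<phi> x \<le> 3" and \<delta>: "0 < \<delta>"
    and M: "\<forall>\<^sub>F \<nu> in \<F>. (\<integral>x. (norm (H \<nu> x))\<^sup>2 \<partial>torus) \<le> M"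
  shows "(\<integral>x. \<phi> x \<partial>D) \<le> (\<integral>x. \<phi> x \<partial>\<Lambda>) / (2 * \<delta>) + \<delta> * (3 * M / 2)"
proof (rule tendsto_le[OF nontrivial])
  show "((\<lambda>\<nu>. (\<integral>x. \<phi> x * (norm (u \<nu> x - u0 x))\<^sup>2 \<partial>torus) / (2 * \<delta>) + \<delta> * (3 * M / 2))
      \<longlongrightarrow> (\<integral>x. \<phi> x \<partial>\<Lambda>) / (2 * \<delta>) + \<delta> * (3 * M / 2)) \<F>"
    using \<delta> by (intro tendsto_intros weak_starD[OF star_\<Lambda> \<phi>]) auto
  show "((\<lambda>\<nu>. - (\<integral>x. (\<phi> x *\<^sub>R (u \<nu> x - u0 x)) \<bullet> H \<nu> x \<partial>torus)) \<longlongrightarrow> (\<integral>x. \<phi> x \<partial>D)) \<F>"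
    using tendsto_minus[OF dissipation_limit[OF \<phi>]] by simp
  show "\<forall>\<^sub>F \<nu> in \<F>. - (\<integral>x. (\<phi> x *\<^sub>R (u \<nu> x - u0 x)) \<bullet> H \<nu> x \<partial>torus)
     \<le> (\<integral>x. \<phi> x * (norm (u \<nu> x - u0 x))\<^sup>2 \<partial>torus) / (2 * \<delta>) + \<delta> * (3 * M / 2)"
    using eventually_S M
  proof eventually_elim
    case (elim \<nu>)
    note c\<phi> = C1perD(2)[OF \<phi>]
    let ?w = "\<lambda>x. u \<nu> x - u0 x"
    have w: "L2_torus ?w" by (intro L2_torus_diff L2 elim)
    have iw: "integrable torus (\<lambda>x. \<phi> x * (norm (?w x))\<^sup>2)"
      using integrable_inner_L2[OF L2_torus_mult_bounded[OF w c\<phi>] w] by (simp add: power2_norm_eq_inner)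
    have iH: "integrable torus (\<lambda>x. (norm (H \<nu> x))\<^sup>2)" using L2(3)[OF elim(1)] by (simp add: L2_torus_def)
    have "- (\<integral>x. (\<phi> x *\<^sub>R ?w x) \<bullet> H \<nu> x \<partial>torus) = (\<integral>x. - ((\<phi> x *\<^sub>R ?w x) \<bullet> H \<nu> x) \<partial>torus)" by simp
    also have "\<dots> \<le> (\<integral>x. \<phi> x * (norm (?w x))\<^sup>2 / (2 * \<delta>) + \<delta> * (3 * (norm (H \<nu> x))\<^sup>2) / 2 \<partial>torus)"
    proof (rule integral_mono)
      show "integrable torus (\<lambda>x. - ((\<phi> x *\<^sub>R ?w x) \<bullet> H \<nu> x))"
        by (intro Bochner_Integration.integrable_minus integrable_inner_L2 L2_torus_mult_bounded w c\<phi> L2 elim)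
      show "integrable torus (\<lambda>x. \<phi> x * (norm (?w x))\<^sup>2 / (2 * \<delta>) + \<delta> * (3 * (norm (H \<nu> x))\<^sup>2) / 2)"
        using iw iH by (intro Bochner_Integration.integrable_add integrable_divide integrable_mult_right) auto
      fix x
      have "- (?w x \<bullet> H \<nu> x) \<le> \<bar>norm (?w x) * norm (H \<nu> x)\<bar>"
        using Cauchy_Schwarz_ineq2[of "?w x" "H \<nu> x"] by simp
      also have "\<dots> \<le> (norm (?w x))\<^sup>2 / (2 * \<delta>) + \<delta> * (norm (H \<nu> x))\<^sup>2 / 2" by (rule Young[OF \<delta>])
      finally have "\<phi> x * - (?w x \<bullet> H \<nu> x) \<le> \<phi> x * ((norm (?w x))\<^sup>2 / (2 * \<delta>) + \<delta> * (norm (H \<nu> x))\<^sup>2 / 2)"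
        using nn by (intro mult_left_mono) auto
      also have "\<dots> = \<phi> x * (norm (?w x))\<^sup>2 / (2 * \<delta>) + \<phi> x * (\<delta> * (norm (H \<nu> x))\<^sup>2 / 2)"
        by (simp add: distrib_left)
      also have "\<phi> x * (\<delta> * (norm (H \<nu> x))\<^sup>2 / 2) \<le> 3 * (\<delta> * (norm (H \<nu> x))\<^sup>2 / 2)"
        using le \<delta> by (intro mult_right_mono) auto
      finally show "- ((\<phi> x *\<^sub>R ?w x) \<bullet> H \<nu> x) \<le> \<phi> x * (norm (?w x))\<^sup>2 / (2 * \<delta>) + \<delta> * (3 * (norm (H \<nu> x))\<^sup>2) / 2"
        by simp
    qed
    also have "\<dots> = (\<integral>x. \<phi> x * (norm (?w x))\<^sup>2 \<partial>torus) / (2 * \<delta>) + \<delta> * (3 * (\<integral>x. (norm (H \<nu> x))\<^sup>2 \<partial>torus) / 2)"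
      using iw iH by (subst Bochner_Integration.integral_add) auto
    also have "\<dots> \<le> (\<integral>x. \<phi> x * (norm (?w x))\<^sup>2 \<partial>torus) / (2 * \<delta>) + \<delta> * (3 * M / 2)"
      using elim(2) \<delta> by (intro add_left_mono mult_left_mono) auto
    finally show ?case .
  qed
qed

lemma D_absolutely_continuous: "absolutely_continuous \<Lambda> D"
  by (rule absolutely_continuous_by_tests[OF finite_measures(1,3) dissipation_le[OF _ _ _ _ bound_H]])

text \<open>Split the force in \<open>norm_sq_H\<close> into \<open>f \<nu> - f0\<close>, which now
  tends to zero strongly, and \<open>f0\<close>, against which \<open>H\<close> tends weakly to
  zero. Thus \<open>H\<close> vanishes strongly, and testing with the constant 1 finishes.\<close>

lemma strong_force_no_dissipation:
  assumes F: "F = null_measure torus"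
  shows "D = null_measure torus"
proof -
  have "measure F cell = 0" unfolding F by (simp add: measure_def)
  then have f: "((\<lambda>\<nu>. \<integral>x. (norm (f \<nu> x - f0 x))\<^sup>2 \<partial>torus) \<longlongrightarrow> 0) \<F>"
    using weak_star_total[OF star_F] by simp
  have "((\<lambda>\<nu>. (\<integral>x. (norm (f \<nu> x - f0 x))\<^sup>2 \<partial>torus) + 2 * \<bar>\<integral>x. f0 x \<bullet> H \<nu> x \<partial>torus\<bar>) \<longlongrightarrow> 0 + 2 * \<bar>0\<bar>) \<F>"
    by (intro tendsto_intros f test_f0_H)
  then have lim: "((\<lambda>\<nu>. (\<integral>x. (norm (f \<nu> x - f0 x))\<^sup>2 \<partial>torus) + 2 * \<bar>\<integral>x. f0 x \<bullet> H \<nu> x \<partial>torus\<bar>) \<longlongrightarrow> 0) \<F>"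
    by simp
  have H: "(\<integral>x. (norm (H \<nu> x))\<^sup>2 \<partial>torus) \<le> (\<integral>x. (norm (f \<nu> x - f0 x))\<^sup>2 \<partial>torus) + 2 * \<bar>\<integral>x. f0 x \<bullet> H \<nu> x \<partial>torus\<bar>"
    if \<nu>: "\<nu> \<in> S" for \<nu>
  proof -
    have d: "L2_torus (\<lambda>x. f \<nu> x - f0 x)" by (intro L2_torus_diff L2 \<nu>)
    have "(\<integral>x. (norm (H \<nu> x))\<^sup>2 \<partial>torus) = - ((\<integral>x. (f \<nu> x - f0 x) \<bullet> H \<nu> x \<partial>torus) + (\<integral>x. f0 x \<bullet> H \<nu> x \<partial>torus))"
      unfolding norm_sq_H[OF \<nu>]
      by (subst Bochner_Integration.integral_add[symmetric])
         (auto intro!: integrable_inner_L2 d L2 \<nu> simp flip: inner_add_left)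
    moreover have "\<bar>\<integral>x. (f \<nu> x - f0 x) \<bullet> H \<nu> x \<partial>torus\<bar> \<le> (\<integral>x. (norm (f \<nu> x - f0 x))\<^sup>2 \<partial>torus) / (2 * 1)
        + 1 * (\<integral>x. (norm (H \<nu> x))\<^sup>2 \<partial>torus) / 2"
      by (intro Young_integral d L2 \<nu>) simp
    ultimately show ?thesis by linarith
  qed
  interpret D: finite_measure D by (rule finite_borel_torusD[OF finite_measures(3)])
  have "measure D cell \<le> 0"
  proof (rule field_le_epsilon)
    fix \<eta> :: real assume \<eta>: "0 < \<eta>"
    \<comment> \<open>Makes the \<open>\<Lambda>\<close> term at most \<open>\<eta> / 2\<close>; the
      bound \<open>\<eta> / (3 * \<delta>)\<close> on \<open>H\<close> then makes the other term
      \<open>\<eta> / 2\<close> as well.\<close>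
    define L \<delta> where "L = measure \<Lambda> cell + 1" and "\<delta> = L / \<eta>"
    have L: "0 < L" "measure \<Lambda> cell \<le> L" using measure_nonneg[of \<Lambda> cell] unfolding L_def by linarith+
    have \<delta>: "0 < \<delta>" using L \<eta> by (simp add: \<delta>_def)
    have "\<forall>\<^sub>F \<nu> in \<F>. (\<integral>x. (norm (f \<nu> x - f0 x))\<^sup>2 \<partial>torus) + 2 * \<bar>\<integral>x. f0 x \<bullet> H \<nu> x \<partial>torus\<bar> < \<eta> / (3 * \<delta>)"
      using \<eta> \<delta> by (intro order_tendstoD[OF lim]) simp
    then have "\<forall>\<^sub>F \<nu> in \<F>. (\<integral>x. (norm (H \<nu> x))\<^sup>2 \<partial>torus) \<le> \<eta> / (3 * \<delta>)"
      using eventually_S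
    proof eventually_elim
      case (elim \<nu>)
      then show ?case using H[OF elim(2)] by linarith
    qed
    then have "(\<integral>x. 1 \<partial>D) \<le> (\<integral>x. 1 \<partial>\<Lambda>) / (2 * \<delta>) + \<delta> * (3 * (\<eta> / (3 * \<delta>)) / 2)"
      by (intro dissipation_le C1per_const \<delta>) auto
    also have "(\<integral>x. 1 \<partial>\<Lambda>) / (2 * \<delta>) \<le> L / (2 * \<delta>)"
      using L \<delta> finite_borel_torusD(3)[OF finite_measures(1)] by (intro divide_right_mono) auto
    also have "L / (2 * \<delta>) = \<eta> / 2" using L \<eta> by (simp add: \<delta>_def)
    also have "\<delta> * (3 * (\<eta> / (3 * \<delta>)) / 2) = \<eta> / 2" using \<delta> by simp
    finally show "measure D cell \<le> 0 + \<eta>"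
      using finite_borel_torusD(3)[OF finite_measures(3)] by simp
  qed
  then have D0: "measure D cell = 0" using measure_nonneg[of D cell] by linarith
  show ?thesis
  proof (rule measure_eqI)
    show "sets D = sets (null_measure torus)" using finite_borel_torusD(2)[OF finite_measures(3)] by simp
    fix A assume "A \<in> sets D"
    then have "measure D A \<le> measure D cell"
      using sets.sets_into_space[of A D] sets.top[of D] finite_borel_torusD(3)[OF finite_measures(3)]
      by (intro D.finite_measure_mono) auto
    then have "measure D A = 0" using D0 measure_nonneg[of D A] by linarith
    then show "emeasure D A = emeasure (null_measure torus) A" by (simp add: D.emeasure_eq_measure)
  qed
qed

lemma enstrophy_limit:
  assumes \<phi>: "C1per \<phi>"
  shows "((\<lambda>\<nu>. \<integral>x. \<nu> * (\<phi> x * (curl (u \<nu>) x)\<^sup>2) \<partial>torus) \<longlongrightarrow> (\<integral>x. \<phi> x \<partial>D)) \<F>"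
proof -
  have "((\<lambda>\<nu>. (\<integral>x. \<phi> x * (\<nu> * grad_norm_sq (u \<nu>) x) \<partial>torus) - (\<integral>x. \<nu> * (\<phi> x * (curl (u \<nu>) x)\<^sup>2) \<partial>torus)) \<longlongrightarrow> 0) \<F>"
    by (rule error_term_tendsto_0[OF \<phi>])
       (rule solenoidal.grad_curl_bound[OF solenoidal_u \<phi> pos])
  from tendsto_diff[OF weak_starD[OF star_D \<phi>] this] show ?thesis by simp
qed

text \<open>Each cutoff is at most 3 and so is their sum, hence the squares sum to at most 9 and the
  Laplacian terms add up to \<open>4 * 9 * Cf\<close> whatever the size of \<open>I\<close>. Only
  the vanishing term depends on the derivatives of the cutoffs.\<close>

lemma dissipation_vorticity_test:
  assumes \<Omega>: "weak_star (\<lambda>\<nu> x. \<bar>curl (u \<nu>) x\<bar>) \<Omega> \<F>"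
    and I: "finite I" and \<phi>: "\<And>i. i \<in> I \<Longrightarrow> C1per (\<phi> i)" and nn: "\<And>i x. i \<in> I \<Longrightarrow> 0 \<le> \<phi> i x"
    and le: "\<And>x. (\<Sum>i\<in>I. \<phi> i x) \<le> 3" and \<delta>: "0 < \<delta>"
  shows "(\<Sum>i\<in>I. \<integral>x. (\<phi> i x)\<^sup>2 \<partial>D) \<le> (\<Sum>i\<in>I. (\<integral>x. \<phi> i x \<partial>\<Omega>)\<^sup>2) / (2 * \<delta>) + \<delta> * (36 * Cf)"
proof -
  have "\<exists>K. \<forall>x\<in>cell. \<bar>\<phi> i x\<bar> \<le> K \<and> (\<forall>j. \<bar>partial j (\<phi> i) x\<bar> \<le> K)" if "i \<in> I" for i
    using C1_bounds[OF \<phi>[OF that]] by metis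
  then obtain K where K: "\<And>i x. i \<in> I \<Longrightarrow> x \<in> cell \<Longrightarrow> \<bar>\<phi> i x\<bar> \<le> K i"
      "\<And>i j x. i \<in> I \<Longrightarrow> x \<in> cell \<Longrightarrow> \<bar>partial j (\<phi> i) x\<bar> \<le> K i"
    by metis
  have sq: "(\<Sum>i\<in>I. (\<phi> i x)\<^sup>2) \<le> 9" for x
  proof -
    have "(\<Sum>i\<in>I. (\<phi> i x)\<^sup>2) \<le> (\<Sum>i\<in>I. \<phi> i x * 3)"
    proof (rule sum_mono)
      fix i assume i: "i \<in> I"
      have "\<phi> i x \<le> (\<Sum>i\<in>I. \<phi> i x)" using nn I i by (intro member_le_sum) auto
      then show "(\<phi> i x)\<^sup>2 \<le> \<phi> i x * 3"
        unfolding power2_eq_square using nn[OF i] le[of x] by (intro mult_left_mono) auto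
    qed
    also have "\<dots> = (\<Sum>i\<in>I. \<phi> i x) * 3" by (simp add: sum_distrib_right)
    finally show ?thesis using le[of x] by simp
  qed
  \<comment> \<open>Collects the constants depending on the cutoffs; they occur multiplied by
    \<open>\<nu>\<close>.\<close>
  define k where "k = (\<Sum>i\<in>I. 18 * (K i)\<^sup>2)"
  have k0: "0 \<le> k" by (auto simp: k_def intro: sum_nonneg)
  show ?thesis
  proof (rule tendsto_le[OF nontrivial])
    show "((\<lambda>\<nu>. \<Sum>i\<in>I. \<integral>x. \<nu> * ((\<phi> i x)\<^sup>2 * (curl (u \<nu>) x)\<^sup>2) \<partial>torus) \<longlongrightarrow> (\<Sum>i\<in>I. \<integral>x. (\<phi> i x)\<^sup>2 \<partial>D)) \<F>"
      unfolding power2_eq_square[of "\<phi> _ _"] by (intro tendsto_sum enstrophy_limit C1per_mult \<phi>)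
    have "((\<lambda>\<nu>. (\<Sum>i\<in>I. (\<integral>x. \<phi> i x * \<bar>curl (u \<nu>) x\<bar> \<partial>torus)\<^sup>2) / (2 * \<delta>) + \<delta> * (k * \<nu> * CD + 36 * Cf))
        \<longlongrightarrow> (\<Sum>i\<in>I. (\<integral>x. \<phi> i x \<partial>\<Omega>)\<^sup>2) / (2 * \<delta>) + \<delta> * (k * 0 * CD + 36 * Cf)) \<F>"
      using \<delta> by (intro tendsto_intros weak_starD[OF \<Omega>] \<phi>) auto
    then show "((\<lambda>\<nu>. (\<Sum>i\<in>I. (\<integral>x. \<phi> i x * \<bar>curl (u \<nu>) x\<bar> \<partial>torus)\<^sup>2) / (2 * \<delta>) + \<delta> * (k * \<nu> * CD + 36 * Cf))
        \<longlongrightarrow> (\<Sum>i\<in>I. (\<integral>x. \<phi> i x \<partial>\<Omega>)\<^sup>2) / (2 * \<delta>) + \<delta> * (36 * Cf)) \<F>" by simp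
    show "\<forall>\<^sub>F \<nu> in \<F>. (\<Sum>i\<in>I. \<integral>x. \<nu> * ((\<phi> i x)\<^sup>2 * (curl (u \<nu>) x)\<^sup>2) \<partial>torus)
       \<le> (\<Sum>i\<in>I. (\<integral>x. \<phi> i x * \<bar>curl (u \<nu>) x\<bar> \<partial>torus)\<^sup>2) / (2 * \<delta>) + \<delta> * (k * \<nu> * CD + 36 * Cf)"
      using eventually_S bound_D bound_H
    proof eventually_elim
      case (elim \<nu>)
      interpret solenoidal "u \<nu>" by (rule solenoidal_u[OF elim(1)])
      define G where "G = (\<integral>x. \<nu> * grad_norm_sq (u \<nu>) x \<partial>torus)"
      have iH: "integrable torus (\<lambda>x. (norm (H \<nu> x))\<^sup>2)" using L2(3)[OF elim(1)] by (simp add: L2_torus_def)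
      have i\<phi>H: "integrable torus (\<lambda>x. (\<phi> i x)\<^sup>2 * (norm (H \<nu> x))\<^sup>2)" if "i \<in> I" for i
        using L2_torus_mult_bounded[OF L2(3)[OF elim(1)] C1perD(2)[OF \<phi>[OF that]]]
        by (simp add: L2_torus_def power_mult_distrib)
      have "(\<Sum>i\<in>I. \<integral>x. (\<phi> i x)\<^sup>2 * (norm (H \<nu> x))\<^sup>2 \<partial>torus) = (\<integral>x. (\<Sum>i\<in>I. (\<phi> i x)\<^sup>2) * (norm (H \<nu> x))\<^sup>2 \<partial>torus)"
        using i\<phi>H by (simp add: sum_distrib_right)
      also have "\<dots> \<le> (\<integral>x. 9 * (norm (H \<nu> x))\<^sup>2 \<partial>torus)"
      proof (rule integral_mono)
        show "integrable torus (\<lambda>x. (\<Sum>i\<in>I. (\<phi> i x)\<^sup>2) * (norm (H \<nu> x))\<^sup>2)"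
          unfolding sum_distrib_right using i\<phi>H by (intro Bochner_Integration.integrable_sum)
        show "(\<Sum>i\<in>I. (\<phi> i x)\<^sup>2) * (norm (H \<nu> x))\<^sup>2 \<le> 9 * (norm (H \<nu> x))\<^sup>2" for x
          by (intro mult_right_mono sq) auto
      qed (use iH in simp)
      also have "\<dots> \<le> 9 * Cf" using elim(3) by simp
      finally have HH: "(\<Sum>i\<in>I. \<integral>x. (\<phi> i x)\<^sup>2 * (norm (H \<nu> x))\<^sup>2 \<partial>torus) \<le> 9 * Cf" .
      have "(\<Sum>i\<in>I. \<integral>x. \<nu> * ((\<phi> i x)\<^sup>2 * (curl (u \<nu>) x)\<^sup>2) \<partial>torus)
        \<le> (\<Sum>i\<in>I. (\<integral>x. \<phi> i x * \<bar>curl (u \<nu>) x\<bar> \<partial>torus)\<^sup>2 / (2 * \<delta>)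
            + \<delta> * (18 * (K i)\<^sup>2 * \<nu> * G + 4 * (\<integral>x. (\<phi> i x)\<^sup>2 * (norm (H \<nu> x))\<^sup>2 \<partial>torus)))"
      proof (rule sum_mono)
        fix i assume i: "i \<in> I"
        have "\<bar>\<phi> i x\<bar> = \<phi> i x" for x using nn[OF i] by simp
        then show "(\<integral>x. \<nu> * ((\<phi> i x)\<^sup>2 * (curl (u \<nu>) x)\<^sup>2) \<partial>torus)
          \<le> (\<integral>x. \<phi> i x * \<bar>curl (u \<nu>) x\<bar> \<partial>torus)\<^sup>2 / (2 * \<delta>)
            + \<delta> * (18 * (K i)\<^sup>2 * \<nu> * G + 4 * (\<integral>x. (\<phi> i x)\<^sup>2 * (norm (H \<nu> x))\<^sup>2 \<partial>torus))"
          using local_enstrophy_bound[OF \<phi>[OF i] pos[OF elim(1)] \<delta> K[OF i]] unfolding G_def H_def by simp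
      qed
      also have "\<dots> = (\<Sum>i\<in>I. (\<integral>x. \<phi> i x * \<bar>curl (u \<nu>) x\<bar> \<partial>torus)\<^sup>2) / (2 * \<delta>)
            + \<delta> * (k * \<nu> * G + 4 * (\<Sum>i\<in>I. \<integral>x. (\<phi> i x)\<^sup>2 * (norm (H \<nu> x))\<^sup>2 \<partial>torus))"
        unfolding k_def by (simp add: sum.distrib sum_divide_distrib sum_distrib_left sum_distrib_right algebra_simps)
      also have "\<dots> \<le> (\<Sum>i\<in>I. (\<integral>x. \<phi> i x * \<bar>curl (u \<nu>) x\<bar> \<partial>torus)\<^sup>2) / (2 * \<delta>)
            + \<delta> * (k * \<nu> * CD + 4 * (9 * Cf))"
        using \<delta> HH elim(2) pos[OF elim(1)] k0 unfolding G_def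
        by (intro add_mono mult_left_mono order_refl) auto
      finally show ?case by simp
    qed
  qed
qed

text \<open>The complement has two parts: the points that are not atoms of \<open>\<Omega>\<close>,
  handled by the vorticity estimate, and the atoms of \<open>\<Omega>\<close> that
  \<open>\<Lambda>\<close> does not charge. The latter are countably many
  \<open>\<Lambda>\<close>-null points, hence \<open>D\<close>-null by absolute continuity.\<close>

lemma D_concentrated:
  assumes \<Omega>: "weak_star (\<lambda>\<nu> x. \<bar>curl (u \<nu>) x\<bar>) \<Omega> \<F>"
  shows "D = measure_restr D (atoms \<Lambda> \<inter> atoms \<Omega>)"
proof -
  have f\<Omega>: "finite_borel_torus \<Omega>" using \<Omega> by (simp add: weak_star_def)
  note fD = finite_measures(3) and f\<Lambda> = finite_measures(1)
  interpret D: finite_measure D by (rule finite_borel_torusD[OF fD])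
  let ?A = "atoms \<Lambda> \<inter> atoms \<Omega>"
  have sets: "sets \<Lambda> = sets D" "sets \<Omega> = sets D"
    using finite_borel_torusD(2) fD f\<Lambda> f\<Omega> by metis+
  have A: "?A \<in> sets D" using atoms_sets(2)[OF f\<Lambda>, of ?A] sets by simp
  have "measure D (cell - atoms \<Omega>) = 0"
    by (rule concentrated_on_atoms_by_tests[OF f\<Omega> fD dissipation_vorticity_test[OF \<Omega>]])
  moreover have "cell - atoms \<Omega> \<in> sets D"
    using atoms_sets(2)[OF f\<Omega> order_refl] sets sets.top[of D] finite_borel_torusD(3)[OF fD] by auto
  ultimately have n1: "cell - atoms \<Omega> \<in> null_sets D"
    by (intro null_setsI) (simp_all add: D.emeasure_eq_measure)
  have n2: "atoms \<Omega> - atoms \<Lambda> \<in> null_sets D"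
  proof -
    have "(\<Union>x\<in>atoms \<Omega> - atoms \<Lambda>. {x}) \<in> null_sets D"
    proof (rule null_sets_UN')
      show "countable (atoms \<Omega> - atoms \<Lambda>)" using atoms_sets(1)[OF f\<Omega>] by auto
      fix x assume x: "x \<in> atoms \<Omega> - atoms \<Lambda>"
      then have xc: "x \<in> cell" using finite_borel_torusD(3)[OF f\<Omega>] by (auto simp: atoms_def)
      then have "emeasure \<Lambda> {x} = 0" using x finite_borel_torusD(3)[OF f\<Lambda>] by (auto simp: atoms_def)
      then have "{x} \<in> null_sets \<Lambda>" using atoms_sets(3)[OF f\<Lambda> xc] by (intro null_setsI)
      then show "{x} \<in> null_sets D" using D_absolutely_continuous by (auto simp: absolutely_continuous_def)
    qed
    then show ?thesis by simp
  qed
  have null: "(cell - atoms \<Omega>) \<union> (atoms \<Omega> - atoms \<Lambda>) \<in> null_sets D" using n1 n2 by (rule null_sets.Un)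
  have eq: "emeasure D X = emeasure D (?A \<inter> X)" if X: "X \<in> sets D" for X
  proof (rule emeasure_eq_AE)
    have "AE x in D. x \<notin> (cell - atoms \<Omega>) \<union> (atoms \<Omega> - atoms \<Lambda>)" using null by (rule AE_not_in)
    then show "AE x in D. x \<in> X \<longleftrightarrow> x \<in> ?A \<inter> X"
      using AE_space by eventually_elim (auto simp: finite_borel_torusD(3)[OF fD])
  qed (use X A in auto)
  \<comment> \<open>\<open>measure_restr\<close> is built with \<open>measure_of\<close>, whose
    values are the given ones only for a genuine measure; identifying it with a density settles
    this.\<close>
  have "measure_restr D ?A = density D (indicator ?A)"
  proof -
    have "measure_restr D ?A = measure_of (space D) (sets D) (emeasure (density D (indicator ?A)))"
      unfolding measure_restr_def
    proof (rule measure_of_eq)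
      show "sets D \<subseteq> Pow (space D)" by (rule sets.space_closed)
      fix X assume "X \<in> sigma_sets (space D) (sets D)"
      then have "X \<in> sets D" by (simp add: sets.sigma_sets_eq)
      then show "emeasure D (?A \<inter> X) = emeasure (density D (indicator ?A)) X"
        using A by (simp add: emeasure_restricted)
    qed
    also have "\<dots> = density D (indicator ?A)"
      using measure_of_of_measure[of "density D (indicator ?A)"] by simp
    finally show ?thesis .
  qed
  also have "\<dots> = D"
  proof (rule measure_eqI)
    fix X assume "X \<in> sets (density D (indicator ?A))"
    then have X: "X \<in> sets D" by simp
    show "emeasure (density D (indicator ?A)) X = emeasure D X"
      unfolding eq[OF X] using A X by (simp add: emeasure_restricted)
  qed simp
  finally show ?thesis by (rule sym)
qed

end

theorem theorem1p10:
  fixes S :: "real set"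
    and u f :: "real \<Rightarrow> real^2 \<Rightarrow> real^2"
    and u0 f0 :: "real^2 \<Rightarrow> real^2"
    and \<Lambda> F D :: "(real^2) measure"
  assumes "S \<subseteq> {0<..}" and "0 islimpt S"
    and "\<And>\<nu>. \<nu> \<in> S \<Longrightarrow> smooth_torus (u \<nu>)"
    and "\<And>\<nu>. \<nu> \<in> S \<Longrightarrow> smooth_torus (f \<nu>)"
    and "\<And>\<nu>. \<nu> \<in> S \<Longrightarrow> \<exists>p. smooth_torus p \<and> stationary_NS \<nu> (u \<nu>) p (f \<nu>)"
    and "weak_L2 u u0 (at 0 within S)"
    and "weak_L2 f f0 (at 0 within S)"
    and "weak_star (\<lambda>\<nu> x. (norm (u \<nu> x - u0 x))\<^sup>2) \<Lambda> (at 0 within S)"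
    and "weak_star (\<lambda>\<nu> x. (norm (f \<nu> x - f0 x))\<^sup>2) F (at 0 within S)"
    and "weak_star (\<lambda>\<nu> x. \<nu> * grad_norm_sq (u \<nu>) x) D (at 0 within S)"
  shows "absolutely_continuous \<Lambda> D
    \<and> (F = null_measure torus \<longrightarrow> D = null_measure torus)
    \<and> (\<forall>\<Omega>. weak_star (\<lambda>\<nu> x. \<bar>curl (u \<nu>) x\<bar>) \<Omega> (at 0 within S) \<longrightarrow>
         D = measure_restr D (atoms \<Lambda> \<inter> atoms \<Omega>))"
proof -
  interpret vanishing_viscosity S u f u0 f0 \<Lambda> F D
    using assms by unfold_locales
  show ?thesis
    using D_absolutely_continuous strong_force_no_dissipation D_concentrated by blast
qed

end
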